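(* There are universal constants $n_0>0$ and $C\ge 1$ such that the following holds. Let $n\ge n_0$ be an integer, let $G$ be the standard Gaussian vector in $\mathbb{R}^n$, and let $\xi>0$ be the number such that $\mathbf{P}\{|g|\le \xi\}=1-\frac1n$, where $g$ is a standard Gaussian random variable. Then: (1) for all $p$ with $1\le p\le \frac{2\log n}{\log(2e)}$, $$C^{-1}\,\frac{2^p}{p}n^{2/p-1}\le \mathrm{Var}(\|G\|_p)\le C\,\frac{2^p}{p}n^{2/p-1};$$ (2) for all $p$ with $\frac{2\log n}{\log(2e)}\le p\le \xi^2$, $$C^{-1}V\le \mathrm{Var}(\|G\|_p)\le C\,V,\qquad V:=\frac{\exp\big(-\frac{p}{2e}n^{2/p}+\log n\big)}{\sqrt{\log n}\,\big(\sqrt{\log n}+p-\frac{2\log n}{\log(2e)}\big)};$$ (3) for all $p\ge \xi^2$, $$C^{-1}\,\frac{1}{\log n}\Big(1-\frac{\xi^2-\xi}{p}\Big)\le \mathrm{Var}(\|G\|_p)\le C\,\frac{1}{\log n}\Big(1-\frac{\xi^2-\xi}{p}\Big).$$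
   Context: $\log$ is the natural logarithm. For $1\le p<\infty$ and $x\in\mathbb{R}^n$, $\|x\|_p=(\sum_{i=1}^n|x_i|^p)^{1/p}$, and $\|x\|_\infty=\max_i|x_i|$. The parameter $p$ ranges over $[1,\infty]$; for $p=\infty$ the quantity $\frac{\xi^2-\xi}{p}$ is read as $0$. The standard Gaussian vector in $\mathbb{R}^n$ has i.i.d. standard normal coordinates. *)

theory Defs
  imports "HOL-Probability.Probability"
begin

definition std_gaussian :: "real measure" where
  "std_gaussian = density lborel (\<lambda>x. ennreal (std_normal_density x))"

text \<open>The law on \<open>\<real>\<^sup>n\<close> of a vector with i.i.d. standard normal coordinates; vectors are
  functions with index set \<open>{..<n}\<close>, so that \<open>n\<close> can be quantified inside a formula.\<close>

definition std_gaussian_vec :: "nat \<Rightarrow> (nat \<Rightarrow> real) measure" where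
  "std_gaussian_vec n = (\<Pi>\<^sub>M i\<in>{..<n}. std_gaussian)"

text \<open>Intended for \<open>n \<ge> 1\<close> (for \<open>n = 0\<close> the maximum is over the empty set) and \<open>p \<in> [1, \<infinity>]\<close>.\<close>

definition lp_norm :: "nat \<Rightarrow> ereal \<Rightarrow> (nat \<Rightarrow> real) \<Rightarrow> real" where
  "lp_norm n p x =
    (if p = \<infinity> then Max ((\<lambda>i. \<bar>x i\<bar>) ` {..<n})
     else (\<Sum>i<n. \<bar>x i\<bar> powr real_of_ereal p) powr (1 / real_of_ereal p))"

definition var_lp_norm :: "nat \<Rightarrow> ereal \<Rightarrow> real" where
  "var_lp_norm n p = prob_space.variance (std_gaussian_vec n) (lp_norm n p)"

lemma prob_space_std_gaussian: "prob_space std_gaussian"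
  unfolding std_gaussian_def by (rule prob_space_normal_density) simp

lemma prob_space_std_gaussian_vec: "prob_space (std_gaussian_vec n)"
  unfolding std_gaussian_vec_def by (rule prob_space_PiM) (rule prob_space_std_gaussian)

end

theory Submission
  imports Defs "HOL-Real_Asymp.Real_Asymp"
begin

text \<open>Why the theorem is true. Write \<open>\<parallel>G\<parallel>\<^sub>p = X powr (1 / p)\<close>, where \<open>X\<close> is the sum of the i.i.d. variables
\<open>\<bar>g\<^sub>i\<bar> powr p\<close>. The variance of a function \<open>F\<close> of \<open>n\<close> exchangeable independent coordinates lies between
\<open>n\<close> times the variance of the conditional expectation of \<open>F\<close> given one coordinate (the first level of the
Hoeffding decomposition) and \<open>n\<close> times the expected conditional variance of \<open>F\<close> in one coordinate
(Efron-Stein). For functions of a sum, both bounds come out of one telescoping identity and Jensen's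
inequality, and they are \<open>variance_sum_bounds\<close>. It is the point of the whole proof that the two bounds
agree up to a constant factor for all \<open>p\<close>, although neither of them is sharp for general functions.

What remains is one-dimensional. Let \<open>S\<close> be the sum over the other \<open>n - 1\<close> coordinates. The increment
\<open>(S + \<bar>g\<bar> powr p) powr (1 / p) - S powr (1 / p)\<close> decreases in \<open>S\<close>, but shrinks by at most the factor by
which \<open>S\<close> grows (\<open>shifted_powr_diff_antimono\<close>, \<open>shifted_powr_diff_scale\<close>). So constant factors in \<open>S\<close> are
harmless: the upper bound needs one level that \<open>S\<close> exceeds apart from a very thin lower tail, and the
lower bound needs a level that exceeds the median of \<open>S\<close>. Lower tails of sums of nonnegative variables are
thin (\<open>sum_lower_tail\<close>), and medians are controlled by Markov's inequality for a truncated sum.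

With \<open>m = S powr (1 / p)\<close>, the increment is about \<open>(m / p) * (\<bar>g\<bar> / m) powr p\<close> for \<open>\<bar>g\<bar> \<le> m\<close> and about
\<open>\<bar>g\<bar> - m\<close> beyond. Its second moment is governed by the integral of \<open>x powr (2 * p)\<close> against the Gaussian
density over \<open>\<bar>x\<bar> \<le> m\<close>, whose integrand peaks at \<open>sqrt (2 * p)\<close>; this produces the three regimes.
If the peak lies inside, which with the typical size \<open>m = n powr (1 / p) * sqrt (p / exp 1)\<close> means
\<open>p \<le> 2 * ln n / ln (2 * exp 1)\<close>, the full moment counts and gives the first formula. If the peak lies
outside, the integral is carried by a window below \<open>m\<close> of width \<open>m / (m + 2 * p - m\<^sup>2)\<close>
(\<open>truncated_moment_upper\<close>, \<open>truncated_moment_lower\<close>), and this gives the second formula.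
For \<open>p \<ge> \<xi>\<^sup>2\<close> the sum \<open>S\<close> is no longer comparable to its mean: it is made by the few coordinates of size
about \<open>\<xi>\<close>. As long as \<open>p \<le> 2 * \<xi>\<^sup>2\<close>, its typical size is \<open>\<xi> powr p / w\<close> with \<open>w = 1 - (\<xi>\<^sup>2 - \<xi>) / p\<close>; a
coordinate matters when it exceeds \<open>m = \<xi> * w powr (- 1 / p)\<close>, which has probability about \<open>w / n\<close>, and
then it moves the norm by about \<open>1 / \<xi>\<close>. For \<open>p \<ge> 2 * \<xi>\<^sup>2\<close>, where \<open>w\<close> is of order one, the norm behaves
like the maximum.
The constants do not depend on \<open>p\<close>, so that \<open>p = \<infinity>\<close> follows by passing to the limit.\<close>

section \<open>Variance of a function of a sum of i.i.d. variables\<close>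

locale iid_sum = prob_space M for M :: "'a measure" +
  fixes h :: "'a \<Rightarrow> real"
  assumes h_measurable [measurable]: "h \<in> borel_measurable M"
    and h_sq: "integrable M (\<lambda>x. (h x)\<^sup>2)"
begin

lemma h_int: "integrable M h"
  by (rule square_integrable_imp_integrable[OF h_measurable h_sq])

text \<open>The transition operator of the random walk with steps \<open>h\<close>, iterated: \<open>mean_op k \<phi> s\<close> is the
expectation of \<open>\<phi>\<close> at the walk started in \<open>s\<close> after \<open>k\<close> steps, defined by conditioning on the first one.
The twin with values in \<open>ennreal\<close> avoids all integrability questions for variances.\<close>

primrec mean_op :: "nat \<Rightarrow> (real \<Rightarrow> real) \<Rightarrow> real \<Rightarrow> real" where
  "mean_op 0 \<phi> = \<phi>"
| "mean_op (Suc k) \<phi> = (\<lambda>s. \<integral>y. mean_op k \<phi> (s + h y) \<partial>M)"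

primrec nn_mean_op :: "nat \<Rightarrow> (real \<Rightarrow> ennreal) \<Rightarrow> real \<Rightarrow> ennreal" where
  "nn_mean_op 0 u = u"
| "nn_mean_op (Suc k) u = (\<lambda>s. \<integral>\<^sup>+y. nn_mean_op k u (s + h y) \<partial>M)"

text \<open>Twice the variance of \<open>\<phi>\<close> after one step, written with an independent copy; in this form Jensen's
inequality and Tonelli's theorem apply without subtractions.\<close>

definition step_var :: "(real \<Rightarrow> real) \<Rightarrow> real \<Rightarrow> ennreal" where
  "step_var \<phi> s = (\<integral>\<^sup>+x. \<integral>\<^sup>+y. ennreal ((\<phi> (s + h x) - \<phi> (s + h y))\<^sup>2) \<partial>M \<partial>M)"

text \<open>With slope one, the class is mapped to itself by the transition operator of any integrable walk, and it
contains the \<open>p\<close>-th root for \<open>p \<ge> 1\<close>.\<close>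

definition lin_growth :: "(real \<Rightarrow> real) \<Rightarrow> bool" where
  "lin_growth \<phi> \<longleftrightarrow> \<phi> \<in> borel_measurable borel \<and> (\<exists>A. \<forall>s. \<bar>\<phi> s\<bar> \<le> A + \<bar>s\<bar>)"

lemma lin_growth_sq_integrable:
  assumes "lin_growth \<phi>"
  shows "integrable M (\<lambda>x. (\<phi> (s + h x))\<^sup>2)"
proof -
  obtain A where A: "\<And>s. \<bar>\<phi> s\<bar> \<le> A + \<bar>s\<bar>" using assms by (auto simp: lin_growth_def)
  have [measurable]: "\<phi> \<in> borel_measurable borel" using assms by (simp add: lin_growth_def)
  show ?thesis
  proof (rule Bochner_Integration.integrable_bound)
    show "integrable M (\<lambda>x. 2 * (A + \<bar>s\<bar>)\<^sup>2 + 2 * (h x)\<^sup>2)" using h_sq by simp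
    show "AE x in M. norm ((\<phi> (s + h x))\<^sup>2) \<le> norm (2 * (A + \<bar>s\<bar>)\<^sup>2 + 2 * (h x)\<^sup>2)"
    proof (rule AE_I2)
      fix x
      have "\<bar>\<phi> (s + h x)\<bar> \<le> (A + \<bar>s\<bar>) + \<bar>h x\<bar>" using A[of "s + h x"] by linarith
      then have "\<bar>\<phi> (s + h x)\<bar>\<^sup>2 \<le> ((A + \<bar>s\<bar>) + \<bar>h x\<bar>)\<^sup>2" by (intro power_mono) auto
      also have "\<dots> \<le> 2 * (A + \<bar>s\<bar>)\<^sup>2 + 2 * \<bar>h x\<bar>\<^sup>2"
        using sum_squares_ge_zero[of "(A + \<bar>s\<bar>) - \<bar>h x\<bar>" 0]
        by (simp add: power2_eq_square algebra_simps)
      finally show "norm ((\<phi> (s + h x))\<^sup>2) \<le> norm (2 * (A + \<bar>s\<bar>)\<^sup>2 + 2 * (h x)\<^sup>2)" by simp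
    qed
  qed measurable
qed

lemma lin_growth_integrable:
  assumes "lin_growth \<phi>"
  shows "integrable M (\<lambda>x. \<phi> (s + h x))"
proof -
  have [measurable]: "\<phi> \<in> borel_measurable borel" using assms by (simp add: lin_growth_def)
  show ?thesis
    by (rule square_integrable_imp_integrable[OF _ lin_growth_sq_integrable[OF assms]]) measurable
qed

lemma lin_growth_mean_op_step:
  assumes "lin_growth \<phi>"
  shows "lin_growth (\<lambda>s. \<integral>y. \<phi> (s + h y) \<partial>M)"
proof -
  obtain A where A: "\<And>s. \<bar>\<phi> s\<bar> \<le> A + \<bar>s\<bar>" using assms by (auto simp: lin_growth_def)
  have [measurable]: "\<phi> \<in> borel_measurable borel" using assms by (simp add: lin_growth_def)
  have "\<bar>\<integral>y. \<phi> (s + h y) \<partial>M\<bar> \<le> (A + (\<integral>y. \<bar>h y\<bar> \<partial>M)) + \<bar>s\<bar>" for s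
  proof -
    have "\<bar>\<integral>y. \<phi> (s + h y) \<partial>M\<bar> \<le> (\<integral>y. \<bar>\<phi> (s + h y)\<bar> \<partial>M)" by (rule integral_abs_bound)
    also have "\<dots> \<le> (\<integral>y. (A + \<bar>s\<bar>) + \<bar>h y\<bar> \<partial>M)"
    proof (rule integral_mono)
      show "integrable M (\<lambda>y. \<bar>\<phi> (s + h y)\<bar>)" using lin_growth_integrable[OF assms] by auto
      show "integrable M (\<lambda>y. (A + \<bar>s\<bar>) + \<bar>h y\<bar>)" using h_int by auto
      show "\<bar>\<phi> (s + h y)\<bar> \<le> (A + \<bar>s\<bar>) + \<bar>h y\<bar>" for y using A[of "s + h y"] by linarith
    qed
    also have "\<dots> = (A + \<bar>s\<bar>) + (\<integral>y. \<bar>h y\<bar> \<partial>M)" using h_int by (simp add: prob_space)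
    finally show ?thesis by simp
  qed
  then show ?thesis unfolding lin_growth_def by (intro conjI exI allI) (measurable, assumption)
qed

lemma lin_growth_mean_op: "lin_growth \<phi> \<Longrightarrow> lin_growth (mean_op k \<phi>)"
  by (induction k) (auto intro: lin_growth_mean_op_step)

lemma nn_mean_op_measurable [measurable]:
  "u \<in> borel_measurable borel \<Longrightarrow> nn_mean_op k u \<in> borel_measurable borel"
  by (induction k) auto

lemma step_var_measurable [measurable]:
  assumes [measurable]: "\<phi> \<in> borel_measurable borel"
  shows "step_var \<phi> \<in> borel_measurable borel"
  unfolding step_var_def by measurable

lemma mean_op_comp: "mean_op k (mean_op j \<phi>) = mean_op (k + j) \<phi>"
  by (induction k) auto

lemma nn_mean_op_comp: "nn_mean_op k (nn_mean_op j u) = nn_mean_op (k + j) u"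
  by (induction k) auto

lemma nn_mean_op_mono: "(\<And>s. u s \<le> v s) \<Longrightarrow> nn_mean_op k u s \<le> nn_mean_op k v s"
  by (induction k arbitrary: s) (auto intro!: nn_integral_mono)

text \<open>The second moment is the squared mean plus the variance; all terms are doubled to match the variance
with an independent copy.\<close>

lemma square_integral_eq:
  assumes "integrable M f" "integrable M (\<lambda>x. (f x)\<^sup>2)"
  shows "2 * (\<integral>\<^sup>+x. ennreal ((f x)\<^sup>2) \<partial>M)
    = 2 * ennreal ((\<integral>x. f x \<partial>M)\<^sup>2) + (\<integral>\<^sup>+x. \<integral>\<^sup>+y. ennreal ((f x - f y)\<^sup>2) \<partial>M \<partial>M)"
proof -
  define a where "a = (\<integral>x. f x \<partial>M)"
  define b where "b = (\<integral>x. (f x)\<^sup>2 \<partial>M)"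
  have E: "(f x - f y)\<^sup>2 = (f x)\<^sup>2 - 2 * f x * f y + (f y)\<^sup>2" for x y
    by (simp add: power2_eq_square algebra_simps)
  have inner: "(\<integral>\<^sup>+y. ennreal ((f x - f y)\<^sup>2) \<partial>M) = ennreal ((f x)\<^sup>2 - 2 * f x * a + b)" for x
  proof -
    have "(\<integral>\<^sup>+y. ennreal ((f x - f y)\<^sup>2) \<partial>M) = ennreal (\<integral>y. (f x - f y)\<^sup>2 \<partial>M)"
      using assms
      by (intro nn_integral_eq_integral AE_I2) (simp_all add: E, simp_all flip: E)
    also have "(\<integral>y. (f x - f y)\<^sup>2 \<partial>M) = (f x)\<^sup>2 - 2 * f x * a + b"
      unfolding E using assms by (simp add: a_def b_def prob_space)
    finally show ?thesis .
  qed
  have nonneg: "0 \<le> (f x)\<^sup>2 - 2 * f x * a + b" for x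
  proof -
    have "0 \<le> (\<integral>y. (f x - f y)\<^sup>2 \<partial>M)" by simp
    also have "\<dots> = (f x)\<^sup>2 - 2 * f x * a + b"
      unfolding E using assms by (simp add: a_def b_def prob_space)
    finally show ?thesis .
  qed
  have "(\<integral>\<^sup>+x. \<integral>\<^sup>+y. ennreal ((f x - f y)\<^sup>2) \<partial>M \<partial>M)
      = ennreal (\<integral>x. (f x)\<^sup>2 - 2 * f x * a + b \<partial>M)"
    unfolding inner using assms nonneg by (intro nn_integral_eq_integral) auto
  also have "(\<integral>x. (f x)\<^sup>2 - 2 * f x * a + b \<partial>M) = 2 * b - 2 * a\<^sup>2"
    using assms by (simp add: a_def[symmetric] b_def[symmetric] prob_space) (simp add: power2_eq_square)
  finally have D: "(\<integral>\<^sup>+x. \<integral>\<^sup>+y. ennreal ((f x - f y)\<^sup>2) \<partial>M \<partial>M) = ennreal (2 * b - 2 * a\<^sup>2)" .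
  have "a\<^sup>2 \<le> b"
  proof -
    have "0 \<le> (\<integral>x. (f x)\<^sup>2 - 2 * f x * a + b \<partial>M)"
      using nonneg by simp
    also have "(\<integral>x. (f x)\<^sup>2 - 2 * f x * a + b \<partial>M) = 2 * b - 2 * a\<^sup>2"
      using assms by (simp add: a_def[symmetric] b_def[symmetric] prob_space) (simp add: power2_eq_square)
    finally show ?thesis by simp
  qed
  then have "2 * ennreal (a\<^sup>2) + ennreal (2 * b - 2 * a\<^sup>2) = ennreal (2 * b)"
    by (simp add: ennreal_plus[symmetric] ennreal_mult'[symmetric] ennreal_numeral[symmetric]
        del: ennreal_plus ennreal_numeral)
  also have "\<dots> = 2 * (\<integral>\<^sup>+x. ennreal ((f x)\<^sup>2) \<partial>M)"
    using assms unfolding b_def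
    by (subst nn_integral_eq_integral) (auto simp: ennreal_mult')
  finally show ?thesis unfolding D a_def ..
qed

lemma square_integral_le: "ennreal ((\<integral>x. f x \<partial>M)\<^sup>2) \<le> (\<integral>\<^sup>+x. ennreal ((f x)\<^sup>2) \<partial>M)"
  if [measurable]: "f \<in> borel_measurable M"
proof (cases "integrable M (\<lambda>x. (f x)\<^sup>2)")
  case True
  then have f: "integrable M f" by (rule square_integrable_imp_integrable[rotated]) simp
  have "2 * ennreal ((\<integral>x. f x \<partial>M)\<^sup>2) \<le> 2 * (\<integral>\<^sup>+x. ennreal ((f x)\<^sup>2) \<partial>M)"
    unfolding square_integral_eq[OF f True] by simp
  then show ?thesis by (subst (asm) ennreal_mult_le_mult_iff) auto
next
  case False
  then have "(\<integral>\<^sup>+x. ennreal ((f x)\<^sup>2) \<partial>M) = \<infinity>"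
    by (simp add: integrable_iff_bounded) (metis less_top)
  then show ?thesis by simp
qed

text \<open>The variance of an average is at most the average of the variances: this is Jensen's inequality for
the differences of \<open>\<phi>\<close> along two copies of one step, applied to the average over the other step. Both the
Efron-Stein bound and the lower bound rest on it.\<close>

lemma step_var_mean_op_step:
  assumes "lin_growth \<phi>"
  shows "step_var (mean_op 1 \<phi>) s \<le> nn_mean_op 1 (step_var \<phi>) s"
proof -
  interpret P: pair_sigma_finite M M ..
  have [measurable]: "\<phi> \<in> borel_measurable borel" using assms by (simp add: lin_growth_def)
  have "step_var (mean_op 1 \<phi>) s = (\<integral>\<^sup>+x. \<integral>\<^sup>+y. ennreal ((\<integral>z. \<phi> (s + h z + h x) - \<phi> (s + h z + h y) \<partial>M)\<^sup>2) \<partial>M \<partial>M)"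
  proof -
    have "(\<integral>z. \<phi> (s + h z + h x) - \<phi> (s + h z + h y) \<partial>M)
        = (\<integral>z. \<phi> (s + h x + h z) \<partial>M) - (\<integral>z. \<phi> (s + h y + h z) \<partial>M)" for x y
      using lin_growth_integrable[OF assms, of "s + h x"] lin_growth_integrable[OF assms, of "s + h y"]
      by (simp add: add_ac)
    then show ?thesis unfolding step_var_def by simp
  qed
  also have "\<dots> \<le> (\<integral>\<^sup>+x. \<integral>\<^sup>+y. \<integral>\<^sup>+z. ennreal ((\<phi> (s + h z + h x) - \<phi> (s + h z + h y))\<^sup>2) \<partial>M \<partial>M \<partial>M)"
    by (intro nn_integral_mono square_integral_le) measurable
  also have "\<dots> = (\<integral>\<^sup>+x. \<integral>\<^sup>+z. \<integral>\<^sup>+y. ennreal ((\<phi> (s + h z + h x) - \<phi> (s + h z + h y))\<^sup>2) \<partial>M \<partial>M \<partial>M)"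
    by (intro nn_integral_cong P.Fubini') measurable
  also have "\<dots> = (\<integral>\<^sup>+z. \<integral>\<^sup>+x. \<integral>\<^sup>+y. ennreal ((\<phi> (s + h z + h x) - \<phi> (s + h z + h y))\<^sup>2) \<partial>M \<partial>M \<partial>M)"
    by (rule P.Fubini') measurable
  finally show ?thesis by (simp add: step_var_def)
qed

lemma step_var_mean_op:
  assumes "lin_growth \<phi>"
  shows "step_var (mean_op k \<phi>) s \<le> nn_mean_op k (step_var \<phi>) s"
proof (induction k arbitrary: s)
  case (Suc k)
  have "step_var (mean_op (Suc k) \<phi>) s = step_var (mean_op 1 (mean_op k \<phi>)) s" by simp
  also have "\<dots> \<le> nn_mean_op 1 (step_var (mean_op k \<phi>)) s" by (rule step_var_mean_op_step[OF lin_growth_mean_op[OF assms]])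
  also have "\<dots> \<le> nn_mean_op 1 (nn_mean_op k (step_var \<phi>)) s" by (rule nn_mean_op_mono) (rule Suc)
  finally show ?case by simp
qed simp

text \<open>Telescoping over the steps of the walk: the variance is the sum of the expected conditional variances
that the individual steps contribute.\<close>

lemma variance_decomposition:
  assumes "lin_growth \<phi>"
  shows "2 * nn_mean_op n (\<lambda>s. ennreal ((\<phi> s)\<^sup>2)) s
    = 2 * ennreal ((mean_op n \<phi> s)\<^sup>2) + (\<Sum>k<n. nn_mean_op k (step_var (mean_op (n - 1 - k) \<phi>)) s)"
proof (induction n arbitrary: s)
  case (Suc n)
  have [measurable]: "\<phi> \<in> borel_measurable borel" using assms by (simp add: lin_growth_def)
  have [measurable]: "mean_op k \<phi> \<in> borel_measurable borel" for k
    using lin_growth_mean_op[OF assms] by (simp add: lin_growth_def)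
  have "2 * nn_mean_op (Suc n) (\<lambda>s. ennreal ((\<phi> s)\<^sup>2)) s
      = (\<integral>\<^sup>+y. 2 * nn_mean_op n (\<lambda>s. ennreal ((\<phi> s)\<^sup>2)) (s + h y) \<partial>M)"
    by (simp add: nn_integral_cmult)
  also have "\<dots> = 2 * (\<integral>\<^sup>+y. ennreal ((mean_op n \<phi> (s + h y))\<^sup>2) \<partial>M)
      + (\<Sum>k<n. nn_mean_op (Suc k) (step_var (mean_op (n - 1 - k) \<phi>)) s)"
    unfolding Suc by (simp add: nn_integral_add nn_integral_cmult nn_integral_sum)
  also have "2 * (\<integral>\<^sup>+y. ennreal ((mean_op n \<phi> (s + h y))\<^sup>2) \<partial>M)
      = 2 * ennreal ((mean_op (Suc n) \<phi> s)\<^sup>2) + step_var (mean_op n \<phi>) s"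
    using square_integral_eq[OF lin_growth_integrable[OF lin_growth_mean_op[OF assms]]
        lin_growth_sq_integrable[OF lin_growth_mean_op[OF assms]]]
    by (simp add: step_var_def)
  also have "2 * ennreal ((mean_op (Suc n) \<phi> s)\<^sup>2) + step_var (mean_op n \<phi>) s
      + (\<Sum>k<n. nn_mean_op (Suc k) (step_var (mean_op (n - 1 - k) \<phi>)) s)
      = 2 * ennreal ((mean_op (Suc n) \<phi> s)\<^sup>2) + (\<Sum>k<Suc n. nn_mean_op k (step_var (mean_op (Suc n - 1 - k) \<phi>)) s)"
    by (subst sum.lessThan_Suc_shift) (simp add: add_ac)
  finally show ?case .
qed simp

text \<open>Each summand of the telescoped variance is pushed, by Jensen's inequality, to either end: averaging
over all other steps before taking the variance only decreases it, averaging afterwards only increases it.\<close>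

lemma variance_bounds:
  assumes "lin_growth \<phi>"
  shows "2 * ennreal ((mean_op (Suc N) \<phi> s)\<^sup>2) + of_nat (Suc N) * step_var (mean_op N \<phi>) s
      \<le> 2 * nn_mean_op (Suc N) (\<lambda>s. ennreal ((\<phi> s)\<^sup>2)) s" (is ?A)
    and "2 * nn_mean_op (Suc N) (\<lambda>s. ennreal ((\<phi> s)\<^sup>2)) s
      \<le> 2 * ennreal ((mean_op (Suc N) \<phi> s)\<^sup>2) + of_nat (Suc N) * nn_mean_op N (step_var \<phi>) s" (is ?B)
proof -
  have 1: "step_var (mean_op N \<phi>) s \<le> nn_mean_op k (step_var (mean_op (N - k) \<phi>)) s" if "k \<le> N" for k
    using step_var_mean_op[OF lin_growth_mean_op[OF assms], where k = k and s = s and k1 = "N - k"] that by (simp add: mean_op_comp)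
  have 2: "nn_mean_op k (step_var (mean_op (N - k) \<phi>)) s \<le> nn_mean_op N (step_var \<phi>) s" if "k \<le> N" for k
    using nn_mean_op_mono[of "step_var (mean_op (N - k) \<phi>)" "nn_mean_op (N - k) (step_var \<phi>)" k s, OF step_var_mean_op[OF assms]] that by (simp add: nn_mean_op_comp)
  have "of_nat (Suc N) * step_var (mean_op N \<phi>) s = (\<Sum>k<Suc N. step_var (mean_op N \<phi>) s)" by simp
  also have "\<dots> \<le> (\<Sum>k<Suc N. nn_mean_op k (step_var (mean_op (N - k) \<phi>)) s)" by (intro sum_mono 1) auto
  finally show ?A unfolding variance_decomposition[OF assms, of "Suc N"]
    by (intro add_left_mono) simp
  have "(\<Sum>k<Suc N. nn_mean_op k (step_var (mean_op (N - k) \<phi>)) s) \<le> (\<Sum>k<Suc N. nn_mean_op N (step_var \<phi>) s)"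
    by (intro sum_mono 2) auto
  also have "\<dots> = of_nat (Suc N) * nn_mean_op N (step_var \<phi>) s" by simp
  finally show ?B unfolding variance_decomposition[OF assms, of "Suc N"]
    by (intro add_left_mono) simp
qed

end

lemma exp_minus_le_quadratic:
  fixes t :: real
  assumes "0 \<le> t"
  shows "exp (- t) \<le> 1 - t + t\<^sup>2 / 2"
proof -
  define g where "g u = 1 - u + u\<^sup>2 / 2 - exp (- u)" for u :: real
  have "g 0 \<le> g t"
  proof (rule DERIV_nonneg_imp_nondecreasing[OF assms])
    fix u :: real assume "0 \<le> u" "u \<le> t"
    have "(g has_real_derivative (u - 1 + exp (- u))) (at u)"
      unfolding g_def by (auto intro!: derivative_eq_intros)
    moreover have "0 \<le> u - 1 + exp (- u)" using exp_ge_add_one_self[of "- u"] by linarith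
    ultimately show "\<exists>y. (g has_real_derivative y) (at u) \<and> 0 \<le> y" by blast
  qed
  then show ?thesis by (simp add: g_def)
qed

context iid_sum
begin

abbreviation iid_law :: "nat \<Rightarrow> (nat \<Rightarrow> 'a) measure" where
  "iid_law n \<equiv> (\<Pi>\<^sub>M i\<in>{..<n}. M)"

text \<open>The end point of the walk on the product space; \<open>nn_integral_iid_law\<close> and \<open>integral_iid_law\<close> identify its
law with the iterated transition operator.\<close>

definition isum :: "nat \<Rightarrow> (nat \<Rightarrow> 'a) \<Rightarrow> real" where
  "isum n x = (\<Sum>i<n. h (x i))"

lemma prob_space_iid_law: "prob_space (iid_law n)"
  by (rule prob_space_PiM) unfold_locales

lemma isum_measurable [measurable]: "isum n \<in> borel_measurable (iid_law n)"
  unfolding isum_def by measurable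

lemma distr_iid_law_component: "i < n \<Longrightarrow> distr (iid_law n) M (\<lambda>x. x i) = M"
  using prob_space_axioms by (intro distr_PiM_component) auto

lemma nn_integral_iid_law_component:
  assumes "i < n" and [measurable]: "u \<in> borel_measurable M"
  shows "(\<integral>\<^sup>+x. u (x i) \<partial>iid_law n) = (\<integral>\<^sup>+x. u x \<partial>M)"
proof -
  have "(\<integral>\<^sup>+x. u x \<partial>distr (iid_law n) M (\<lambda>x. x i)) = (\<integral>\<^sup>+x. u (x i) \<partial>iid_law n)"
    using assms by (intro nn_integral_distr) auto
  then show ?thesis using distr_iid_law_component[OF assms(1)] by simp
qed

lemma nn_integral_iid_law:
  assumes [measurable]: "u \<in> borel_measurable borel"
  shows "(\<integral>\<^sup>+x. u (s + isum n x) \<partial>iid_law n) = nn_mean_op n u s"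
proof (induction n arbitrary: s)
  case 0
  then show ?case by (simp add: isum_def space_PiM)
next
  case (Suc n)
  interpret P: product_sigma_finite "\<lambda>_::nat. M" by standard
  have isum: "isum (Suc n) (x(n := y)) = h y + isum n x" for x y
    by (simp add: isum_def)
  have "(\<integral>\<^sup>+x. u (s + isum (Suc n) x) \<partial>iid_law (Suc n)) = (\<integral>\<^sup>+x. u (s + isum (Suc n) x) \<partial>Pi\<^sub>M (insert n {..<n}) (\<lambda>_. M))"
    by (simp add: lessThan_Suc)
  also have "\<dots> = (\<integral>\<^sup>+y. \<integral>\<^sup>+x. u (s + isum (Suc n) (x(n := y))) \<partial>iid_law n \<partial>M)"
    by (rule P.product_nn_integral_insert_rev) (auto simp: lessThan_Suc[symmetric])
  also have "\<dots> = (\<integral>\<^sup>+y. nn_mean_op n u (s + h y) \<partial>M)"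
    unfolding isum using Suc[of "s + h _"] by (simp add: add.assoc)
  finally show ?case by simp
qed

lemma isum_sq_integrable: "integrable (iid_law n) (\<lambda>x. (isum n x)\<^sup>2)"
proof (rule Bochner_Integration.integrable_bound)
  have "integrable (distr (iid_law n) M (\<lambda>x. x i)) (\<lambda>x. (h x)\<^sup>2)" if "i < n" for i
    using distr_iid_law_component[OF that] h_sq by simp
  then have "integrable (iid_law n) (\<lambda>x. (h (x i))\<^sup>2)" if "i < n" for i
    using that by (intro integrable_distr_eq[THEN iffD1, of "\<lambda>x. x i" "iid_law n" M "\<lambda>y. (h y)\<^sup>2"]) auto
  then show "integrable (iid_law n) (\<lambda>x. real n * (\<Sum>i<n. (h (x i))\<^sup>2))" by auto
  show "AE x in iid_law n. norm ((isum n x)\<^sup>2) \<le> norm (real n * (\<Sum>i<n. (h (x i))\<^sup>2))"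
  proof (rule AE_I2)
    fix x
    have "(isum n x)\<^sup>2 \<le> real n * (\<Sum>i<n. (h (x i))\<^sup>2)"
      unfolding isum_def using sum_squared_le_sum_of_squares[of "\<lambda>i. h (x i)" "{..<n}"] by (simp add: mult.commute)
    then show "norm ((isum n x)\<^sup>2) \<le> norm (real n * (\<Sum>i<n. (h (x i))\<^sup>2))"
      by (simp add: sum_nonneg)
  qed
qed measurable

lemma lin_growth_sum_sq_integrable:
  assumes "lin_growth \<phi>"
  shows "integrable (iid_law n) (\<lambda>x. (\<phi> (s + isum n x))\<^sup>2)"
proof -
  interpret P: prob_space "iid_law n" by (rule prob_space_iid_law)
  interpret L: iid_sum "iid_law n" "isum n" by unfold_locales (use isum_sq_integrable in auto)
  show ?thesis using L.lin_growth_sq_integrable assms unfolding lin_growth_def L.lin_growth_def by blast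
qed

lemma lin_growth_sum_integrable:
  assumes "lin_growth \<phi>"
  shows "integrable (iid_law n) (\<lambda>x. \<phi> (s + isum n x))"
proof -
  interpret P: prob_space "iid_law n" by (rule prob_space_iid_law)
  interpret L: iid_sum "iid_law n" "isum n" by unfold_locales (use isum_sq_integrable in auto)
  show ?thesis using L.lin_growth_integrable assms unfolding lin_growth_def L.lin_growth_def by blast
qed

lemma mean_op_nonneg: "(\<And>s. 0 \<le> \<phi> s) \<Longrightarrow> 0 \<le> mean_op k \<phi> s"
  by (induction k arbitrary: s) auto

lemma ennreal_mean_op:
  assumes "lin_growth \<phi>" "\<And>s. 0 \<le> \<phi> s"
  shows "ennreal (mean_op k \<phi> s) = nn_mean_op k (\<lambda>s. ennreal (\<phi> s)) s"
proof (induction k arbitrary: s)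
  case (Suc k)
  have "ennreal (mean_op (Suc k) \<phi> s) = (\<integral>\<^sup>+y. ennreal (mean_op k \<phi> (s + h y)) \<partial>M)"
    using lin_growth_integrable[OF lin_growth_mean_op[OF assms(1)]] mean_op_nonneg[OF assms(2)]
    by (simp add: nn_integral_eq_integral)
  then show ?case using Suc by simp
qed simp

lemma integral_iid_law:
  assumes "lin_growth \<phi>" "\<And>s. 0 \<le> \<phi> s"
  shows "(\<integral>x. \<phi> (s + isum n x) \<partial>iid_law n) = mean_op n \<phi> s"
proof -
  have [measurable]: "\<phi> \<in> borel_measurable borel" using assms by (simp add: lin_growth_def)
  have "ennreal (\<integral>x. \<phi> (s + isum n x) \<partial>iid_law n) = (\<integral>\<^sup>+x. ennreal (\<phi> (s + isum n x)) \<partial>iid_law n)"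
    using lin_growth_sum_integrable[OF assms(1)] assms(2) by (simp add: nn_integral_eq_integral)
  also have "\<dots> = nn_mean_op n (\<lambda>s. ennreal (\<phi> s)) s"
    by (rule nn_integral_iid_law) measurable
  also have "\<dots> = ennreal (mean_op n \<phi> s)" using ennreal_mean_op[OF assms] by simp
  finally show ?thesis using assms(2) mean_op_nonneg[OF assms(2)]
    by (subst (asm) ennreal_inj) auto
qed

text \<open>The lower bound keeps only the first-order part of the Hoeffding decomposition, the upper bound is the
Efron-Stein inequality. In both, the factor two comes from the doubled one-step variance.\<close>

lemma variance_sum_bounds:
  fixes N :: nat
  assumes "lin_growth \<phi>" "\<And>s. 0 \<le> \<phi> s"
  defines "V \<equiv> prob_space.variance (iid_law (Suc N)) (\<lambda>x. \<phi> (isum (Suc N) x))"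
  shows "of_nat (Suc N) * step_var (\<lambda>t. \<integral>x. \<phi> (t + isum N x) \<partial>iid_law N) 0 \<le> ennreal (2 * V)"
    and "ennreal (2 * V) \<le> of_nat (Suc N) * (\<integral>\<^sup>+x. step_var \<phi> (isum N x) \<partial>iid_law N)"
proof -
  interpret P: prob_space "iid_law (Suc N)" by (rule prob_space_iid_law)
  have [measurable]: "\<phi> \<in> borel_measurable borel" using assms by (simp add: lin_growth_def)
  define a where "a = (\<integral>x. \<phi> (isum (Suc N) x) \<partial>iid_law (Suc N))"
  define b where "b = (\<integral>x. (\<phi> (isum (Suc N) x))\<^sup>2 \<partial>iid_law (Suc N))"
  have sq: "integrable (iid_law (Suc N)) (\<lambda>x. (\<phi> (isum (Suc N) x))\<^sup>2)"
    using lin_growth_sum_sq_integrable[OF assms(1), of "Suc N" 0] by simp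
  have a: "mean_op (Suc N) \<phi> 0 = a"
    unfolding a_def using integral_iid_law[OF assms(1,2), where s = 0 and n = "Suc N"] by simp
  have b: "nn_mean_op (Suc N) (\<lambda>s. ennreal ((\<phi> s)\<^sup>2)) 0 = ennreal b"
  proof -
    have "nn_mean_op (Suc N) (\<lambda>s. ennreal ((\<phi> s)\<^sup>2)) 0 = (\<integral>\<^sup>+x. ennreal ((\<phi> (0 + isum (Suc N) x))\<^sup>2) \<partial>iid_law (Suc N))"
      by (rule nn_integral_iid_law[symmetric]) measurable
    also have "\<dots> = ennreal b" unfolding b_def using sq by (simp add: nn_integral_eq_integral)
    finally show ?thesis .
  qed
  have V: "V = b - a\<^sup>2" unfolding V_def a_def b_def
    using lin_growth_sum_integrable[OF assms(1), of "Suc N" 0] sq by (subst P.variance_eq) auto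
  have ab: "2 * ennreal b = 2 * ennreal (a\<^sup>2) + ennreal (2 * V)"
  proof -
    have "0 \<le> V" unfolding V_def by simp
    then have "ennreal (2 * b) = ennreal (2 * a\<^sup>2) + ennreal (2 * V)"
      by (subst ennreal_plus[symmetric]) (auto simp: V)
    then show ?thesis by (simp add: ennreal_mult')
  qed
  have N: "mean_op N \<phi> = (\<lambda>t. \<integral>x. \<phi> (t + isum N x) \<partial>iid_law N)"
    using integral_iid_law[OF assms(1,2)] by auto
  have D: "nn_mean_op N (step_var \<phi>) 0 = (\<integral>\<^sup>+x. step_var \<phi> (isum N x) \<partial>iid_law N)"
    using nn_integral_iid_law[of "step_var \<phi>", where s = 0 and n = N] by simp
  have "2 * ennreal (a\<^sup>2) + of_nat (Suc N) * step_var (mean_op N \<phi>) 0 \<le> 2 * ennreal (a\<^sup>2) + ennreal (2 * V)"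
    using variance_bounds(1)[OF assms(1), of N 0] unfolding a b ab .
  then have "of_nat (Suc N) * step_var (mean_op N \<phi>) 0 \<le> ennreal (2 * V)"
    by (subst (asm) ennreal_add_left_cancel_le) (auto simp: ennreal_mult_eq_top_iff)
  then show "of_nat (Suc N) * step_var (\<lambda>t. \<integral>x. \<phi> (t + isum N x) \<partial>iid_law N) 0 \<le> ennreal (2 * V)"
    unfolding N .
  have "2 * ennreal (a\<^sup>2) + ennreal (2 * V) \<le> 2 * ennreal (a\<^sup>2) + of_nat (Suc N) * nn_mean_op N (step_var \<phi>) 0"
    using variance_bounds(2)[OF assms(1), of N 0] unfolding a b ab .
  then have "ennreal (2 * V) \<le> of_nat (Suc N) * nn_mean_op N (step_var \<phi>) 0"
    by (subst (asm) ennreal_add_left_cancel_le) (auto simp: ennreal_mult_eq_top_iff)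
  then show "ennreal (2 * V) \<le> of_nat (Suc N) * (\<integral>\<^sup>+x. step_var \<phi> (isum N x) \<partial>iid_law N)"
    unfolding D .
qed

lemma step_var_le_increment:
  assumes [measurable]: "\<phi> \<in> borel_measurable borel"
  shows "step_var \<phi> s \<le> 4 * (\<integral>\<^sup>+x. ennreal ((\<phi> (s + h x) - \<phi> s)\<^sup>2) \<partial>M)"
proof -
  define f where "f x = \<phi> (s + h x) - \<phi> s" for x
  have [measurable]: "f \<in> borel_measurable M" unfolding f_def by measurable
  have le: "(a - b)\<^sup>2 \<le> 2 * a\<^sup>2 + 2 * b\<^sup>2" for a b :: real
    using zero_le_power2[of "a + b"] by (simp add: power2_eq_square algebra_simps)
  have "step_var \<phi> s = (\<integral>\<^sup>+x. \<integral>\<^sup>+y. ennreal ((f x - f y)\<^sup>2) \<partial>M \<partial>M)"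
    by (simp add: step_var_def f_def)
  also have "\<dots> \<le> (\<integral>\<^sup>+x. \<integral>\<^sup>+y. ennreal (2 * (f x)\<^sup>2 + 2 * (f y)\<^sup>2) \<partial>M \<partial>M)"
    by (intro nn_integral_mono ennreal_leI le)
  also have "\<dots> = (\<integral>\<^sup>+x. \<integral>\<^sup>+y. 2 * ennreal ((f x)\<^sup>2) + 2 * ennreal ((f y)\<^sup>2) \<partial>M \<partial>M)"
    by (simp add: ennreal_mult')
  also have "\<dots> = 2 * (\<integral>\<^sup>+x. ennreal ((f x)\<^sup>2) \<partial>M) + 2 * (\<integral>\<^sup>+x. ennreal ((f x)\<^sup>2) \<partial>M)"
    by (simp add: nn_integral_add nn_integral_cmult emeasure_space_1)
  also have "\<dots> = 4 * (\<integral>\<^sup>+x. ennreal ((f x)\<^sup>2) \<partial>M)"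
    by (simp flip: distrib_right)
  finally show ?thesis by (simp add: f_def)
qed

section \<open>Tails of sums of i.i.d. nonnegative variables\<close>

text \<open>Markov's inequality; with suitable \<open>y\<close> it covers union bounds as well.\<close>

lemma sum_ge_one_prob:
  assumes [measurable]: "y \<in> borel_measurable M"
  shows "emeasure (iid_law N) {x \<in> space (iid_law N). 1 \<le> (\<Sum>i<N. y (x i))} \<le> of_nat N * (\<integral>\<^sup>+x. y x \<partial>M)" (is "?L \<le> _")
proof -
  have "?L = (\<integral>\<^sup>+x. indicator {x \<in> space (iid_law N). 1 \<le> (\<Sum>i<N. y (x i))} x \<partial>iid_law N)" by simp
  also have "\<dots> \<le> (\<integral>\<^sup>+x. (\<Sum>i<N. y (x i)) \<partial>iid_law N)"
    by (intro nn_integral_mono) (auto split: split_indicator)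
  also have "\<dots> = (\<Sum>i<N. \<integral>\<^sup>+x. y (x i) \<partial>iid_law N)"
    by (intro nn_integral_sum) auto
  also have "\<dots> = (\<Sum>i<N. \<integral>\<^sup>+x. y x \<partial>M)"
    by (intro sum.cong refl nn_integral_iid_law_component) auto
  finally show ?thesis by simp
qed

text \<open>Chernoff's bound for nonnegative summands. The lower tail of a nonnegative variable is subgaussian with
its second moment as variance proxy, because \<open>exp (- t) \<le> 1 - t + t\<^sup>2 / 2\<close> for all \<open>t \<ge> 0\<close>; no upper tail enters.\<close>

lemma sum_lower_tail:
  fixes Y :: "'a \<Rightarrow> real"
  assumes Y: "integrable M Y" "integrable M (\<lambda>x. (Y x)\<^sup>2)" "\<And>x. 0 \<le> Y x"
    and m: "0 \<le> m" "m \<le> (\<integral>x. Y x \<partial>M)" and v: "0 < v" "(\<integral>x. (Y x)\<^sup>2 \<partial>M) \<le> v"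
  shows "emeasure (iid_law N) {x \<in> space (iid_law N). (\<Sum>i<N. Y (x i)) \<le> real N * m / 2}
    \<le> ennreal (exp (- (real N * m\<^sup>2 / (8 * v))))" (is "?L \<le> _")
proof -
  interpret P: product_sigma_finite "\<lambda>_::nat. M" by standard
  have [measurable]: "Y \<in> borel_measurable M" using Y by auto
  \<comment> \<open>the minimizer of the exponent \<open>s * m / 2 - s * m + s\<^sup>2 * v / 2\<close>\<close>
  define s where "s = m / (2 * v)"
  have s: "0 \<le> s" using m v by (simp add: s_def)
  note quad = exp_minus_le_quadratic
  have one: "(\<integral>\<^sup>+x. ennreal (exp (- s * Y x)) \<partial>M) \<le> ennreal (exp (- s * m + s\<^sup>2 * v / 2))"
  proof -
    have "(\<integral>\<^sup>+x. ennreal (exp (- s * Y x)) \<partial>M) \<le> (\<integral>\<^sup>+x. ennreal (1 - s * Y x + (s * Y x)\<^sup>2 / 2) \<partial>M)"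
      using quad[of "s * Y _"] s Y(3) by (intro nn_integral_mono ennreal_leI) auto
    also have "\<dots> = ennreal (\<integral>x. 1 - s * Y x + (s * Y x)\<^sup>2 / 2 \<partial>M)"
    proof (rule nn_integral_eq_integral)
      show "integrable M (\<lambda>x. 1 - s * Y x + (s * Y x)\<^sup>2 / 2)"
        using Y by (auto simp: power_mult_distrib)
      show "AE x in M. 0 \<le> 1 - s * Y x + (s * Y x)\<^sup>2 / 2"
      proof (rule AE_I2)
        fix x show "0 \<le> 1 - s * Y x + (s * Y x)\<^sup>2 / 2"
          using quad[of "s * Y x"] s Y(3)[of x] exp_ge_zero[of "- (s * Y x)"]
          by (smt (verit) mult_nonneg_nonneg)
      qed
    qed
    also have "(\<integral>x. 1 - s * Y x + (s * Y x)\<^sup>2 / 2 \<partial>M)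
        = 1 - s * (\<integral>x. Y x \<partial>M) + s\<^sup>2 * (\<integral>x. (Y x)\<^sup>2 \<partial>M) / 2"
      using Y by (simp add: power_mult_distrib prob_space)
    also have "\<dots> \<le> 1 + (- s * m + s\<^sup>2 * v / 2)"
      using mult_left_mono[OF m(2) s] mult_left_mono[OF v(2), of "s\<^sup>2"] by simp
    also have "\<dots> \<le> exp (- s * m + s\<^sup>2 * v / 2)" by (rule exp_ge_add_one_self)
    finally show ?thesis by (simp add: ennreal_leI)
  qed
  have "?L = (\<integral>\<^sup>+x. indicator {x \<in> space (iid_law N). (\<Sum>i<N. Y (x i)) \<le> real N * m / 2} x \<partial>iid_law N)" by simp
  also have "\<dots> \<le> (\<integral>\<^sup>+x. ennreal (exp (s * (real N * m / 2))) * (\<Prod>i<N. ennreal (exp (- s * Y (x i)))) \<partial>iid_law N)"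
  proof (intro nn_integral_mono)
    fix x
    have "(\<Prod>i<N. ennreal (exp (- s * Y (x i)))) = ennreal (\<Prod>i<N. exp (- s * Y (x i)))"
      by (simp add: prod_ennreal)
    also have "(\<Prod>i<N. exp (- s * Y (x i))) = exp (- s * (\<Sum>i<N. Y (x i)))"
      by (simp add: sum_distrib_left exp_sum)
    finally have E: "ennreal (exp (s * (real N * m / 2))) * (\<Prod>i<N. ennreal (exp (- s * Y (x i))))
       = ennreal (exp (s * (real N * m / 2 - (\<Sum>i<N. Y (x i)))))"
      by (simp add: ennreal_mult[symmetric] exp_add[symmetric] algebra_simps)
    have "1 \<le> exp (s * (real N * m / 2 - (\<Sum>i<N. Y (x i))))"
      if "(\<Sum>i<N. Y (x i)) \<le> real N * m / 2" using that s by simp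
    then show "indicator {x \<in> space (iid_law N). (\<Sum>i<N. Y (x i)) \<le> real N * m / 2} x
      \<le> ennreal (exp (s * (real N * m / 2))) * (\<Prod>i<N. ennreal (exp (- s * Y (x i))))"
      unfolding E by (auto split: split_indicator)
  qed
  also have "\<dots> = ennreal (exp (s * (real N * m / 2))) * (\<Prod>i<N. \<integral>\<^sup>+x. ennreal (exp (- s * Y x)) \<partial>M)"
    by (subst nn_integral_cmult, measurable) (subst P.product_nn_integral_prod, auto)
  also have "\<dots> \<le> ennreal (exp (s * (real N * m / 2))) * (\<Prod>i<N. ennreal (exp (- s * m + s\<^sup>2 * v / 2)))"
    by (intro mult_left_mono prod_mono_ennreal one) auto
  also have "\<dots> = ennreal (exp (s * (real N * m / 2)) * exp (real N * (- s * m + s\<^sup>2 * v / 2)))"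
    by (simp add: ennreal_mult ennreal_power exp_of_nat_mult)
  also have "\<dots> = ennreal (exp (- (real N * m\<^sup>2 / (8 * v))))"
  proof -
    have "s * (real N * m / 2) + real N * (- s * m + s\<^sup>2 * v / 2) = - (real N * m\<^sup>2 / (8 * v))"
      using v by (simp add: s_def field_simps power2_eq_square)
    then show ?thesis by (simp flip: exp_add)
  qed
  finally show ?thesis .
qed

text \<open>For summands bounded by \<open>b\<close> the second moment is at most \<open>b\<close> times the mean, so the exponent is linear
in the number of summands that contribute on the scale \<open>b\<close>.\<close>

lemma bounded_sum_lower_tail:
  fixes Y :: "'a \<Rightarrow> real"
  assumes [measurable]: "Y \<in> borel_measurable M" and Y: "\<And>x. 0 \<le> Y x" "\<And>x. Y x \<le> b" and b: "0 < b"
    and m: "m \<le> (\<integral>x. Y x \<partial>M)" and q: "b * q \<le> (\<integral>x. Y x \<partial>M)"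
  shows "emeasure (iid_law N) {x \<in> space (iid_law N). (\<Sum>i<N. Y (x i)) \<le> real N * m / 2}
    \<le> ennreal (exp (- (real N * q / 8)))" (is "?L \<le> _")
proof (cases "(\<integral>x. Y x \<partial>M) = 0")
  case True
  interpret P: prob_space "iid_law N" by (rule prob_space_iid_law)
  have "q \<le> 0" using q b unfolding True by (simp add: mult_le_0_iff)
  then have "(0::real) \<le> - (real N * q / 8)" by (simp add: mult_nonneg_nonpos)
  then have "1 \<le> exp (- (real N * q / 8))" by simp
  then have "1 \<le> ennreal (exp (- (real N * q / 8)))" by simp
  then show ?thesis using P.emeasure_le_1 order_trans by blast
next
  case False
  define e where "e = (\<integral>x. Y x \<partial>M)"
  have e: "0 < e" using False Y unfolding e_def by (simp add: less_le)
  have i: "integrable M Y" by (rule integrable_const_bound[of _ b]) (use Y in auto)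
  have i2: "integrable M (\<lambda>x. (Y x)\<^sup>2)"
    by (rule integrable_const_bound[of _ "b\<^sup>2"]) (use Y in \<open>auto simp: power_mono\<close>)
  have "(\<integral>x. (Y x)\<^sup>2 \<partial>M) \<le> (\<integral>x. b * Y x \<partial>M)"
    using i i2 Y by (intro integral_mono) (auto simp: power2_eq_square mult_right_mono)
  then have v: "(\<integral>x. (Y x)\<^sup>2 \<partial>M) \<le> b * e" by (simp add: e_def)
  have "?L \<le> emeasure (iid_law N) {x \<in> space (iid_law N). (\<Sum>i<N. Y (x i)) \<le> real N * e / 2}"
  proof (rule emeasure_mono)
    have "real N * m / 2 \<le> real N * e / 2"
      using m by (intro divide_right_mono mult_left_mono) (auto simp: e_def)
    then show "{x \<in> space (iid_law N). (\<Sum>i<N. Y (x i)) \<le> real N * m / 2}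
      \<subseteq> {x \<in> space (iid_law N). (\<Sum>i<N. Y (x i)) \<le> real N * e / 2}" by auto
  qed measurable
  also have "\<dots> \<le> ennreal (exp (- (real N * e\<^sup>2 / (8 * (b * e)))))"
    by (rule sum_lower_tail) (use i i2 Y e b v in \<open>auto simp: e_def\<close>)
  also have "\<dots> \<le> ennreal (exp (- (real N * q / 8)))"
  proof (rule ennreal_leI)
    have "q \<le> e / b" using q b by (simp add: e_def field_simps)
    then have "real N * q \<le> real N * (e / b)" by (intro mult_left_mono) auto
    moreover have "real N * e\<^sup>2 / (8 * (b * e)) = real N * (e / b) / 8"
      using e b by (simp add: power2_eq_square field_simps)
    ultimately show "exp (- (real N * e\<^sup>2 / (8 * (b * e)))) \<le> exp (- (real N * q / 8))" by simp
  qed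
  finally show ?thesis .
qed

end

section \<open>Gaussian integrals\<close>

lemma sets_std_gaussian [measurable_cong, simp]: "sets std_gaussian = sets borel"
  by (simp add: std_gaussian_def)

lemma space_std_gaussian [simp]: "space std_gaussian = UNIV"
  by (simp add: std_gaussian_def)

abbreviation gauss_int :: "(real \<Rightarrow> real) \<Rightarrow> ennreal" where
  "gauss_int f \<equiv> \<integral>\<^sup>+x. ennreal (f x) \<partial>std_gaussian"

lemma nn_integral_std_gaussian:
  assumes [measurable]: "u \<in> borel_measurable borel"
  shows "gauss_int (\<lambda>x. u x)
    = (\<integral>\<^sup>+x. ennreal (1 / sqrt (2 * pi) * (exp (- x\<^sup>2 / 2) * u x)) \<partial>lborel)"
  unfolding std_gaussian_def
  by (subst nn_integral_density) (auto simp: std_normal_density_def ennreal_mult'[symmetric] mult.assoc)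

lemma sqrt_2pi_bounds: "2 \<le> sqrt (2 * pi)" "sqrt (2 * pi) \<le> 3"
  using pi_gt3 pi_less_4 by (auto intro: real_le_rsqrt real_le_lsqrt)

lemma nn_integral_exp_tail:
  fixes a m :: real
  assumes "0 < a"
  shows "(\<integral>\<^sup>+x. ennreal (exp (- a * (x - m))) * indicator {m..} x \<partial>lborel) = ennreal (1 / a)"
proof -
  have "(\<integral>\<^sup>+x. ennreal (exp (- a * (x - m))) * indicator {m..} x \<partial>lborel)
      = ennreal (0 - (- (1 / a) * exp (- a * (m - m))))"
  proof (rule nn_integral_FTC_atLeast[where F = "\<lambda>x. - (1 / a) * exp (- a * (x - m))"])
    show "((\<lambda>x. - (1 / a) * exp (- a * (x - m))) \<longlongrightarrow> 0) at_top"
    proof -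
      have "((\<lambda>x. exp (- a * (x - m))) \<longlongrightarrow> 0) at_top"
      proof (rule filterlim_compose[OF exp_at_bot])
        have "filterlim (\<lambda>x. - m + x) at_top at_top"
          by (rule filterlim_tendsto_add_at_top[OF tendsto_const filterlim_ident])
        then have "filterlim (\<lambda>x. (- a) * (- m + x)) at_bot at_top"
          by (rule filterlim_tendsto_neg_mult_at_bot[OF tendsto_const, rotated]) (use assms in simp)
        then show "filterlim (\<lambda>x. - a * (x - m)) at_bot at_top" by (simp add: add.commute)
      qed
      from tendsto_mult_left[OF this, of "- (1 / a)"] show ?thesis by simp
    qed
    show "DERIV (\<lambda>x. - (1 / a) * exp (- a * (x - m))) x :> exp (- a * (x - m))" for x
      using assms by (auto intro!: derivative_eq_intros)
  qed auto
  then show ?thesis by simp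
qed

lemma nn_integral_exp_tail_reflected:
  fixes a m :: real
  assumes "0 < a"
  shows "(\<integral>\<^sup>+x. ennreal (exp (- a * (- x - m))) * indicator {m..} (- x) \<partial>lborel) = ennreal (1 / a)"
  using nn_integral_real_affine[of "\<lambda>x. ennreal (exp (- a * (x - m))) * indicator {m..} x" "-1" 0]
    nn_integral_exp_tail[OF assms, of m] by simp

text \<open>Two exponentials, one on each side, as a majorant: it is enough to compare the exponent with its
tangent at the dominating point. With \<open>m > 0\<close> this bounds integrals over \<open>\<bar>x\<bar> \<ge> m\<close>, with \<open>m = - M < 0\<close>
integrals over \<open>\<bar>x\<bar> \<le> M\<close>.\<close>

lemma gaussian_integral_upper:
  fixes u :: "real \<Rightarrow> real"
  assumes [measurable]: "u \<in> borel_measurable borel" and a: "0 < a" and A: "0 \<le> A"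
    and u: "\<And>x. exp (- x\<^sup>2 / 2) * u x \<le> A * (exp (- a * (x - m)) * indicator {m..} x + exp (- a * (- x - m)) * indicator {m..} (- x))"
  shows "gauss_int (\<lambda>x. u x) \<le> ennreal (A / a)"
proof -
  have "gauss_int (\<lambda>x. u x)
      = (\<integral>\<^sup>+x. ennreal (1 / sqrt (2 * pi) * (exp (- x\<^sup>2 / 2) * u x)) \<partial>lborel)"
    by (rule nn_integral_std_gaussian) measurable
  also have "\<dots> \<le> (\<integral>\<^sup>+x. ennreal (A / 2) * (ennreal (exp (- a * (x - m))) * indicator {m..} x
        + ennreal (exp (- a * (- x - m))) * indicator {m..} (- x)) \<partial>lborel)"
  proof (rule nn_integral_mono)
    fix x
    let ?E = "exp (- a * (x - m)) * indicator {m..} x + exp (- a * (- x - m)) * indicator {m..} (- x) :: real"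
    have E: "0 \<le> ?E" by simp
    have "1 / sqrt (2 * pi) * (exp (- x\<^sup>2 / 2) * u x) \<le> 1 / sqrt (2 * pi) * (A * ?E)"
      by (rule mult_left_mono[OF u]) simp
    also have "\<dots> \<le> 1 / 2 * (A * ?E)"
      using sqrt_2pi_bounds A E by (intro mult_right_mono divide_left_mono) auto
    finally have "ennreal (1 / sqrt (2 * pi) * (exp (- x\<^sup>2 / 2) * u x)) \<le> ennreal (A / 2 * ?E)"
      by (intro ennreal_leI) simp
    also have "\<dots> = ennreal (A / 2) * (ennreal (exp (- a * (x - m))) * indicator {m..} x
        + ennreal (exp (- a * (- x - m))) * indicator {m..} (- x))"
    proof -
      have G0: "ennreal (A * e / 2) = ennreal (A / 2) * ennreal e" if "0 \<le> e" for e :: real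
      proof -
        have e: "A * e / 2 = A / 2 * e" by simp
        show ?thesis unfolding e by (rule ennreal_mult') (use A in simp)
      qed
      have G: "ennreal (A * (e1 + e2) / 2) = ennreal (A / 2) * (ennreal e1 + ennreal e2)"
        if "0 \<le> e1" "0 \<le> e2" for e1 e2 :: real
        unfolding ennreal_plus[OF that, symmetric] by (rule G0) (use that in simp)
      show ?thesis by (auto split: split_indicator intro!: G G0)
    qed
    finally show "ennreal (1 / sqrt (2 * pi) * (exp (- x\<^sup>2 / 2) * u x)) \<le> \<dots>" .
  qed
  also have "\<dots> = ennreal (A / 2) * (ennreal (1 / a) + ennreal (1 / a))"
  proof -
    have "(\<integral>\<^sup>+x. ennreal (exp (- a * (x - m))) * indicator {m..} x
        + ennreal (exp (- a * (- x - m))) * indicator {m..} (- x) \<partial>lborel)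
      = (\<integral>\<^sup>+x. ennreal (exp (- a * (x - m))) * indicator {m..} x \<partial>lborel)
        + (\<integral>\<^sup>+x. ennreal (exp (- a * (- x - m))) * indicator {m..} (- x) \<partial>lborel)"
      by (rule nn_integral_add) measurable
    also have "\<dots> = ennreal (1 / a) + ennreal (1 / a)"
      unfolding nn_integral_exp_tail[OF a] nn_integral_exp_tail_reflected[OF a] ..
    finally show ?thesis by (subst nn_integral_cmult) auto
  qed
  also have "\<dots> = ennreal (A / a)"
  proof -
    have 1: "ennreal (1 / a) + ennreal (1 / a) = ennreal (1 / a + 1 / a)"
      using a by (intro ennreal_plus[symmetric]) auto
    have 2: "A / a = A / 2 * (1 / a + 1 / a)" by simp
    show ?thesis unfolding 1 2 by (rule ennreal_mult'[symmetric]) (use A in simp)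
  qed
  finally show ?thesis .
qed

lemma gaussian_integral_lower:
  fixes u :: "real \<Rightarrow> real"
  assumes [measurable]: "u \<in> borel_measurable borel" and "a \<le> b" and A: "0 \<le> A"
    and u: "\<And>t. a \<le> t \<Longrightarrow> t \<le> b \<Longrightarrow> A \<le> exp (- t\<^sup>2 / 2) * u t"
  shows "ennreal (A * (b - a) / 3) \<le> gauss_int (\<lambda>x. u x)"
proof -
  have "ennreal (A * (b - a) / 3) = (\<integral>\<^sup>+x. ennreal (A / 3) * indicator {a..b} x \<partial>lborel)"
    using assms by (simp add: nn_integral_cmult_indicator ennreal_mult'[symmetric])
  also have "\<dots> \<le> (\<integral>\<^sup>+x. ennreal (1 / sqrt (2 * pi) * (exp (- x\<^sup>2 / 2) * u x)) \<partial>lborel)"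
  proof (rule nn_integral_mono)
    fix x
    have "A / 3 \<le> 1 / sqrt (2 * pi) * (exp (- x\<^sup>2 / 2) * u x)" if "a \<le> x" "x \<le> b"
    proof -
      have "1 / 3 * A \<le> 1 / sqrt (2 * pi) * A"
        using sqrt_2pi_bounds A by (intro mult_right_mono divide_left_mono) auto
      also have "\<dots> \<le> 1 / sqrt (2 * pi) * (exp (- x\<^sup>2 / 2) * u x)"
        by (rule mult_left_mono[OF u[OF that]]) simp
      finally show ?thesis by simp
    qed
    then show "ennreal (A / 3) * indicator {a..b} x \<le> ennreal (1 / sqrt (2 * pi) * (exp (- x\<^sup>2 / 2) * u x))"
      by (auto split: split_indicator intro: ennreal_leI)
  qed
  also have "\<dots> = gauss_int (\<lambda>x. u x)"
    by (rule nn_integral_std_gaussian[symmetric]) measurable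
  finally show ?thesis .
qed

definition gtail :: "real \<Rightarrow> real" where
  "gtail r = measure std_gaussian {x. r \<le> \<bar>x\<bar>}"

lemma gauss_int_indicator_tail: "gauss_int (\<lambda>x. indicator {x. r \<le> \<bar>x\<bar>} x) = ennreal (gtail r)"
proof -
  interpret prob_space std_gaussian by (rule prob_space_std_gaussian)
  have "gauss_int (\<lambda>x. indicator {x. r \<le> \<bar>x\<bar>} x)
    = (\<integral>\<^sup>+x. indicator {x. r \<le> \<bar>x\<bar>} x \<partial>std_gaussian)"
    by (intro nn_integral_cong) (auto split: split_indicator)
  then show ?thesis by (simp add: gtail_def emeasure_eq_measure)
qed

lemma gtail_le:
  assumes "0 < m"
  shows "gtail m \<le> exp (- m\<^sup>2 / 2) / m"
proof -
  have "gauss_int (\<lambda>x. indicator {x. m \<le> \<bar>x\<bar>} x) \<le> ennreal (exp (- m\<^sup>2 / 2) / m)"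
  proof (rule gaussian_integral_upper[where m = m])
    fix x :: real
    have "exp (- x\<^sup>2 / 2) \<le> exp (- m\<^sup>2 / 2) * exp (- m * (x - m))"
      using zero_le_power2[of "x - m"]
      by (simp add: exp_add[symmetric] power2_eq_square algebra_simps)
    moreover have "exp (- x\<^sup>2 / 2) \<le> exp (- m\<^sup>2 / 2) * exp (- m * (- x - m))"
      using zero_le_power2[of "x + m"]
      by (simp add: exp_add[symmetric] power2_eq_square algebra_simps)
    ultimately show "exp (- x\<^sup>2 / 2) * indicator {x. m \<le> \<bar>x\<bar>} x
      \<le> exp (- m\<^sup>2 / 2) * (exp (- m * (x - m)) * indicator {m..} x + exp (- m * (- x - m)) * indicator {m..} (- x))"
      using assms by (auto split: split_indicator simp: distrib_left)
  qed (use assms in auto)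
  then show ?thesis using assms by (simp add: gauss_int_indicator_tail)
qed

lemma gtail_ge:
  assumes "1 \<le> r"
  shows "exp (- r\<^sup>2 / 2) / (16 * r) \<le> gtail r"
proof -
  have e1: "exp (1::real) \<le> 3" using exp_le by simp
  have "exp (3 / 2 :: real) = exp 1 * exp (1/2)" by (simp flip: exp_add)
  also have "\<dots> \<le> 3 * (1 + 1/2 + (1/2)\<^sup>2)"
    by (intro mult_mono e1 exp_bound) auto
  finally have e: "exp (3 / 2 :: real) \<le> 21/4" by (simp add: power2_eq_square)
  have "ennreal (exp (- r\<^sup>2 / 2) * exp (- (3 / 2)) * (r + 1 / r - r) / 3)
    \<le> gauss_int (\<lambda>x. indicator {x. r \<le> \<bar>x\<bar>} x)"
  proof (rule gaussian_integral_lower)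
    fix t assume t: "r \<le> t" "t \<le> r + 1 / r"
    have "t\<^sup>2 \<le> (r + 1 / r)\<^sup>2" using t assms by (intro power_mono) auto
    also have "\<dots> = r\<^sup>2 + 2 + (1 / r)\<^sup>2" using assms by (simp add: power2_eq_square field_simps)
    also have "(1 / r)\<^sup>2 \<le> 1" using assms by (simp add: power_le_one)
    finally have "t\<^sup>2 \<le> r\<^sup>2 + 3" by simp
    then have "exp (- r\<^sup>2 / 2) * exp (- (3 / 2)) \<le> exp (- t\<^sup>2 / 2)" by (simp flip: exp_add)
    then show "exp (- r\<^sup>2 / 2) * exp (- (3 / 2)) \<le> exp (- t\<^sup>2 / 2) * indicator {x. r \<le> \<bar>x\<bar>} t"
      using t by (auto split: split_indicator)
  qed (use assms in auto)
  also have "\<dots> = ennreal (gtail r)"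
    by (rule gauss_int_indicator_tail)
  finally have "exp (- r\<^sup>2 / 2) * exp (- (3 / 2)) * (1 / r) / 3 \<le> gtail r"
    by (simp add: gtail_def)
  moreover have "1 / 16 \<le> exp (- (3 / 2) :: real) / 3" using e by (simp add: exp_minus field_simps)
  then have "exp (- r\<^sup>2 / 2) * (1 / r) * (1 / 16) \<le> exp (- r\<^sup>2 / 2) * (1 / r) * (exp (- (3 / 2)) / 3)"
    using assms by (intro mult_left_mono) auto
  ultimately show ?thesis by (simp add: field_simps)
qed

text \<open>The weight \<open>t powr q * exp (- t\<^sup>2 / 2)\<close> has its maximum at \<open>sqrt q\<close>, and its logarithm is more concave
than a Gaussian one, since \<open>ln\<close> is concave. This replaces Stirling's formula for the Gaussian moments.\<close>

lemma powr_gaussian_max: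
  fixes t q :: real
  assumes "0 \<le> t" "0 < q"
  shows "exp (- t\<^sup>2 / 2) * t powr q \<le> (q / exp 1) powr (q / 2) * exp (- (t - sqrt q)\<^sup>2 / 2)"
proof (cases "t = 0")
  case False
  with assms have t: "0 < t" by simp
  have "ln (t / sqrt q) \<le> t / sqrt q - 1" using t assms by (intro ln_le_minus_one) auto
  then have "q * ln (t / sqrt q) \<le> q * (t / sqrt q - 1)" using assms by (intro mult_left_mono) auto
  moreover have "ln (t / sqrt q) = ln t - ln q / 2" using t assms by (simp add: ln_div ln_sqrt)
  moreover have "q * (t / sqrt q - 1) = sqrt q * t - q" using assms
    by (simp add: field_simps)
  ultimately have "q * (ln t - ln q / 2) \<le> sqrt q * t - q" by simp
  then have "- t\<^sup>2 / 2 + q * ln t \<le> (q / 2) * (ln q - 1) - (t - sqrt q)\<^sup>2 / 2"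
  proof -
    have "(t - sqrt q)\<^sup>2 = t\<^sup>2 - 2 * (sqrt q * t) + q"
      using assms by (simp add: power2_diff)
    moreover have "(q / 2) * (ln q - 1) = q * ln q / 2 - q / 2" by (simp add: field_simps)
    moreover have "q * (ln t - ln q / 2) = q * ln t - q * ln q / 2" by (simp add: field_simps)
    ultimately show ?thesis using \<open>q * (ln t - ln q / 2) \<le> sqrt q * t - q\<close> by linarith
  qed
  then have "exp (- t\<^sup>2 / 2 + q * ln t) \<le> exp ((q / 2) * (ln q - 1) - (t - sqrt q)\<^sup>2 / 2)" by simp
  moreover have "(q / exp 1) powr (q / 2) = exp ((q / 2) * (ln q - 1))"
    using assms by (simp add: powr_def ln_div)
  moreover have "exp (- t\<^sup>2 / 2) * t powr q = exp (- t\<^sup>2 / 2 + q * ln t)"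
    using t by (simp only: exp_add) (simp add: powr_def)
  moreover have "exp ((q / 2) * (ln q - 1)) * exp (- (t - sqrt q)\<^sup>2 / 2)
      = exp ((q / 2) * (ln q - 1) - (t - sqrt q)\<^sup>2 / 2)"
    by (simp flip: exp_add)
  ultimately show ?thesis by simp
qed (simp)

lemma gaussian_moment_le:
  fixes q :: real
  assumes "0 < q"
  shows "gauss_int (\<lambda>x. \<bar>x\<bar> powr q) \<le> ennreal (2 * (q / exp 1) powr (q / 2))"
proof -
  let ?B = "(q / exp 1) powr (q / 2)"
  have N: "(\<integral>\<^sup>+x. ennreal (normal_density c 1 x) \<partial>lborel) = 1" for c :: real
    by (simp add: nn_integral_eq_integral)
  have "gauss_int (\<lambda>x. \<bar>x\<bar> powr q)
      = (\<integral>\<^sup>+x. ennreal (1 / sqrt (2 * pi) * (exp (- x\<^sup>2 / 2) * \<bar>x\<bar> powr q)) \<partial>lborel)"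
    by (rule nn_integral_std_gaussian) measurable
  also have "\<dots> \<le> (\<integral>\<^sup>+x. ennreal ?B * (ennreal (normal_density (sqrt q) 1 x) + ennreal (normal_density (- sqrt q) 1 x)) \<partial>lborel)"
  proof (rule nn_integral_mono)
    fix x :: real
    have 1: "exp (- x\<^sup>2 / 2) * \<bar>x\<bar> powr q \<le> ?B * exp (- (\<bar>x\<bar> - sqrt q)\<^sup>2 / 2)"
      using powr_gaussian_max[of "\<bar>x\<bar>" q] assms by simp
    have 2: "exp (- (\<bar>x\<bar> - sqrt q)\<^sup>2 / 2) \<le> exp (- (x - sqrt q)\<^sup>2 / 2) + exp (- (x + sqrt q)\<^sup>2 / 2)"
    proof (cases "x \<ge> 0")
      case False
      then have "(\<bar>x\<bar> - sqrt q)\<^sup>2 = (x + sqrt q)\<^sup>2" by (simp add: power2_eq_square algebra_simps)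
      then show ?thesis by simp
    qed simp
    have "exp (- x\<^sup>2 / 2) * \<bar>x\<bar> powr q
        \<le> ?B * (exp (- (x - sqrt q)\<^sup>2 / 2) + exp (- (x + sqrt q)\<^sup>2 / 2))"
      by (rule order_trans[OF 1 mult_left_mono[OF 2]]) simp
    then have "1 / sqrt (2 * pi) * (exp (- x\<^sup>2 / 2) * \<bar>x\<bar> powr q)
       \<le> 1 / sqrt (2 * pi) * (?B * (exp (- (x - sqrt q)\<^sup>2 / 2) + exp (- (x + sqrt q)\<^sup>2 / 2)))"
      by (intro mult_left_mono) auto
    also have "\<dots> = ?B * (normal_density (sqrt q) 1 x + normal_density (- sqrt q) 1 x)"
      by (simp add: normal_density_def algebra_simps)
    finally show "ennreal (1 / sqrt (2 * pi) * (exp (- x\<^sup>2 / 2) * \<bar>x\<bar> powr q))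
       \<le> ennreal ?B * (ennreal (normal_density (sqrt q) 1 x) + ennreal (normal_density (- sqrt q) 1 x))"
      by (simp add: ennreal_plus[symmetric] ennreal_mult'[symmetric] ennreal_leI del: ennreal_plus)
  qed
  also have "\<dots> = ennreal ?B * (1 + 1)"
    by (subst nn_integral_cmult, measurable) (subst nn_integral_add, auto simp: N)
  also have "\<dots> = ennreal (2 * ?B)" by (simp add: ennreal_mult' mult.commute)
  finally show ?thesis .
qed

text \<open>When the maximum \<open>sqrt q\<close> of the weight lies beyond \<open>M\<close>, the integral is carried by a window below \<open>M\<close>:
the logarithmic slope at \<open>M\<close> is \<open>(q - M\<^sup>2) / M\<close>, and the Gaussian factor limits the width to \<open>1\<close>. The fraction on
the right is the harmonic combination \<open>1 / (1 + z)\<close> of these two widths.\<close>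

lemma truncated_moment_upper:
  fixes M q :: real
  assumes M: "0 < M" and q: "M\<^sup>2 \<le> q"
  shows "gauss_int (\<lambda>x. (\<bar>x\<bar> / M) powr q * indicator {x. \<bar>x\<bar> \<le> M} x)
    \<le> ennreal (2 * exp (- M\<^sup>2 / 2) * (M / (M + q - M\<^sup>2)))"
proof -
  \<comment> \<open>\<open>z\<close> is the logarithmic slope of the integrand at \<open>M\<close>\<close>
  define z where "z = (q - M\<^sup>2) / M"
  have z: "0 \<le> z" using M q by (simp add: z_def)
  have qp: "0 < q" using M q by (meson less_le_trans zero_less_power)
  have key: "exp (- t\<^sup>2 / 2) * (t / M) powr q \<le> 2 * exp (- M\<^sup>2 / 2) * exp (- (1 + z) * (M - t))"
    if t: "0 \<le> t" "t \<le> M" for t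
  proof (cases "t = 0")
    case False
    with t have t0: "0 < t" by simp
    have "ln (t / M) \<le> t / M - 1" using t0 M by (intro ln_le_minus_one) auto
    then have "q * ln (t / M) \<le> q * (t / M - 1)" using qp by (intro mult_left_mono) auto
    also have "\<dots> = - (z + M) * (M - t)" using M by (simp add: z_def field_simps power2_eq_square)
    finally have "- t\<^sup>2 / 2 + q * ln (t / M) \<le> - t\<^sup>2 / 2 - (z + M) * (M - t)"
      by (simp add: algebra_simps)
    also have "\<dots> \<le> 1 / 2 - M\<^sup>2 / 2 - (1 + z) * (M - t)"
      using zero_le_power2[of "M - t - 1"] by (simp add: power2_eq_square algebra_simps)
    finally have "exp (- t\<^sup>2 / 2 + q * ln (t / M)) \<le> exp (1 / 2 - M\<^sup>2 / 2 - (1 + z) * (M - t))" by simp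
    also have "\<dots> = exp (1/2) * (exp (- M\<^sup>2 / 2) * exp (- (1 + z) * (M - t)))"
      by (simp add: exp_add[symmetric] algebra_simps)
    also have "\<dots> \<le> 2 * (exp (- M\<^sup>2 / 2) * exp (- (1 + z) * (M - t)))"
    proof (rule mult_right_mono)
      have "exp (1/2 :: real) \<le> 1 + 1/2 + (1/2)\<^sup>2" by (rule exp_bound) auto
      then show "exp (1/2 :: real) \<le> 2" by (simp add: power2_eq_square)
    qed simp
    finally have "exp (- t\<^sup>2 / 2 + q * ln (t / M)) \<le> 2 * (exp (- M\<^sup>2 / 2) * exp (- (1 + z) * (M - t)))" .
    moreover have "exp (- t\<^sup>2 / 2) * (t / M) powr q = exp (- t\<^sup>2 / 2 + q * ln (t / M))"
      using t0 M by (simp only: exp_add) (simp add: powr_def)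
    ultimately show ?thesis by (simp only: mult.assoc)
  qed (use M in auto)
  have "gauss_int (\<lambda>x. (\<bar>x\<bar> / M) powr q * indicator {x. \<bar>x\<bar> \<le> M} x)
    \<le> ennreal (2 * exp (- M\<^sup>2 / 2) / (1 + z))"
  proof (rule gaussian_integral_upper[where m = "- M"])
    fix x :: real
    show "exp (- x\<^sup>2 / 2) * ((\<bar>x\<bar> / M) powr q * indicator {x. \<bar>x\<bar> \<le> M} x)
      \<le> 2 * exp (- M\<^sup>2 / 2) * (exp (- (1 + z) * (x - - M)) * indicator {- M..} x
        + exp (- (1 + z) * (- x - - M)) * indicator {- M..} (- x))"
    proof (cases "\<bar>x\<bar> \<le> M")
      case True
      have "exp (- x\<^sup>2 / 2) * (\<bar>x\<bar> / M) powr q \<le> 2 * exp (- M\<^sup>2 / 2) * exp (- (1 + z) * (M - \<bar>x\<bar>))"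
        using key[of "\<bar>x\<bar>"] True by simp
      also have "\<dots> \<le> 2 * exp (- M\<^sup>2 / 2) * (exp (- (1 + z) * (x - - M)) + exp (- (1 + z) * (- x - - M)))"
        by (intro mult_left_mono) (auto simp: abs_if add.commute)
      finally show ?thesis using True by (auto split: split_indicator)
    qed simp
  qed (use z in auto)
  also have "2 * exp (- M\<^sup>2 / 2) / (1 + z) = 2 * exp (- M\<^sup>2 / 2) * (M / (M + q - M\<^sup>2))"
  proof -
    have "1 + z = (M + q - M\<^sup>2) / M" using M by (simp add: z_def field_simps)
    then show ?thesis by simp
  qed
  finally show ?thesis .
qed

text \<open>The matching lower bound from the window of width \<open>1 / (2 * (1 + z))\<close> below \<open>M\<close>, on which the integrand
differs from its value at \<open>M\<close> by a bounded factor. The bound \<open>q \<le> 2 * M\<^sup>2\<close> controls the quadratic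
term of \<open>q * ln (t / M)\<close>.\<close>

lemma truncated_moment_lower:
  fixes M q :: real
  assumes M: "1 \<le> M" and q: "M\<^sup>2 \<le> q" "q \<le> 2 * M\<^sup>2"
  shows "ennreal (1 / 54 * exp (- M\<^sup>2 / 2) * (M / (M + q - M\<^sup>2)))
    \<le> gauss_int (\<lambda>x. (\<bar>x\<bar> / M) powr q * indicator {x. M - 1/2 \<le> \<bar>x\<bar> \<and> \<bar>x\<bar> \<le> M} x)"
proof -
  define z where "z = (q - M\<^sup>2) / M"
  have z: "0 \<le> z" using M q by (simp add: z_def)
  have qp: "0 < q" using M q by (meson less_le_trans zero_less_power zero_less_one)
  define d where "d = 1 / (2 * (1 + z))"
  have d: "0 < d" "d \<le> 1/2" "d * z \<le> 1/2" using z by (auto simp: d_def field_simps)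
  have "ennreal (exp (- 2) * exp (- M\<^sup>2 / 2) * (M - (M - d)) / 3)
    \<le> gauss_int (\<lambda>x. (\<bar>x\<bar> / M) powr q * indicator {x. M - 1/2 \<le> \<bar>x\<bar> \<and> \<bar>x\<bar> \<le> M} x)"
  proof (rule gaussian_integral_lower)
    fix t assume t: "M - d \<le> t" "t \<le> M"
    define s where "s = M - t"
    have s: "0 \<le> s" "s \<le> d" "s \<le> 1/2" "t = M - s" using t d by (auto simp: s_def)
    have t0: "0 < t" "1/2 \<le> t" using s M by auto
    have sz: "s * z \<le> 1/2" using mult_right_mono[OF s(2) z] d by simp
    have s2: "s\<^sup>2 \<le> 1/4" using s power_mono[of s "1/2" 2] by (simp add: power2_eq_square)
    have "ln (M / t) \<le> M / t - 1" using t0 M by (intro ln_le_minus_one) auto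
    then have "1 - M / t \<le> ln (t / M)" using t0 M by (simp add: ln_div)
    then have "q * (1 - M / t) \<le> q * ln (t / M)" using qp by (intro mult_left_mono) auto
    moreover have "- s * (z + M) - 1 \<le> q * (1 - M / t)"
    proof -
      have "1 - M / t = - (s / M) - s\<^sup>2 / (M * t)" using t0 M unfolding s_def
        by (simp add: field_simps power2_eq_square)
      then have "q * (1 - M / t) = q * (- (s / M) - s\<^sup>2 / (M * t))" by (simp only:)
      also have "\<dots> = - s * (q / M) - s\<^sup>2 * (q / (M * t))" by (simp add: right_diff_distrib algebra_simps)
      finally have "q * (1 - M / t) = - s * (q / M) - s\<^sup>2 * (q / (M * t))" .
      moreover have "q / M = z + M" using M by (simp add: z_def field_simps power2_eq_square)
      moreover have "s\<^sup>2 * (q / (M * t)) \<le> 1/4 * 4"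
      proof (rule mult_mono[OF s2])
        have "M \<le> 2 * t" using s M by simp
        then have "M * M \<le> M * (2 * t)" using M by (intro mult_left_mono) auto
        then have "q \<le> 4 * (M * t)" using q by (simp add: power2_eq_square)
        then show "q / (M * t) \<le> 4" using M t0 by (simp add: field_simps)
      qed (use M t0 qp in auto)
      ultimately show ?thesis by simp
    qed
    ultimately have "- t\<^sup>2 / 2 - s * (z + M) - 1 \<le> - t\<^sup>2 / 2 + q * ln (t / M)" by simp
    moreover have "- 2 - M\<^sup>2 / 2 \<le> - t\<^sup>2 / 2 - s * (z + M) - 1"
      using sz s2 unfolding s(4) by (simp add: power2_eq_square algebra_simps)
    ultimately have "exp (- 2 - M\<^sup>2 / 2) \<le> exp (- t\<^sup>2 / 2 + q * ln (t / M))" by simp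
    then have "exp (- 2) * exp (- M\<^sup>2 / 2) \<le> exp (- t\<^sup>2 / 2) * (t / M) powr q"
      using t0 M by (simp add: powr_def exp_add[symmetric])
    then show "exp (- 2) * exp (- M\<^sup>2 / 2) \<le> exp (- t\<^sup>2 / 2)
       * ((\<bar>t\<bar> / M) powr q * indicator {x. M - 1/2 \<le> \<bar>x\<bar> \<and> \<bar>x\<bar> \<le> M} t)"
      using s t0 by simp
  qed (use d in auto)
  moreover have "1 / 54 * exp (- M\<^sup>2 / 2) * (M / (M + q - M\<^sup>2)) \<le> exp (- 2) * exp (- M\<^sup>2 / 2) * (M - (M - d)) / 3"
  proof -
    have "exp (2::real) = exp 1 * exp 1" by (simp flip: exp_add)
    also have "\<dots> \<le> 3 * 3" using exp_le by (intro mult_mono) auto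
    finally have "1 / 9 \<le> exp (- 2 :: real)" by (simp add: exp_minus field_simps)
    moreover have "1 + z = (M + q - M\<^sup>2) / M" using M by (simp add: z_def field_simps)
    then have "M / (M + q - M\<^sup>2) = inverse (1 + z)" by simp
    then have "M / (M + q - M\<^sup>2) = 2 * d" using z by (simp add: d_def field_simps)
    ultimately show ?thesis using d mult_right_mono[of "1/9" "exp (- 2)" "exp (- M\<^sup>2 / 2) * d / 3"]
      by (simp add: field_simps)
  qed
  ultimately show ?thesis by (meson ennreal_leI order_trans)
qed

section \<open>Increments of the root function\<close>

lemma DERIV_shifted_powr:
  fixes T y r :: real
  assumes "0 < T + y"
  shows "((\<lambda>y. (T + y) powr r) has_real_derivative r * (T + y) powr (r - 1)) (at y)"
  using assms by (auto intro!: derivative_eq_intros)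

lemma continuous_shifted_powr:
  fixes T r :: real
  assumes "0 \<le> T" "0 \<le> a" "0 < r"
  shows "continuous_on {a..b} (\<lambda>y. (T + y) powr r)"
  using assms by (intro continuous_on_powr' continuous_intros) auto

text \<open>An inequality between derivatives integrates to one between increments. Both the monotonicity and
the scaling of the increments in the base point are instances.\<close>

lemma shifted_powr_diff_le:
  fixes S T K a b r :: real
  assumes "0 \<le> S" "0 \<le> T" "0 \<le> a" "a \<le> b" "0 < r"
    and K: "\<And>y. a < y \<Longrightarrow> y < b \<Longrightarrow> (T + y) powr (r - 1) \<le> K * (S + y) powr (r - 1)"
  shows "(T + b) powr r - (T + a) powr r \<le> K * ((S + b) powr r - (S + a) powr r)"
proof (cases "a < b")
  case True
  define g where "g y = K * (S + y) powr r - (T + y) powr r" for y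
  have "g a \<le> g b"
  proof (rule DERIV_nonneg_imp_increasing_open[OF \<open>a \<le> b\<close>])
    fix y assume y: "a < y" "y < b"
    have "(g has_real_derivative (K * (r * (S + y) powr (r - 1)) - r * (T + y) powr (r - 1))) (at y)"
      unfolding g_def using assms y
      by (intro DERIV_diff DERIV_cmult DERIV_shifted_powr) auto
    moreover have "0 \<le> K * (r * (S + y) powr (r - 1)) - r * (T + y) powr (r - 1)"
      using mult_left_mono[OF K[OF y], of r] assms by (simp add: algebra_simps)
    ultimately show "\<exists>d. (g has_real_derivative d) (at y) \<and> 0 \<le> d" by blast
  next
    show "continuous_on {a..b} g"
      unfolding g_def using assms
      by (intro continuous_on_diff continuous_on_mult_left continuous_shifted_powr) auto
  qed
  then show ?thesis by (simp add: g_def algebra_simps)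
qed (use assms in auto)

lemma shifted_powr_diff_upper:
  fixes T K a b r :: real
  assumes "0 \<le> T" "0 \<le> a" "a \<le> b" "0 < r"
    and K: "\<And>y. a < y \<Longrightarrow> y < b \<Longrightarrow> r * (T + y) powr (r - 1) \<le> K"
  shows "(T + b) powr r - (T + a) powr r \<le> K * (b - a)"
proof (cases "a < b")
  case True
  define g where "g y = K * y - (T + y) powr r" for y
  have "g a \<le> g b"
  proof (rule DERIV_nonneg_imp_increasing_open[OF \<open>a \<le> b\<close>])
    fix y assume y: "a < y" "y < b"
    have "(g has_real_derivative (K * 1 - r * (T + y) powr (r - 1))) (at y)"
      unfolding g_def using assms y
      by (intro DERIV_diff DERIV_cmult DERIV_shifted_powr DERIV_ident) auto
    then show "\<exists>d. (g has_real_derivative d) (at y) \<and> 0 \<le> d" using K[OF y] by auto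
  next
    show "continuous_on {a..b} g"
      unfolding g_def using assms
      by (intro continuous_on_diff continuous_on_mult_left continuous_shifted_powr continuous_intros) auto
  qed
  then show ?thesis by (simp add: g_def algebra_simps)
qed (use assms in auto)

lemma shifted_powr_diff_lower:
  fixes T K a b r :: real
  assumes "0 \<le> T" "0 \<le> a" "a \<le> b" "0 < r"
    and K: "\<And>y. a < y \<Longrightarrow> y < b \<Longrightarrow> K \<le> r * (T + y) powr (r - 1)"
  shows "K * (b - a) \<le> (T + b) powr r - (T + a) powr r"
proof (cases "a < b")
  case True
  define g where "g y = (T + y) powr r - K * y" for y
  have "g a \<le> g b"
  proof (rule DERIV_nonneg_imp_increasing_open[OF \<open>a \<le> b\<close>])
    fix y assume y: "a < y" "y < b"
    have "(g has_real_derivative (r * (T + y) powr (r - 1) - K * 1)) (at y)"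
      unfolding g_def using assms y
      by (intro DERIV_diff DERIV_cmult DERIV_shifted_powr DERIV_ident) auto
    then show "\<exists>d. (g has_real_derivative d) (at y) \<and> 0 \<le> d" using K[OF y] by auto
  next
    show "continuous_on {a..b} g"
      unfolding g_def using assms
      by (intro continuous_on_diff continuous_on_mult_left continuous_shifted_powr continuous_intros) auto
  qed
  then show ?thesis by (simp add: g_def algebra_simps)
qed (use assms in auto)

lemma shifted_powr_diff_antimono:
  fixes S T a b r :: real
  assumes "0 \<le> S" "S \<le> T" "0 \<le> a" "a \<le> b" "0 < r" "r \<le> 1"
  shows "(T + b) powr r - (T + a) powr r \<le> (S + b) powr r - (S + a) powr r"
proof -
  have "(T + b) powr r - (T + a) powr r \<le> 1 * ((S + b) powr r - (S + a) powr r)"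
    by (rule shifted_powr_diff_le) (use assms in \<open>auto intro: powr_mono2'\<close>)
  then show ?thesis by simp
qed

text \<open>Monotonicity of increments has a partial converse: shrinking the base point by the factor \<open>\<kappa>\<close> enlarges an
increment at most by \<open>1 / \<kappa>\<close>. Therefore base points only matter up to constant factors.\<close>

lemma shifted_powr_diff_scale:
  fixes S \<kappa> a b r :: real
  assumes "0 \<le> S" "0 < \<kappa>" "\<kappa> \<le> 1" "0 \<le> a" "a \<le> b" "0 < r" "r \<le> 1"
  shows "(\<kappa> * S + b) powr r - (\<kappa> * S + a) powr r \<le> (1 / \<kappa>) * ((S + b) powr r - (S + a) powr r)"
proof (rule shifted_powr_diff_le)
  fix y assume y: "a < y" "y < b"
  have "(\<kappa> * S + y) powr (r - 1) \<le> (\<kappa> * (S + y)) powr (r - 1)"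
    using assms y by (intro powr_mono2') (auto simp: distrib_left mult_left_le_one_le add_nonneg_pos)
  also have "\<dots> = \<kappa> powr (r - 1) * (S + y) powr (r - 1)"
    by (rule powr_mult)
  also have "\<dots> \<le> \<kappa> powr (- 1) * (S + y) powr (r - 1)"
    using assms by (intro mult_right_mono powr_mono') auto
  also have "\<kappa> powr (- 1) = 1 / \<kappa>" using assms by (simp add: powr_minus_divide)
  finally show "(\<kappa> * S + y) powr (r - 1) \<le> (1 / \<kappa>) * (S + y) powr (r - 1)" .
qed (use assms in auto)

text \<open>The change of the norm when a coordinate \<open>x\<close> is added to coordinates whose \<open>p\<close>-th powers sum to \<open>S\<close>.\<close>

definition root_inc :: "real \<Rightarrow> real \<Rightarrow> real \<Rightarrow> real" where
  "root_inc p S x = (S + \<bar>x\<bar> powr p) powr (1 / p) - S powr (1 / p)"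

lemma root_inc_nonneg: "0 \<le> S \<Longrightarrow> 1 \<le> p \<Longrightarrow> 0 \<le> root_inc p S x"
  unfolding root_inc_def by (simp add: powr_mono2)

lemma root_inc_antimono: "0 \<le> S \<Longrightarrow> S \<le> T \<Longrightarrow> 1 \<le> p \<Longrightarrow> root_inc p T x \<le> root_inc p S x"
  using shifted_powr_diff_antimono[of S T 0 "\<bar>x\<bar> powr p" "1 / p"] by (simp add: root_inc_def)

lemma root_inc_scale:
  "0 \<le> S \<Longrightarrow> 0 < \<kappa> \<Longrightarrow> \<kappa> \<le> 1 \<Longrightarrow> 1 \<le> p \<Longrightarrow> root_inc p (\<kappa> * S) x \<le> (1 / \<kappa>) * root_inc p S x"
  using shifted_powr_diff_scale[of S \<kappa> 0 "\<bar>x\<bar> powr p" "1 / p"] by (simp add: root_inc_def)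

lemma root_inc_le_small:
  assumes "1 \<le> p" "0 < m"
  shows "root_inc p (m powr p) x \<le> m / p * (\<bar>x\<bar> / m) powr p"
proof -
  have "(m powr p + \<bar>x\<bar> powr p) powr (1 / p) - (m powr p + 0) powr (1 / p)
      \<le> (1 / p * (m powr p) powr (1 / p - 1)) * (\<bar>x\<bar> powr p - 0)"
    using assms by (intro shifted_powr_diff_upper mult_left_mono powr_mono2') auto
  also have "(m powr p) powr (1 / p - 1) = m powr (p * (1 / p - 1))" by (simp add: powr_powr)
  also have "p * (1 / p - 1) = 1 - p" using assms by (simp add: field_simps)
  also have "(1 / p * m powr (1 - p)) * (\<bar>x\<bar> powr p - 0) = m / p * (\<bar>x\<bar> / m) powr p"
    using assms by (simp add: powr_diff powr_divide)
  finally show ?thesis by (simp add: root_inc_def)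
qed

text \<open>A coordinate that dominates: the first term is the growth of the maximum, the second one the excess of
the norm over the maximum, from \<open>2 powr (1 / p) \<le> 1 + 1 / p\<close>.\<close>

lemma root_inc_le_large:
  assumes "1 \<le> p" "0 < m" "m \<le> \<bar>x\<bar>"
  shows "root_inc p (m powr p) x \<le> (\<bar>x\<bar> - m) + \<bar>x\<bar> / p"
proof -
  have "(1 + 1) powr (1 / p) - (1 + 0) powr (1 / p) \<le> (1 / p) * (1 - 0 :: real)"
  proof (rule shifted_powr_diff_upper)
    fix y :: real assume "0 < y" "y < 1"
    then have "(1 + y) powr (1 / p - 1) \<le> (1 + y) powr 0" using assms by (intro powr_mono) auto
    then show "1 / p * (1 + y) powr (1 / p - 1) \<le> 1 / p"
      using assms \<open>0 < y\<close> mult_left_mono[of "(1 + y) powr (1 / p - 1)" 1 "1 / p"] by simp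
  qed (use assms in auto)
  then have two: "2 powr (1 / p) \<le> 1 + 1 / p" by simp
  have "(m powr p + \<bar>x\<bar> powr p) powr (1 / p) \<le> (2 * \<bar>x\<bar> powr p) powr (1 / p)"
    using assms powr_mono2[of p m "\<bar>x\<bar>"] by (intro powr_mono2) auto
  also have "\<dots> = 2 powr (1 / p) * \<bar>x\<bar>" using assms by (simp add: powr_mult powr_powr)
  also have "\<dots> \<le> (1 + 1 / p) * \<bar>x\<bar>" by (intro mult_right_mono two) auto
  finally show ?thesis using assms by (simp add: root_inc_def powr_powr algebra_simps)
qed

text \<open>The one-coordinate variance term of the Efron-Stein bound, given the sum \<open>S\<close> over the other coordinates.\<close>

definition inc_energy :: "real \<Rightarrow> real \<Rightarrow> ennreal" where
  "inc_energy p S = gauss_int (\<lambda>x. (root_inc p S x)\<^sup>2)"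

lemma root_inc_measurable [measurable]: "(\<lambda>z. root_inc p (f z) (g z)) \<in> borel_measurable N"
  if [measurable]: "f \<in> borel_measurable N" "g \<in> borel_measurable N"
  unfolding root_inc_def by measurable

lemma inc_energy_antimono:
  assumes "0 \<le> S" "S \<le> T" "1 \<le> p"
  shows "inc_energy p T \<le> inc_energy p S"
  unfolding inc_energy_def using assms root_inc_antimono root_inc_nonneg[of T p]
  by (intro nn_integral_mono ennreal_leI power_mono) auto

lemma inc_energy_scale:
  assumes "0 \<le> S" "0 < \<kappa>" "\<kappa> \<le> 1" "1 \<le> p"
  shows "inc_energy p (\<kappa> * S) \<le> ennreal (1 / \<kappa>\<^sup>2) * inc_energy p S"
proof -
  have "inc_energy p (\<kappa> * S) \<le> gauss_int (\<lambda>x. ((1 / \<kappa>) * root_inc p S x)\<^sup>2)"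
    unfolding inc_energy_def using assms root_inc_scale[of S \<kappa> p] root_inc_nonneg[of "\<kappa> * S" p]
    by (intro nn_integral_mono ennreal_leI power_mono) auto
  also have "\<dots> = (\<integral>\<^sup>+x. ennreal (1 / \<kappa>\<^sup>2) * ennreal ((root_inc p S x)\<^sup>2) \<partial>std_gaussian)"
    using assms by (intro nn_integral_cong) (simp add: ennreal_mult'[symmetric] power_mult_distrib power_divide)
  also have "\<dots> = ennreal (1 / \<kappa>\<^sup>2) * inc_energy p S"
    unfolding inc_energy_def by (rule nn_integral_cmult) measurable
  finally show ?thesis .
qed

lemma inc_energy_le_2:
  assumes "0 \<le> S" "1 \<le> p"
  shows "inc_energy p S \<le> 2"
proof -
  have "inc_energy p S \<le> inc_energy p 0" using assms by (intro inc_energy_antimono) auto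
  also have "inc_energy p 0 = gauss_int (\<lambda>x. \<bar>x\<bar> powr 2)"
    unfolding inc_energy_def root_inc_def using assms by (intro nn_integral_cong) (simp add: powr_powr)
  also have "\<dots> \<le> ennreal (2 * (2 / exp 1) powr (2 / 2))" by (rule gaussian_moment_le) simp
  also have "\<dots> \<le> ennreal 2"
  proof (rule ennreal_leI)
    have "2 / exp 1 \<le> (1::real)" using exp_ge_add_one_self[of 1] by simp
    then have "2 * (2 / exp 1) \<le> 2 * (1::real)" by (intro mult_left_mono) auto
    then show "2 * (2 / exp 1) powr (2 / 2) \<le> (2::real)" by simp
  qed
  finally show ?thesis by simp
qed

text \<open>Sharp when \<open>m\<close> is above the peak \<open>sqrt (2 * p)\<close> of the weight, that is, in the first regime.\<close>

lemma inc_energy_le_moment: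
  assumes "1 \<le> p" "0 < m"
  shows "inc_energy p (m powr p) \<le> ennreal ((m / p)\<^sup>2 * m powr (- 2 * p) * (2 * (2 * p / exp 1) powr p))"
proof -
  let ?c = "(m / p)\<^sup>2 * m powr (- 2 * p)"
  have "inc_energy p (m powr p) \<le> (\<integral>\<^sup>+x. ennreal ?c * ennreal (\<bar>x\<bar> powr (2 * p)) \<partial>std_gaussian)"
    unfolding inc_energy_def
  proof (rule nn_integral_mono)
    fix x
    have "(root_inc p (m powr p) x)\<^sup>2 \<le> (m / p * (\<bar>x\<bar> / m) powr p)\<^sup>2"
      using assms by (intro power_mono root_inc_le_small root_inc_nonneg) auto
    also have "\<dots> = ?c * \<bar>x\<bar> powr (2 * p)"
    proof -
      have "((\<bar>x\<bar> / m) powr p)\<^sup>2 = (\<bar>x\<bar> / m) powr (2 * p)"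
        by (simp add: power2_eq_square flip: powr_add)
      also have "\<dots> = m powr (- 2 * p) * \<bar>x\<bar> powr (2 * p)"
        using assms by (simp add: powr_divide powr_minus field_simps)
      finally show ?thesis unfolding power_mult_distrib by simp
    qed
    finally show "ennreal ((root_inc p (m powr p) x)\<^sup>2) \<le> ennreal ?c * ennreal (\<bar>x\<bar> powr (2 * p))"
      by (simp add: ennreal_mult'[symmetric] ennreal_leI)
  qed
  also have "\<dots> = ennreal ?c * gauss_int (\<lambda>x. \<bar>x\<bar> powr (2 * p))"
    by (rule nn_integral_cmult) measurable
  also have "\<dots> \<le> ennreal ?c * ennreal (2 * (2 * p / exp 1) powr (2 * p / 2))"
    using assms by (intro mult_left_mono gaussian_moment_le) auto
  also have "\<dots> = ennreal (?c * (2 * (2 * p / exp 1) powr p))"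
    by (simp add: ennreal_mult')
  finally show ?thesis .
qed

text \<open>The contribution of dominating coordinates, which is of order \<open>1 / m\<^sup>2\<close> times the probability of \<open>\<bar>x\<bar> \<ge> m\<close>
as long as \<open>m\<^sup>2\<close> is at most of order \<open>p\<close>.\<close>

lemma gaussian_overshoot:
  assumes m: "0 < m" and p: "1 \<le> p"
  shows "gauss_int (\<lambda>x. ((\<bar>x\<bar> - m) + \<bar>x\<bar> / p)\<^sup>2 * indicator {x. m \<le> \<bar>x\<bar>} x)
    \<le> ennreal (exp (- m\<^sup>2 / 2) * (128 / m^3 + 4 * m / p\<^sup>2))"
proof -
  let ?A = "exp (- m\<^sup>2 / 2) * (64 / m\<^sup>2 + 2 * m\<^sup>2 / p\<^sup>2)"
  have key: "exp (- t\<^sup>2 / 2) * ((t - m) + t / p)\<^sup>2 \<le> ?A * exp (- (m / 2) * (t - m))" if t: "m \<le> t" for t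
  proof -
    define s where "s = t - m"
    have s: "0 \<le> s" "t = m + s" using t by (auto simp: s_def)
    \<comment> \<open>half of the exponential decay absorbs the polynomial factor, so that one exponential remains to be integrated\<close>
    have ex: "s\<^sup>2 \<le> 8 / m\<^sup>2 * exp (m / 2 * s)"
    proof -
      have "1 + m / 2 * s + (m / 2 * s)\<^sup>2 / 2 \<le> exp (m / 2 * s)"
        using m s by (intro exp_lower_Taylor_quadratic) auto
      moreover have "0 \<le> m / 2 * s" using m s by simp
      ultimately have "(m / 2 * s)\<^sup>2 / 2 \<le> exp (m / 2 * s)" by linarith
      then have "8 / m\<^sup>2 * ((m / 2 * s)\<^sup>2 / 2) \<le> 8 / m\<^sup>2 * exp (m / 2 * s)" using m by (intro mult_left_mono) auto
      moreover have "8 / m\<^sup>2 * ((m / 2 * s)\<^sup>2 / 2) = s\<^sup>2" using m by (simp add: field_simps power2_eq_square)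
      ultimately show ?thesis by simp
    qed
    have "0 \<le> s / p" "s / p \<le> s" using s p mult_left_mono[of 1 p s] by (auto simp: divide_le_eq)
    then have "(t - m) + t / p \<le> 2 * s + m / p" unfolding s(2) by (simp add: add_divide_distrib)
    then have "((t - m) + t / p)\<^sup>2 \<le> (2 * s + m / p)\<^sup>2" using t m p s by (intro power_mono) auto
    also have "\<dots> \<le> 8 * s\<^sup>2 + 2 * (m / p)\<^sup>2"
      using zero_le_power2[of "2 * s - m / p"] unfolding power2_sum power2_diff by (simp add: power_mult_distrib)
    also have "\<dots> \<le> 8 * (8 / m\<^sup>2 * exp (m / 2 * s)) + 2 * (m / p)\<^sup>2 * exp (m / 2 * s)"
    proof (intro add_mono)
      have "1 \<le> exp (m / 2 * s)" using m s by simp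
      then show "2 * (m / p)\<^sup>2 \<le> 2 * (m / p)\<^sup>2 * exp (m / 2 * s)"
        using mult_left_mono[of 1 "exp (m / 2 * s)" "2 * (m / p)\<^sup>2"] by simp
    qed (use ex in simp)
    also have "\<dots> = (64 / m\<^sup>2 + 2 * m\<^sup>2 / p\<^sup>2) * exp (m / 2 * s)" by (simp add: algebra_simps power_divide)
    finally have 1: "((t - m) + t / p)\<^sup>2 \<le> (64 / m\<^sup>2 + 2 * m\<^sup>2 / p\<^sup>2) * exp (m / 2 * s)" .
    have "- t\<^sup>2 / 2 \<le> - m\<^sup>2 / 2 - m * s"
      unfolding s(2) using zero_le_power2[of s] by (simp add: power2_eq_square field_simps)
    then have "exp (- t\<^sup>2 / 2) \<le> exp (- m\<^sup>2 / 2 - m * s)" by simp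
    then have "exp (- t\<^sup>2 / 2) * ((t - m) + t / p)\<^sup>2
        \<le> exp (- m\<^sup>2 / 2 - m * s) * ((64 / m\<^sup>2 + 2 * m\<^sup>2 / p\<^sup>2) * exp (m / 2 * s))"
      using 1 by (intro mult_mono) auto
    also have "\<dots> = (64 / m\<^sup>2 + 2 * m\<^sup>2 / p\<^sup>2) * exp (- m\<^sup>2 / 2 - m * s + m / 2 * s)"
      unfolding exp_add by simp
    also have "- m\<^sup>2 / 2 - m * s + m / 2 * s = - m\<^sup>2 / 2 + - (m / 2) * (t - m)"
      by (simp add: s_def algebra_simps)
    finally show ?thesis unfolding exp_add by (simp add: mult_ac)
  qed
  have "gauss_int (\<lambda>x. ((\<bar>x\<bar> - m) + \<bar>x\<bar> / p)\<^sup>2 * indicator {x. m \<le> \<bar>x\<bar>} x)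
      \<le> ennreal (?A / (m / 2))"
  proof (rule gaussian_integral_upper[where m = m])
    fix x :: real
    show "exp (- x\<^sup>2 / 2) * (((\<bar>x\<bar> - m) + \<bar>x\<bar> / p)\<^sup>2 * indicator {x. m \<le> \<bar>x\<bar>} x)
      \<le> ?A * (exp (- (m / 2) * (x - m)) * indicator {m..} x + exp (- (m / 2) * (- x - m)) * indicator {m..} (- x))"
      using key[of x] key[of "- x"] m p
      by (cases "x \<ge> 0") (auto split: split_indicator)
  qed (use m in auto)
  also have "?A / (m / 2) = exp (- m\<^sup>2 / 2) * (128 / m^3 + 4 * m / p\<^sup>2)"
    using m by (simp add: field_simps power2_eq_square power3_eq_cube)
  finally show ?thesis .
qed

text \<open>Sharp when \<open>m\<close> is below the peak \<open>sqrt (2 * p)\<close> of the weight, that is, in the second and third regimes.\<close>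

lemma inc_energy_le:
  assumes m: "0 < m" and p: "1 \<le> p" and mp: "m\<^sup>2 \<le> 2 * p"
  shows "inc_energy p (m powr p)
    \<le> ennreal (exp (- m\<^sup>2 / 2) * (2 * (m / p)\<^sup>2 * (m / (m + 2 * p - m\<^sup>2)) + 128 / m^3 + 4 * m / p\<^sup>2))"
proof -
  let ?f = "\<lambda>x. (\<bar>x\<bar> / m) powr (2 * p) * indicator {x. \<bar>x\<bar> \<le> m} x"
  let ?g = "\<lambda>x. ((\<bar>x\<bar> - m) + \<bar>x\<bar> / p)\<^sup>2 * indicator {x. m \<le> \<bar>x\<bar>} x"
  have "inc_energy p (m powr p) \<le> (\<integral>\<^sup>+x. ennreal ((m / p)\<^sup>2) * ennreal (?f x) + ennreal (?g x) \<partial>std_gaussian)"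
    unfolding inc_energy_def
  proof (rule nn_integral_mono)
    fix x :: real
    have "(root_inc p (m powr p) x)\<^sup>2 \<le> (m / p)\<^sup>2 * ?f x + ?g x"
    proof (cases "\<bar>x\<bar> \<le> m")
      case True
      have "(root_inc p (m powr p) x)\<^sup>2 \<le> (m / p * (\<bar>x\<bar> / m) powr p)\<^sup>2"
        using m p by (intro power_mono root_inc_le_small root_inc_nonneg) auto
      also have "\<dots> = (m / p)\<^sup>2 * ?f x"
      proof -
        have "((\<bar>x\<bar> / m) powr p)\<^sup>2 = (\<bar>x\<bar> / m) powr (2 * p)"
          by (simp add: power2_eq_square flip: powr_add)
        then show ?thesis using True unfolding power_mult_distrib by simp
      qed
      also have "\<dots> \<le> (m / p)\<^sup>2 * ?f x + ?g x" by simp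
      finally show ?thesis .
    next
      case False
      then show ?thesis using m p
        by (auto intro!: power_mono root_inc_le_large root_inc_nonneg)
    qed
    then show "ennreal ((root_inc p (m powr p) x)\<^sup>2) \<le> ennreal ((m / p)\<^sup>2) * ennreal (?f x) + ennreal (?g x)"
    proof -
      have "ennreal ((m / p)\<^sup>2 * ?f x + ?g x) = ennreal ((m / p)\<^sup>2 * ?f x) + ennreal (?g x)"
        by (rule ennreal_plus) auto
      also have "ennreal ((m / p)\<^sup>2 * ?f x) = ennreal ((m / p)\<^sup>2) * ennreal (?f x)"
        by (rule ennreal_mult') simp
      finally show ?thesis using ennreal_leI[OF \<open>(root_inc p (m powr p) x)\<^sup>2 \<le> _\<close>] by simp
    qed
  qed
  also have "\<dots> = ennreal ((m / p)\<^sup>2) * gauss_int (\<lambda>x. ?f x) + gauss_int (\<lambda>x. ?g x)"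
    by (subst nn_integral_add) (auto simp: nn_integral_cmult)
  also have "\<dots> \<le> ennreal ((m / p)\<^sup>2) * ennreal (2 * exp (- m\<^sup>2 / 2) * (m / (m + 2 * p - m\<^sup>2)))
      + ennreal (exp (- m\<^sup>2 / 2) * (128 / m^3 + 4 * m / p\<^sup>2))"
    by (intro add_mono mult_left_mono truncated_moment_upper gaussian_overshoot m p mp) auto
  also have "\<dots> = ennreal ((m / p)\<^sup>2 * (2 * exp (- m\<^sup>2 / 2) * (m / (m + 2 * p - m\<^sup>2)))
      + exp (- m\<^sup>2 / 2) * (128 / m^3 + 4 * m / p\<^sup>2))"
    using m p mp by (subst ennreal_mult'[symmetric], simp, subst ennreal_plus[symmetric]) auto
  finally show ?thesis by (simp add: algebra_simps)
qed

text \<open>The first-order projection of the norm is tested against the two events \<open>\<bar>x\<bar> \<ge> 1/4\<close> and \<open>\<bar>y\<bar> \<le> 1/4\<close>.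
The number \<open>1/4\<close> leaves a fixed distance to \<open>1/2\<close>, the smallest value of \<open>\<bar>x\<bar>\<close> that will contribute.\<close>

definition root_gap :: "real \<Rightarrow> real \<Rightarrow> real \<Rightarrow> real" where
  "root_gap p S x = (S + \<bar>x\<bar> powr p) powr (1 / p) - (S + (1/4) powr p) powr (1 / p)"

definition gap_energy :: "real \<Rightarrow> real \<Rightarrow> ennreal" where
  "gap_energy p S = gauss_int (\<lambda>x. (root_gap p S x)\<^sup>2 * indicator {x. 1/4 \<le> \<bar>x\<bar>} x)"

lemma root_gap_measurable [measurable]: "root_gap p S \<in> borel_measurable borel"
  unfolding root_gap_def[abs_def] by measurable

lemma root_gap_nonneg: "0 \<le> S \<Longrightarrow> 1 \<le> p \<Longrightarrow> 1/4 \<le> \<bar>x\<bar> \<Longrightarrow> 0 \<le> root_gap p S x"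
  unfolding root_gap_def by (auto intro!: powr_mono2 add_left_mono)

text \<open>The lower bound may therefore be computed at any sum \<open>S\<close> of the right order, not only at a median.\<close>

lemma gap_energy_scale:
  assumes "0 \<le> S" "0 < \<kappa>" "\<kappa> \<le> 1" "1 \<le> p"
  shows "gap_energy p (\<kappa> * S) \<le> ennreal (1 / \<kappa>\<^sup>2) * gap_energy p S"
proof -
  have "gap_energy p (\<kappa> * S) \<le> gauss_int (\<lambda>x. ((1 / \<kappa>) * root_gap p S x)\<^sup>2 * indicator {x. 1/4 \<le> \<bar>x\<bar>} x)"
    unfolding gap_energy_def
  proof (intro nn_integral_mono ennreal_leI)
    fix x :: real
    have "root_gap p (\<kappa> * S) x \<le> (1 / \<kappa>) * root_gap p S x" if "1/4 \<le> \<bar>x\<bar>"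
      using powr_mono2[of p "1/4" "\<bar>x\<bar>"] shifted_powr_diff_scale[of S \<kappa> "(1/4) powr p" "\<bar>x\<bar> powr p" "1 / p"] assms that
      by (auto simp: root_gap_def intro!: powr_mono2)
    then show "(root_gap p (\<kappa> * S) x)\<^sup>2 * indicator {x. 1/4 \<le> \<bar>x\<bar>} x
        \<le> ((1 / \<kappa>) * root_gap p S x)\<^sup>2 * indicator {x. 1/4 \<le> \<bar>x\<bar>} x"
      using assms root_gap_nonneg[of "\<kappa> * S" p x] by (auto intro!: power_mono split: split_indicator)
  qed
  also have "\<dots> = (\<integral>\<^sup>+x. ennreal (1 / \<kappa>\<^sup>2) * ennreal ((root_gap p S x)\<^sup>2 * indicator {x. 1/4 \<le> \<bar>x\<bar>} x) \<partial>std_gaussian)"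
    using assms by (intro nn_integral_cong) (simp add: ennreal_mult'[symmetric] power_mult_distrib power_divide)
  also have "\<dots> = ennreal (1 / \<kappa>\<^sup>2) * gap_energy p S"
    unfolding gap_energy_def by (rule nn_integral_cmult) measurable
  finally show ?thesis .
qed

text \<open>Up to \<open>\<bar>x\<bar> = m\<close> the base point at most doubles, so the linearization of the root loses only a factor.\<close>

lemma root_gap_ge:
  assumes p: "1 \<le> p" and x: "1/2 \<le> \<bar>x\<bar>" "\<bar>x\<bar> \<le> m"
  shows "m / (4 * p) * (\<bar>x\<bar> / m) powr p \<le> root_gap p (m powr p) x"
proof -
  have m: "0 < m" using x by linarith
  have quarter: "(1/4) powr p \<le> 1/2 * \<bar>x\<bar> powr p"
  proof -
    have "(1/4) powr p \<le> (1/2 * \<bar>x\<bar>) powr p" using x p by (intro powr_mono2) auto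
    also have "\<dots> = (1/2) powr p * \<bar>x\<bar> powr p" by (rule powr_mult)
    also have "\<dots> \<le> (1/2) powr 1 * \<bar>x\<bar> powr p" using p by (intro mult_right_mono powr_mono') auto
    finally show ?thesis by simp
  qed
  have "1 / (2 * p) * m powr (1 - p) * (\<bar>x\<bar> powr p - (1/4) powr p)
      \<le> (m powr p + \<bar>x\<bar> powr p) powr (1 / p) - (m powr p + (1/4) powr p) powr (1 / p)"
  proof (rule shifted_powr_diff_lower)
    fix y assume y: "(1/4) powr p < y" "y < \<bar>x\<bar> powr p"
    have y0: "0 < y" using y by (smt (verit) powr_ge_zero)
    have "\<bar>x\<bar> powr p \<le> m powr p" using x p by (intro powr_mono2) auto
    then have ym: "m powr p + y \<le> 2 * m powr p" using y by simp
    have "1/2 * m powr (1 - p) \<le> 2 powr (1 / p - 1) * m powr (1 - p)"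
    proof (intro mult_right_mono)
      have "2 powr (- 1) \<le> 2 powr (1 / p - 1 :: real)" using p by (intro powr_mono) auto
      then show "1/2 \<le> 2 powr (1 / p - 1 :: real)" by (simp add: powr_minus_divide)
    qed simp
    also have "\<dots> = (2 * m powr p) powr (1 / p - 1)"
    proof -
      have "p * (1 / p - 1) = 1 - p" using p by (simp add: field_simps)
      then show ?thesis by (simp add: powr_mult powr_powr)
    qed
    also have "\<dots> \<le> (m powr p + y) powr (1 / p - 1)"
      using m y0 p ym by (intro powr_mono2') (auto intro: add_pos_pos)
    finally have "1 / p * (1/2 * m powr (1 - p)) \<le> 1 / p * (m powr p + y) powr (1 / p - 1)"
      using p by (intro mult_left_mono) auto
    then show "1 / (2 * p) * m powr (1 - p) \<le> 1 / p * (m powr p + y) powr (1 / p - 1)" by simp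
  qed (use p x in \<open>auto intro!: powr_mono2\<close>)
  moreover have "m / (4 * p) * (\<bar>x\<bar> / m) powr p \<le> 1 / (2 * p) * m powr (1 - p) * (\<bar>x\<bar> powr p - (1/4) powr p)"
  proof -
    have "m / (4 * p) * (\<bar>x\<bar> / m) powr p = 1 / (2 * p) * m powr (1 - p) * (1/2 * \<bar>x\<bar> powr p)"
      using m p by (simp add: powr_diff powr_divide field_simps)
    also have "\<dots> \<le> 1 / (2 * p) * m powr (1 - p) * (\<bar>x\<bar> powr p - (1/4) powr p)"
      using quarter p by (intro mult_left_mono) auto
    finally show ?thesis .
  qed
  ultimately show ?thesis by (simp add: root_gap_def)
qed

text \<open>Contribution of the window below \<open>M\<close>; taking \<open>M = sqrt (2 * p)\<close>, the peak, gives the first regime and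
\<open>M = m\<close> the second one.\<close>

lemma gap_energy_ge_window:
  assumes p: "1 \<le> p" and M: "1 \<le> M" "M \<le> m" "M\<^sup>2 \<le> 2 * p" "p \<le> M\<^sup>2"
  shows "ennreal ((m / (4 * p))\<^sup>2 * (M / m) powr (2 * p) * (1 / 54 * exp (- M\<^sup>2 / 2) * (M / (M + 2 * p - M\<^sup>2))))
    \<le> gap_energy p (m powr p)"
proof -
  let ?f = "\<lambda>x. (\<bar>x\<bar> / M) powr (2 * p) * indicator {x. M - 1/2 \<le> \<bar>x\<bar> \<and> \<bar>x\<bar> \<le> M} x"
  let ?c = "(m / (4 * p))\<^sup>2 * (M / m) powr (2 * p)"
  have "ennreal (?c * (1 / 54 * exp (- M\<^sup>2 / 2) * (M / (M + 2 * p - M\<^sup>2))))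
      = ennreal ?c * ennreal (1 / 54 * exp (- M\<^sup>2 / 2) * (M / (M + 2 * p - M\<^sup>2)))"
    by (rule ennreal_mult') simp
  also have "\<dots> \<le> ennreal ?c * gauss_int (\<lambda>x. ?f x)"
    using M p by (intro mult_left_mono truncated_moment_lower) auto
  also have "\<dots> = (\<integral>\<^sup>+x. ennreal ?c * ennreal (?f x) \<partial>std_gaussian)"
    by (rule nn_integral_cmult[symmetric]) measurable
  also have "\<dots> \<le> gap_energy p (m powr p)"
    unfolding gap_energy_def
  proof (rule nn_integral_mono)
    fix x :: real
    have "?c * ?f x \<le> (root_gap p (m powr p) x)\<^sup>2 * indicator {x. 1/4 \<le> \<bar>x\<bar>} x"
    proof (cases "M - 1/2 \<le> \<bar>x\<bar> \<and> \<bar>x\<bar> \<le> M")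
      case True
      have "?c * ?f x = (m / (4 * p))\<^sup>2 * ((M / m) powr (2 * p) * (\<bar>x\<bar> / M) powr (2 * p))" using True by simp
      also have "(M / m) powr (2 * p) * (\<bar>x\<bar> / M) powr (2 * p) = (\<bar>x\<bar> / m) powr (2 * p)"
        using M by (subst powr_mult[symmetric]) auto
      also have "(m / (4 * p))\<^sup>2 * (\<bar>x\<bar> / m) powr (2 * p) = (m / (4 * p) * (\<bar>x\<bar> / m) powr p)\<^sup>2"
      proof -
        have "((\<bar>x\<bar> / m) powr p)\<^sup>2 = (\<bar>x\<bar> / m) powr (2 * p)"
          by (simp add: power2_eq_square flip: powr_add)
        then show ?thesis unfolding power_mult_distrib by simp
      qed
      also have "\<dots> \<le> (root_gap p (m powr p) x)\<^sup>2"
        using True M p by (intro power_mono root_gap_ge) auto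
      finally show ?thesis using True M by (auto split: split_indicator)
    qed (auto split: split_indicator)
    then show "ennreal ?c * ennreal (?f x) \<le> ennreal ((root_gap p (m powr p) x)\<^sup>2 * indicator {x. 1/4 \<le> \<bar>x\<bar>} x)"
      by (subst ennreal_mult'[symmetric]) (auto intro!: ennreal_leI)
  qed
  finally show ?thesis .
qed

text \<open>Contribution of the dominating coordinates, which decide the third regime.\<close>

lemma gap_energy_ge_tail:
  assumes p: "1 \<le> p" and S: "0 \<le> S" and T: "1/4 \<le> T" and d: "0 \<le> d" "d \<le> root_gap p S T"
  shows "ennreal (d\<^sup>2 * gtail T) \<le> gap_energy p S"
proof -
  have "ennreal (d\<^sup>2 * gtail T) = ennreal (d\<^sup>2) * gauss_int (\<lambda>x. indicator {x. T \<le> \<bar>x\<bar>} x)"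
    unfolding gauss_int_indicator_tail by (rule ennreal_mult') simp
  also have "\<dots> = (\<integral>\<^sup>+x. ennreal (d\<^sup>2) * ennreal (indicator {x. T \<le> \<bar>x\<bar>} x) \<partial>std_gaussian)"
    by (rule nn_integral_cmult[symmetric]) measurable
  also have "\<dots> \<le> gap_energy p S"
    unfolding gap_energy_def
  proof (rule nn_integral_mono)
    fix x :: real
    have "d \<le> root_gap p S x" if "T \<le> \<bar>x\<bar>"
    proof -
      have "root_gap p S T \<le> root_gap p S x"
        unfolding root_gap_def using that T S p by (auto intro!: powr_mono2 add_left_mono)
      then show ?thesis using d by simp
    qed
    then have "d\<^sup>2 * indicator {x. T \<le> \<bar>x\<bar>} x \<le> (root_gap p S x)\<^sup>2 * indicator {x. 1/4 \<le> \<bar>x\<bar>} x"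
      using T d by (auto split: split_indicator intro!: power_mono)
    then show "ennreal (d\<^sup>2) * ennreal (indicator {x. T \<le> \<bar>x\<bar>} x) \<le> ennreal ((root_gap p S x)\<^sup>2 * indicator {x. 1/4 \<le> \<bar>x\<bar>} x)"
      by (subst ennreal_mult'[symmetric]) (auto intro!: ennreal_leI)
  qed
  finally show ?thesis .
qed

section \<open>Reduction of the variance to one-dimensional integrals\<close>

definition psum :: "real \<Rightarrow> nat \<Rightarrow> (nat \<Rightarrow> real) \<Rightarrow> real" where
  "psum p N x = (\<Sum>i<N. \<bar>x i\<bar> powr p)"

lemma psum_nonneg: "0 \<le> psum p N x"
  by (simp add: psum_def sum_nonneg)

lemma sets_std_gaussian_vec [measurable_cong]:
  "sets (std_gaussian_vec N) = sets (\<Pi>\<^sub>M i\<in>{..<N}. borel)"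
  unfolding std_gaussian_vec_def by (intro sets_PiM_cong) auto

abbreviation law_below :: "real \<Rightarrow> nat \<Rightarrow> real \<Rightarrow> ennreal" where
  "law_below p N a \<equiv> emeasure (std_gaussian_vec N) {x \<in> space (std_gaussian_vec N). psum p N x < a}"

abbreviation law_upto :: "real \<Rightarrow> nat \<Rightarrow> real \<Rightarrow> ennreal" where
  "law_upto p N a \<equiv> emeasure (std_gaussian_vec N) {x \<in> space (std_gaussian_vec N). psum p N x \<le> a}"

abbreviation prob_upto :: "real \<Rightarrow> nat \<Rightarrow> real \<Rightarrow> real" where
  "prob_upto p N a \<equiv> measure (std_gaussian_vec N) {x \<in> space (std_gaussian_vec N). psum p N x \<le> a}"

lemma psum_measurable [measurable]: "psum p N \<in> borel_measurable (std_gaussian_vec N)"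
  unfolding psum_def[abs_def] by measurable

lemma gaussian_powr_integrable:
  assumes "0 < q"
  shows "integrable std_gaussian (\<lambda>x. \<bar>x\<bar> powr q)"
proof (rule integrableI_bounded)
  show "gauss_int (\<lambda>x. norm (\<bar>x\<bar> powr q)) < \<infinity>"
    using le_less_trans[OF gaussian_moment_le[OF assms]] by simp
qed (simp cong: measurable_cong_sets)

lemma iid_sum_std_gaussian:
  assumes "1 \<le> p"
  shows "iid_sum std_gaussian (\<lambda>x. \<bar>x\<bar> powr p)"
proof -
  interpret prob_space std_gaussian by (rule prob_space_std_gaussian)
  show ?thesis
  proof unfold_locales
    have "(\<bar>x\<bar> powr p)\<^sup>2 = \<bar>x\<bar> powr (2 * p)" for x :: real
      by (simp add: power2_eq_square flip: powr_add)
    then show "integrable std_gaussian (\<lambda>x. (\<bar>x\<bar> powr p)\<^sup>2)"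
      using gaussian_powr_integrable[of "2 * p"] assms by simp
  qed (simp cong: measurable_cong_sets)
qed

lemma std_gaussian_vec_iid_law:
  assumes "1 \<le> p"
  shows "std_gaussian_vec N = iid_sum.iid_law std_gaussian N"
    and "psum p N x = iid_sum.isum (\<lambda>x. \<bar>x\<bar> powr p) N x"
proof -
  interpret iid_sum std_gaussian "\<lambda>x. \<bar>x\<bar> powr p" by (rule iid_sum_std_gaussian[OF assms])
  show "std_gaussian_vec N = iid_law N" by (simp add: std_gaussian_vec_def)
  show "psum p N x = isum N x" by (simp add: psum_def isum_def)
qed

lemma lp_norm_psum: "lp_norm N (ereal p) x = \<bar>psum p N x\<bar> powr (1 / p)"
  using psum_nonneg[of p N x] by (simp add: lp_norm_def psum_def)

lemma lin_growth_root:
  assumes "1 \<le> p"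
  shows "(\<lambda>s. \<bar>s\<bar> powr (1 / p)) \<in> borel_measurable borel \<and> (\<exists>A. \<forall>s. \<bar>\<bar>s\<bar> powr (1 / p)\<bar> \<le> A + \<bar>s::real\<bar>)"
proof (intro conjI exI allI)
  fix s :: real
  show "\<bar>\<bar>s\<bar> powr (1 / p)\<bar> \<le> 1 + \<bar>s\<bar>"
  proof (cases "\<bar>s\<bar> \<le> 1")
    case True
    then have "\<bar>s\<bar> powr (1 / p) \<le> 1 powr (1 / p)" using assms by (intro powr_mono2) auto
    then show ?thesis by simp
  next
    case False
    then have "\<bar>s\<bar> powr (1 / p) \<le> \<bar>s\<bar> powr 1" using assms by (intro powr_mono) auto
    then show ?thesis by simp
  qed
qed measurable

text \<open>The Efron-Stein bound, with the one-coordinate variance replaced by the second moment of the increment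
from coordinate \<open>0\<close>; the loss is a constant factor.\<close>

lemma var_lp_norm_le:
  assumes p: "1 \<le> p"
  shows "ennreal (var_lp_norm (Suc N) (ereal p))
    \<le> of_nat (2 * Suc N) * (\<integral>\<^sup>+x. inc_energy p (psum p N x) \<partial>std_gaussian_vec N)"
proof -
  interpret iid_sum std_gaussian "\<lambda>x. \<bar>x\<bar> powr p" by (rule iid_sum_std_gaussian[OF p])
  let ?\<phi> = "\<lambda>s::real. \<bar>s\<bar> powr (1 / p)"
  have lg: "lin_growth ?\<phi>" using lin_growth_root[OF p] by (simp add: lin_growth_def)
  have V: "var_lp_norm (Suc N) (ereal p) = prob_space.variance (iid_law (Suc N)) (\<lambda>x. ?\<phi> (isum (Suc N) x))"
    unfolding var_lp_norm_def lp_norm_psum[abs_def] std_gaussian_vec_iid_law[OF p] ..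
  have d: "step_var ?\<phi> s \<le> 4 * inc_energy p s" if "0 \<le> s" for s
  proof -
    have "step_var ?\<phi> s \<le> 4 * gauss_int (\<lambda>x. (?\<phi> (s + \<bar>x\<bar> powr p) - ?\<phi> s)\<^sup>2)"
      by (rule step_var_le_increment) measurable
    also have "gauss_int (\<lambda>x. (?\<phi> (s + \<bar>x\<bar> powr p) - ?\<phi> s)\<^sup>2) = inc_energy p s"
      using that unfolding inc_energy_def root_inc_def by simp
    finally show ?thesis .
  qed
  have "ennreal (2 * var_lp_norm (Suc N) (ereal p)) \<le> of_nat (Suc N) * (\<integral>\<^sup>+x. step_var ?\<phi> (isum N x) \<partial>iid_law N)"
    unfolding V by (rule variance_sum_bounds(2)[OF lg]) simp
  also have "\<dots> \<le> of_nat (Suc N) * (\<integral>\<^sup>+x. 4 * inc_energy p (isum N x) \<partial>iid_law N)"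
    by (intro mult_left_mono nn_integral_mono d) (auto simp: isum_def sum_nonneg)
  also have "(\<integral>\<^sup>+x. 4 * inc_energy p (isum N x) \<partial>iid_law N) = 4 * (\<integral>\<^sup>+x. inc_energy p (isum N x) \<partial>iid_law N)"
    unfolding inc_energy_def
    by (rule nn_integral_cmult) measurable
  also have "of_nat (Suc N) * (4 * (\<integral>\<^sup>+x. inc_energy p (isum N x) \<partial>iid_law N))
      = 2 * (of_nat (2 * Suc N) * (\<integral>\<^sup>+x. inc_energy p (isum N x) \<partial>iid_law N))"
  proof -
    have 4: "(4::ennreal) = 2 * 2" by simp
    show ?thesis unfolding 4 of_nat_mult by (simp only: mult_ac of_nat_numeral)
  qed
  finally have "2 * ennreal (var_lp_norm (Suc N) (ereal p))
      \<le> 2 * (of_nat (2 * Suc N) * (\<integral>\<^sup>+x. inc_energy p (isum N x) \<partial>iid_law N))"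
    by (simp add: ennreal_mult')
  then show ?thesis unfolding std_gaussian_vec_iid_law[OF p]
    by (subst (asm) ennreal_mult_le_mult_iff) auto
qed

lemma gaussian_quarter: "ennreal (1/24) \<le> gauss_int (\<lambda>y. indicator {y. \<bar>y\<bar> \<le> 1/4} y)"
proof -
  have "ennreal (1/2 * (1/4 - 0) / 3) \<le> gauss_int (\<lambda>y. indicator {y. \<bar>y\<bar> \<le> 1/4} y)"
  proof (rule gaussian_integral_lower)
    fix t :: real assume t: "0 \<le> t" "t \<le> 1/4"
    have "t\<^sup>2 \<le> (1/4)\<^sup>2" using t by (intro power_mono) auto
    then have "1/2 \<le> 1 + (- t\<^sup>2 / 2)" by (simp add: power2_eq_square)
    also have "\<dots> \<le> exp (- t\<^sup>2 / 2)" by (rule exp_ge_add_one_self)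
    finally show "1/2 \<le> exp (- t\<^sup>2 / 2) * indicator {y. \<bar>y\<bar> \<le> 1/4} t" using t by simp
  qed auto
  then show ?thesis by simp
qed

text \<open>The first-order lower bound. Increments of the conditional expectation are averages of increments over
the base point, and on the event that the base point is at most \<open>S1\<close> each of them is at least the one at
\<open>S1\<close>. Restricting the independent copy \<open>y\<close> to \<open>\<bar>y\<bar> \<le> 1/4\<close> makes the difference a \<open>root_gap\<close>.\<close>

lemma var_lp_norm_ge:
  assumes p: "1 \<le> p" and S1: "0 \<le> S1"
    and med: "1/2 \<le> prob_upto p N (S1)"
  shows "of_nat (Suc N) * gap_energy p S1 \<le> ennreal (192 * var_lp_norm (Suc N) (ereal p))"
proof -
  interpret iid_sum std_gaussian "\<lambda>x. \<bar>x\<bar> powr p" by (rule iid_sum_std_gaussian[OF p])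
  let ?\<phi> = "\<lambda>s::real. \<bar>s\<bar> powr (1 / p)"
  interpret P: prob_space "iid_law N" by (rule prob_space_iid_law)
  have lg: "lin_growth ?\<phi>" using lin_growth_root[OF p] by (simp add: lin_growth_def)
  have V: "var_lp_norm (Suc N) (ereal p) = prob_space.variance (iid_law (Suc N)) (\<lambda>x. ?\<phi> (isum (Suc N) x))"
    unfolding var_lp_norm_def lp_norm_psum[abs_def] std_gaussian_vec_iid_law[OF p] ..
  define A where "A = {x \<in> space (iid_law N). isum N x \<le> S1}"
  have A [measurable]: "A \<in> sets (iid_law N)" unfolding A_def by measurable
  have medA: "1/2 \<le> measure (iid_law N) A" using med unfolding std_gaussian_vec_iid_law[OF p] A_def .
  define H where "H t = (\<integral>x. ?\<phi> (t + isum N x) \<partial>iid_law N)" for t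
  have Hm [measurable]: "H \<in> borel_measurable borel"
    using integral_iid_law[OF lg, of _ N] lin_growth_mean_op[OF lg, of N] unfolding lin_growth_def H_def by simp
  have key: "(1/2 * root_gap p S1 x)\<^sup>2 \<le> (H (0 + \<bar>x\<bar> powr p) - H (0 + \<bar>y\<bar> powr p))\<^sup>2"
    if x: "1/4 \<le> \<bar>x\<bar>" and y: "\<bar>y\<bar> \<le> 1/4" for x y
  proof -
    have yx: "\<bar>y\<bar> powr p \<le> (1/4) powr p" "(1/4) powr p \<le> \<bar>x\<bar> powr p"
      using x y p by (auto intro: powr_mono2)
    have lo: "0 \<le> root_gap p S1 x" using root_gap_nonneg[OF S1 p x] .
    have "1/2 * root_gap p S1 x \<le> measure (iid_law N) A * root_gap p S1 x"
      using medA lo by (intro mult_right_mono) auto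
    also have "\<dots> = (\<integral>z. indicator A z * root_gap p S1 x \<partial>iid_law N)" by simp
    also have "\<dots> \<le> (\<integral>z. ?\<phi> (\<bar>x\<bar> powr p + isum N z) - ?\<phi> (\<bar>y\<bar> powr p + isum N z) \<partial>iid_law N)"
    proof (rule integral_mono)
      show "integrable (iid_law N) (\<lambda>z. indicator A z * root_gap p S1 x)"
        by (intro integrable_mult_left integrable_real_indicator) (auto simp: P.emeasure_eq_measure)
      show "integrable (iid_law N) (\<lambda>z. ?\<phi> (\<bar>x\<bar> powr p + isum N z) - ?\<phi> (\<bar>y\<bar> powr p + isum N z))"
        using lin_growth_sum_integrable[OF lg] by auto
      fix z
      have s: "0 \<le> isum N z" by (simp add: isum_def sum_nonneg)
      have mono: "(isum N z + \<bar>y\<bar> powr p) powr (1 / p) \<le> (isum N z + (1/4) powr p) powr (1 / p)"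
        "(isum N z + (1/4) powr p) powr (1 / p) \<le> (isum N z + \<bar>x\<bar> powr p) powr (1 / p)"
        using yx s p by (auto intro!: powr_mono2)
      have "root_gap p S1 x \<le> (isum N z + \<bar>x\<bar> powr p) powr (1 / p) - (isum N z + (1/4) powr p) powr (1 / p)" if "z \<in> A"
        unfolding root_gap_def using that s yx p by (intro shifted_powr_diff_antimono) (auto simp: A_def)
      then show "indicator A z * root_gap p S1 x \<le> ?\<phi> (\<bar>x\<bar> powr p + isum N z) - ?\<phi> (\<bar>y\<bar> powr p + isum N z)"
        using mono s by (auto split: split_indicator simp: add.commute)
    qed
    also have "\<dots> = H (0 + \<bar>x\<bar> powr p) - H (0 + \<bar>y\<bar> powr p)"
      unfolding H_def using lin_growth_sum_integrable[OF lg] by simp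
    finally show ?thesis using lo by (intro power_mono) auto
  qed
  let ?I = "\<lambda>x. indicator {x. 1/4 \<le> \<bar>x\<bar>} x :: real"
  let ?J = "\<lambda>y. indicator {y. \<bar>y\<bar> \<le> 1/4} y :: real"
  have "ennreal (1/96) * gap_energy p S1 = ennreal (1/4) * gap_energy p S1 * ennreal (1/24)"
  proof -
    have "ennreal (1/96) = ennreal (1/4) * ennreal (1/24)" by (subst ennreal_mult'[symmetric]) auto
    then show ?thesis by (simp only: mult_ac)
  qed
  also have "\<dots> \<le> ennreal (1/4) * gap_energy p S1 * gauss_int (\<lambda>y. ?J y)"
    by (intro mult_left_mono gaussian_quarter) simp
  also have "\<dots> = (\<integral>\<^sup>+x. ennreal (1/4) * ennreal ((root_gap p S1 x)\<^sup>2 * ?I x) * gauss_int (\<lambda>y. ?J y) \<partial>std_gaussian)"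
    unfolding gap_energy_def by (simp add: nn_integral_cmult nn_integral_multc)
  also have "\<dots> = (\<integral>\<^sup>+x. \<integral>\<^sup>+y. ennreal (1/4) * ennreal ((root_gap p S1 x)\<^sup>2 * ?I x) * ennreal (?J y) \<partial>std_gaussian \<partial>std_gaussian)"
    by (intro nn_integral_cong nn_integral_cmult[symmetric]) measurable
  also have "\<dots> \<le> step_var H 0"
    unfolding step_var_def
  proof (intro nn_integral_mono)
    fix x y :: real
    have "ennreal (1/4) * ennreal ((root_gap p S1 x)\<^sup>2 * ?I x) * ennreal (?J y)
        = ennreal ((1/2 * root_gap p S1 x)\<^sup>2 * ?I x * ?J y)"
    proof -
      have "(1/2 * root_gap p S1 x)\<^sup>2 * ?I x * ?J y = 1/4 * ((root_gap p S1 x)\<^sup>2 * ?I x) * ?J y"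
        by (simp add: power_mult_distrib power_divide)
      moreover have "ennreal (1/4 * ((root_gap p S1 x)\<^sup>2 * ?I x) * ?J y) = ennreal (1/4 * ((root_gap p S1 x)\<^sup>2 * ?I x)) * ennreal (?J y)"
        by (rule ennreal_mult'') simp
      moreover have "ennreal (1/4 * ((root_gap p S1 x)\<^sup>2 * ?I x)) = ennreal (1/4) * ennreal ((root_gap p S1 x)\<^sup>2 * ?I x)"
        by (rule ennreal_mult') simp
      ultimately show ?thesis by (simp only:)
    qed
    also have "\<dots> \<le> ennreal ((H (0 + \<bar>x\<bar> powr p) - H (0 + \<bar>y\<bar> powr p))\<^sup>2)"
      using key[of x y] by (intro ennreal_leI) (auto split: split_indicator)
    finally show "ennreal (1/4) * ennreal ((root_gap p S1 x)\<^sup>2 * ?I x) * ennreal (?J y)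
      \<le> ennreal ((H (0 + \<bar>x\<bar> powr p) - H (0 + \<bar>y\<bar> powr p))\<^sup>2)" .
  qed
  finally have 1: "ennreal (1/96) * gap_energy p S1 \<le> step_var H 0" .
  have "of_nat (Suc N) * (ennreal (1/96) * gap_energy p S1) \<le> of_nat (Suc N) * step_var H 0"
    by (intro mult_left_mono 1) simp
  also have "\<dots> \<le> ennreal (2 * var_lp_norm (Suc N) (ereal p))"
    unfolding V H_def[abs_def] by (rule variance_sum_bounds(1)[OF lg]) simp
  finally have 2: "of_nat (Suc N) * (ennreal (1/96) * gap_energy p S1) \<le> ennreal (2 * var_lp_norm (Suc N) (ereal p))" .
  have "of_nat (Suc N) * gap_energy p S1 = ennreal 96 * (of_nat (Suc N) * (ennreal (1/96) * gap_energy p S1))"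
  proof -
    have "ennreal 96 * ennreal (1/96) = 1" by (subst ennreal_mult'[symmetric]) auto
    then have "(ennreal 96 * ennreal (1/96)) * (of_nat (Suc N) * gap_energy p S1) = of_nat (Suc N) * gap_energy p S1"
      by simp
    then show ?thesis by (simp only: mult_ac)
  qed
  also have "\<dots> \<le> ennreal 96 * ennreal (2 * var_lp_norm (Suc N) (ereal p))"
    by (intro mult_left_mono 2) simp
  also have "\<dots> = ennreal (192 * var_lp_norm (Suc N) (ereal p))"
    by (subst ennreal_mult'[symmetric]) auto
  finally show ?thesis .
qed

text \<open>Truncation at \<open>r\<close> keeps the summands bounded; the exponent is the expected number of coordinates that
reach the truncation level.\<close>

lemma psum_lower_tail:
  assumes p: "1 \<le> p" and r: "0 < r" and m: "ennreal m \<le> gauss_int (\<lambda>x. min (\<bar>x\<bar> powr p) (r powr p))"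
  shows "law_upto p N (real N * m / 2)
    \<le> ennreal (exp (- (real N * gtail r / 8)))"
proof -
  interpret iid_sum std_gaussian "\<lambda>x. \<bar>x\<bar> powr p" by (rule iid_sum_std_gaussian[OF p])
  let ?Y = "\<lambda>x::real. min (\<bar>x\<bar> powr p) (r powr p)"
  have i: "integrable std_gaussian ?Y"
    by (rule integrable_const_bound[of _ "r powr p"]) (auto cong: measurable_cong_sets)
  have I: "gauss_int (\<lambda>x. ?Y x) = ennreal (\<integral>x. ?Y x \<partial>std_gaussian)"
    using i by (intro nn_integral_eq_integral) auto
  have "law_upto p N (real N * m / 2)
    \<le> emeasure (iid_law N) {x \<in> space (iid_law N). (\<Sum>i<N. ?Y (x i)) \<le> real N * m / 2}"
  proof -
    have le: "(\<Sum>i<N. ?Y (x i)) \<le> psum p N x" for x unfolding psum_def by (intro sum_mono) auto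
    show ?thesis unfolding std_gaussian_vec_iid_law(1)[OF p]
    proof (rule emeasure_mono)
      show "{x \<in> space (iid_law N). psum p N x \<le> real N * m / 2}
        \<subseteq> {x \<in> space (iid_law N). (\<Sum>i<N. ?Y (x i)) \<le> real N * m / 2}"
        using le order_trans by blast
    qed measurable
  qed
  also have "\<dots> \<le> ennreal (exp (- (real N * gtail r / 8)))"
  proof (rule bounded_sum_lower_tail[where b = "r powr p"])
    show "m \<le> (\<integral>x. ?Y x \<partial>std_gaussian)" using m unfolding I by (subst (asm) ennreal_le_iff) auto
    have "ennreal (r powr p * gtail r) = ennreal (r powr p) * gauss_int (\<lambda>x. indicator {x. r \<le> \<bar>x\<bar>} x)"
      unfolding gauss_int_indicator_tail by (rule ennreal_mult') simp
    also have "\<dots> = (\<integral>\<^sup>+x. ennreal (r powr p) * ennreal (indicator {x. r \<le> \<bar>x\<bar>} x) \<partial>std_gaussian)"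
      by (rule nn_integral_cmult[symmetric]) measurable
    also have "\<dots> \<le> gauss_int (\<lambda>x. ?Y x)"
      using r p by (intro nn_integral_mono) (auto split: split_indicator intro!: ennreal_leI powr_mono2)
    finally show "r powr p * gtail r \<le> (\<integral>x. ?Y x \<partial>std_gaussian)" unfolding I by (subst (asm) ennreal_le_iff) auto
  qed (use r in auto)
  finally show ?thesis .
qed

lemma psum_lower_tail_moments:
  assumes p: "1 \<le> p" and m: "0 \<le> m" "ennreal m \<le> gauss_int (\<lambda>x. \<bar>x\<bar> powr p)"
    and v: "0 < v" "gauss_int (\<lambda>x. \<bar>x\<bar> powr (2 * p)) \<le> ennreal v"
  shows "law_upto p N (real N * m / 2)
    \<le> ennreal (exp (- (real N * m\<^sup>2 / (8 * v))))"
proof -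
  interpret iid_sum std_gaussian "\<lambda>x. \<bar>x\<bar> powr p" by (rule iid_sum_std_gaussian[OF p])
  have sq: "(\<bar>x\<bar> powr p)\<^sup>2 = \<bar>x\<bar> powr (2 * p)" for x :: real
    by (simp add: power2_eq_square flip: powr_add)
  have 1: "gauss_int (\<lambda>x. \<bar>x\<bar> powr p) = ennreal (\<integral>x. \<bar>x\<bar> powr p \<partial>std_gaussian)"
    using gaussian_powr_integrable[of p] p by (intro nn_integral_eq_integral) auto
  have 2: "gauss_int (\<lambda>x. \<bar>x\<bar> powr (2 * p)) = ennreal (\<integral>x. \<bar>x\<bar> powr (2 * p) \<partial>std_gaussian)"
    using gaussian_powr_integrable[of "2 * p"] p by (intro nn_integral_eq_integral) auto
  show ?thesis
    unfolding std_gaussian_vec_iid_law(1)[OF p] psum_def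
  proof (rule sum_lower_tail)
    show "integrable std_gaussian (\<lambda>x. \<bar>x\<bar> powr p)" using gaussian_powr_integrable[of p] p by simp
    show "integrable std_gaussian (\<lambda>x. (\<bar>x\<bar> powr p)\<^sup>2)" by (rule h_sq)
    show "m \<le> (\<integral>x. \<bar>x\<bar> powr p \<partial>std_gaussian)" using m unfolding 1 by (subst (asm) ennreal_le_iff) auto
    show "(\<integral>x. (\<bar>x\<bar> powr p)\<^sup>2 \<partial>std_gaussian) \<le> v"
      using v unfolding 2 sq by (subst (asm) ennreal_le_iff) auto
  qed (use m v in auto)
qed

text \<open>With \<open>B\<close> a set of exceptional values for a coordinate: either some coordinate lies in \<open>B\<close>, or the sum is
the sum of the truncated terms.\<close>

lemma psum_median_le:
  assumes p: "1 \<le> p" and S1: "0 < S1"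
    and B [measurable]: "B \<in> sets borel"
    and c: "real N * (c1 + c2) \<le> 1/2" "0 \<le> c1" "0 \<le> c2"
      "gauss_int (\<lambda>x. indicator B x) \<le> ennreal c1"
      "gauss_int (\<lambda>x. \<bar>x\<bar> powr p * indicator (- B) x) \<le> ennreal (c2 * S1)"
  shows "1/2 \<le> prob_upto p N (S1)"
proof -
  interpret iid_sum std_gaussian "\<lambda>x. \<bar>x\<bar> powr p" by (rule iid_sum_std_gaussian[OF p])
  interpret P: prob_space "iid_law N" by (rule prob_space_iid_law)
  define y where "y x = ennreal (indicator B x) + ennreal (1 / S1) * ennreal (\<bar>x\<bar> powr p * indicator (- B) x)" for x :: real
  have [measurable]: "y \<in> borel_measurable borel" unfolding y_def[abs_def] by measurable
  have "(\<integral>\<^sup>+x. y x \<partial>std_gaussian) = gauss_int (\<lambda>x. indicator B x)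
     + ennreal (1 / S1) * gauss_int (\<lambda>x. \<bar>x\<bar> powr p * indicator (- B) x)"
    unfolding y_def by (subst nn_integral_add) (auto simp: nn_integral_cmult)
  also have "\<dots> \<le> ennreal c1 + ennreal (1 / S1) * ennreal (c2 * S1)"
    by (intro add_mono mult_left_mono c) auto
  also have "\<dots> = ennreal (c1 + c2)"
    using S1 c by (subst ennreal_mult'[symmetric]) (auto simp: ennreal_plus)
  finally have y: "(\<integral>\<^sup>+x. y x \<partial>std_gaussian) \<le> ennreal (c1 + c2)" .
  let ?D = "{x \<in> space (iid_law N). S1 < psum p N x}"
  have D [measurable]: "?D \<in> sets (iid_law N)" unfolding std_gaussian_vec_iid_law[OF p] by measurable
  have "emeasure (iid_law N) ?D \<le> emeasure (iid_law N) {x \<in> space (iid_law N). 1 \<le> (\<Sum>i<N. y (x i))}"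
  proof (rule emeasure_mono)
    show "?D \<subseteq> {x \<in> space (iid_law N). 1 \<le> (\<Sum>i<N. y (x i))}"
    proof clarify
      fix x assume x: "S1 < psum p N x"
      show "1 \<le> (\<Sum>i<N. y (x i))"
      proof (cases "\<exists>i<N. x i \<in> B")
        case True
        then obtain i where i: "i < N" "x i \<in> B" by auto
        have "1 \<le> y (x i)" using i by (auto simp: y_def)
        also have "\<dots> \<le> (\<Sum>i<N. y (x i))" using i by (intro member_le_sum) auto
        finally show ?thesis .
      next
        case False
        have "1 \<le> 1 / S1 * psum p N x" using x S1 by (simp add: field_simps)
        then have "1 \<le> ennreal (1 / S1 * psum p N x)" by simp
        also have "\<dots> = (\<Sum>i<N. ennreal (1 / S1 * \<bar>x i\<bar> powr p))"
          unfolding psum_def sum_distrib_left using S1 by (subst sum_ennreal) auto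
        also have "\<dots> \<le> (\<Sum>i<N. y (x i))"
          using False S1 by (intro sum_mono) (auto simp: y_def ennreal_mult'[symmetric])
        finally show ?thesis .
      qed
    qed
  qed measurable
  also have "\<dots> \<le> of_nat N * (\<integral>\<^sup>+x. y x \<partial>std_gaussian)" by (rule sum_ge_one_prob) measurable
  also have "\<dots> \<le> of_nat N * ennreal (c1 + c2)" by (intro mult_left_mono y) simp
  also have "\<dots> = ennreal (real N * (c1 + c2))" by (simp add: ennreal_mult' ennreal_of_nat_eq_real_of_nat)
  also have "\<dots> \<le> ennreal (1/2)" by (intro ennreal_leI c)
  finally have F: "emeasure (iid_law N) ?D \<le> ennreal (1/2)" .
  have "measure (iid_law N) ?D \<le> 1/2"
    using F unfolding P.emeasure_eq_measure by (subst (asm) ennreal_le_iff) auto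
  moreover have "measure (iid_law N) (space (iid_law N) - ?D) = 1 - measure (iid_law N) ?D"
    by (rule P.prob_compl) measurable
  moreover have "space (iid_law N) - ?D = {x \<in> space (iid_law N). psum p N x \<le> S1}" by auto
  ultimately show ?thesis unfolding std_gaussian_vec_iid_law(1)[OF p] by simp
qed

text \<open>If the sum is below \<open>r powr p\<close>, no coordinate reaches \<open>r\<close>.\<close>

lemma psum_lower_tail_max:
  assumes p: "1 \<le> p" and r: "0 < r"
  shows "law_below p N (r powr p)
    \<le> ennreal (exp (- (real N * gtail r / 8)))"
proof -
  interpret iid_sum std_gaussian "\<lambda>x. \<bar>x\<bar> powr p" by (rule iid_sum_std_gaussian[OF p])
  let ?Y = "\<lambda>x::real. indicator {x. r \<le> \<bar>x\<bar>} x :: real"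
  have [measurable]: "?Y \<in> borel_measurable std_gaussian" by (simp cong: measurable_cong_sets)
  have E: "(\<integral>x. ?Y x \<partial>std_gaussian) = gtail r"
    by (simp add: gtail_def)
  have sub: "{x \<in> space (iid_law N). psum p N x < r powr p} \<subseteq> {x \<in> space (iid_law N). (\<Sum>i<N. ?Y (x i)) \<le> real N * 0 / 2}"
  proof clarify
    fix x assume x: "psum p N x < r powr p"
    have "\<bar>x i\<bar> < r" if "i < N" for i
    proof (rule ccontr)
      assume "\<not> \<bar>x i\<bar> < r"
      then have "r powr p \<le> \<bar>x i\<bar> powr p" using r p by (intro powr_mono2) auto
      also have "\<dots> \<le> psum p N x" unfolding psum_def using that by (intro member_le_sum) auto
      finally show False using x by simp
    qed
    then have "?Y (x i) = 0" if "i < N" for i using that by (force split: split_indicator)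
    then show "(\<Sum>i<N. ?Y (x i)) \<le> real N * 0 / 2" by simp
  qed
  have "emeasure (iid_law N) {x \<in> space (iid_law N). psum p N x < r powr p}
    \<le> emeasure (iid_law N) {x \<in> space (iid_law N). (\<Sum>i<N. ?Y (x i)) \<le> real N * 0 / 2}"
    by (rule emeasure_mono[OF sub]) measurable
  also have "\<dots> \<le> ennreal (exp (- (real N * gtail r / 8)))"
    by (rule bounded_sum_lower_tail[where b = 1])
       (auto simp: E gtail_def split: split_indicator)
  finally show ?thesis unfolding std_gaussian_vec_iid_law(1)[OF p] .
qed

text \<open>A staircase majorant for a decreasing function: below the level \<open>\<sigma> k\<close> the value at the next level
\<open>\<sigma> (Suc k)\<close> is added, and below the last level the trivial bound \<open>2\<close>.\<close>

lemma inc_energy_levels: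
  fixes K :: nat
  assumes p: "1 \<le> p" and S: "0 \<le> S" and \<sigma>: "\<And>k. k \<le> K \<Longrightarrow> 0 \<le> \<sigma> k"
  shows "inc_energy p S \<le> inc_energy p (\<sigma> 0) + (\<Sum>k<K. inc_energy p (\<sigma> (Suc k)) * indicator {s. s < \<sigma> k} S) + 2 * indicator {s. s < \<sigma> K} S"
proof -
  define c where "c k = inc_energy p (\<sigma> (Suc k)) * indicator {s. s < \<sigma> k} S" for k
  have step: "inc_energy p S \<le> inc_energy p (\<sigma> k) + 2 * indicator {s. s < \<sigma> k} S" if "k \<le> K" for k
  proof (cases "S < \<sigma> k")
    case True
    have "inc_energy p S \<le> inc_energy p (\<sigma> k) + 2" using inc_energy_le_2[OF S p] by (rule add_increasing[OF zero_le])
    then show ?thesis using True by simp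
  next
    case False
    then show ?thesis using inc_energy_antimono[of "\<sigma> k" S p] p \<sigma>[OF that] by simp
  qed
  have "inc_energy p S \<le> inc_energy p (\<sigma> 0) + (\<Sum>k<L. c k) + 2 * indicator {s. s < \<sigma> L} S" if "L \<le> K" for L
    using that
  proof (induction L)
    case 0
    then show ?case using step[of 0] by simp
  next
    case (Suc L)
    have IH: "inc_energy p S \<le> inc_energy p (\<sigma> 0) + (\<Sum>k<L. c k) + 2 * indicator {s. s < \<sigma> L} S"
      using Suc by auto
    show ?case
    proof (cases "S < \<sigma> L")
      case False
      then have "inc_energy p S \<le> inc_energy p (\<sigma> 0) + (\<Sum>k<L. c k)" using IH by simp
      also have "\<dots> \<le> \<dots> + (c L + 2 * indicator {s. s < \<sigma> (Suc L)} S)" by (rule add_increasing2) auto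
      finally show ?thesis by (simp add: add.assoc)
    next
      case True
      have "inc_energy p S \<le> c L + 2 * indicator {s. s < \<sigma> (Suc L)} S"
        using step[OF Suc.prems] True by (simp add: c_def)
      also have "\<dots> \<le> (inc_energy p (\<sigma> 0) + (\<Sum>k<L. c k)) + (c L + 2 * indicator {s. s < \<sigma> (Suc L)} S)"
        by (rule add_increasing) auto
      finally show ?thesis by (simp add: add.assoc)
    qed
  qed
  from this[of K] show ?thesis by (simp only: c_def order_refl)
qed

lemma expectation_inc_energy_levels:
  fixes K :: nat
  assumes p: "1 \<le> p" and \<sigma>: "\<And>k. k \<le> K \<Longrightarrow> 0 \<le> \<sigma> k"
    and U: "\<And>k. k \<le> K \<Longrightarrow> inc_energy p (\<sigma> k) \<le> ennreal (B * b k)" and B: "0 \<le> B" "\<And>k. 0 \<le> b k"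
    and P: "\<And>k. k \<le> K \<Longrightarrow> law_below p N (\<sigma> k) \<le> ennreal (e k)"
    and e: "\<And>k. 0 \<le> e k"
  shows "(\<integral>\<^sup>+x. inc_energy p (psum p N x) \<partial>std_gaussian_vec N)
    \<le> ennreal (B * (b 0 + (\<Sum>k<K. b (Suc k) * e k)) + 2 * e K)"
proof -
  let ?G = "std_gaussian_vec N"
  interpret P: prob_space ?G by (rule prob_space_std_gaussian_vec)
  let ?A = "\<lambda>k. {x \<in> space ?G. psum p N x < \<sigma> k}"
  have [measurable]: "?A k \<in> sets ?G" for k by measurable
  have "(\<integral>\<^sup>+x. inc_energy p (psum p N x) \<partial>?G) \<le> (\<integral>\<^sup>+x. inc_energy p (\<sigma> 0)
      + (\<Sum>k<K. inc_energy p (\<sigma> (Suc k)) * indicator (?A k) x) + 2 * indicator (?A K) x \<partial>?G)"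
  proof (rule nn_integral_mono)
    fix x assume x: "x \<in> space ?G"
    have ind: "indicator {s. s < \<sigma> k} (psum p N x) = (indicator (?A k) x :: ennreal)" for k
      using x by (auto split: split_indicator)
    show "inc_energy p (psum p N x) \<le> inc_energy p (\<sigma> 0)
      + (\<Sum>k<K. inc_energy p (\<sigma> (Suc k)) * indicator (?A k) x) + 2 * indicator (?A K) x"
      using inc_energy_levels[OF p psum_nonneg[of p N x] \<sigma>] unfolding ind .
  qed
  also have "\<dots> = inc_energy p (\<sigma> 0) + (\<Sum>k<K. inc_energy p (\<sigma> (Suc k)) * emeasure ?G (?A k)) + 2 * emeasure ?G (?A K)"
  proof -
    have 1: "(\<integral>\<^sup>+x. (\<Sum>k<K. inc_energy p (\<sigma> (Suc k)) * indicator (?A k) x) \<partial>?G)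
        = (\<Sum>k<K. inc_energy p (\<sigma> (Suc k)) * emeasure ?G (?A k))"
      by (subst nn_integral_sum) (auto simp: nn_integral_cmult_indicator)
    have 2: "(\<integral>\<^sup>+x. 2 * indicator (?A K) x \<partial>?G) = 2 * emeasure ?G (?A K)"
      by (rule nn_integral_cmult_indicator) measurable
    have 3: "(\<integral>\<^sup>+x. inc_energy p (\<sigma> 0) \<partial>?G) = inc_energy p (\<sigma> 0)"
      by (simp add: P.emeasure_space_1)
    have "(\<integral>\<^sup>+x. inc_energy p (\<sigma> 0) + (\<Sum>k<K. inc_energy p (\<sigma> (Suc k)) * indicator (?A k) x) + 2 * indicator (?A K) x \<partial>?G)
      = (\<integral>\<^sup>+x. inc_energy p (\<sigma> 0) + (\<Sum>k<K. inc_energy p (\<sigma> (Suc k)) * indicator (?A k) x) \<partial>?G) + (\<integral>\<^sup>+x. 2 * indicator (?A K) x \<partial>?G)"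
      by (rule nn_integral_add) measurable
    also have "(\<integral>\<^sup>+x. inc_energy p (\<sigma> 0) + (\<Sum>k<K. inc_energy p (\<sigma> (Suc k)) * indicator (?A k) x) \<partial>?G)
      = (\<integral>\<^sup>+x. inc_energy p (\<sigma> 0) \<partial>?G) + (\<integral>\<^sup>+x. (\<Sum>k<K. inc_energy p (\<sigma> (Suc k)) * indicator (?A k) x) \<partial>?G)"
      by (rule nn_integral_add) measurable
    finally show ?thesis unfolding 1 2 3 .
  qed
  also have "\<dots> \<le> ennreal (B * b 0) + (\<Sum>k<K. ennreal (B * b (Suc k)) * ennreal (e k)) + 2 * ennreal (e K)"
    by (intro add_mono sum_mono mult_mono U P) auto
  also have "(\<Sum>k<K. ennreal (B * b (Suc k)) * ennreal (e k)) = ennreal (\<Sum>k<K. B * b (Suc k) * e k)"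
    using B e by (subst sum_ennreal[symmetric]) (auto simp: ennreal_mult')
  also have "2 * ennreal (e K) = ennreal (2 * e K)" by (simp add: ennreal_mult')
  also have "ennreal (B * b 0) + ennreal (\<Sum>k<K. B * b (Suc k) * e k) + ennreal (2 * e K)
      = ennreal (B * b 0 + (\<Sum>k<K. B * b (Suc k) * e k) + 2 * e K)"
    using B e by (simp add: sum_nonneg)
  finally show ?thesis by (simp add: distrib_left sum_distrib_left mult.assoc)
qed

section \<open>The scale of the maximal coordinate and the levels below it\<close>

text \<open>The second condition makes the remainder from below the last level negligible against all three formulas,
the third one makes \<open>ln \<xi>\<close> small against \<open>\<xi>\<close>, and the fourth one makes powers of \<open>\<xi>\<close> small against
\<open>exp (\<xi>\<^sup>2)\<close>.\<close>

definition sufficiently_large :: "real \<Rightarrow> bool" where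
  "sufficiently_large \<xi> \<longleftrightarrow> 10 \<le> \<xi>
    \<and> 64 * \<xi> * exp (\<xi>\<^sup>2 / 2) * exp (- (exp (\<xi>\<^sup>2 / 4 - 1 / 2) / 256)) \<le> exp (- 2 * \<xi>\<^sup>2)
    \<and> 20 * ln (2 * \<xi>) \<le> \<xi> \<and> 3 * \<xi>^3 \<le> exp (\<xi>\<^sup>2)"

lemma eventually_sufficiently_large: "eventually sufficiently_large at_top"
proof -
  have 1: "((\<lambda>\<xi>::real. 64 * \<xi> * exp (\<xi>\<^sup>2 / 2) * exp (- (exp (\<xi>\<^sup>2 / 4 - 1 / 2) / 256)) / exp (- 2 * \<xi>\<^sup>2)) \<longlongrightarrow> 0) at_top"
    by real_asymp
  have "eventually (\<lambda>\<xi>::real. 64 * \<xi> * exp (\<xi>\<^sup>2 / 2) * exp (- (exp (\<xi>\<^sup>2 / 4 - 1 / 2) / 256)) / exp (- 2 * \<xi>\<^sup>2) < 1) at_top"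
    by (rule order_tendstoD(2)[OF 1]) simp
  then have 1: "eventually (\<lambda>\<xi>::real. 64 * \<xi> * exp (\<xi>\<^sup>2 / 2) * exp (- (exp (\<xi>\<^sup>2 / 4 - 1 / 2) / 256)) \<le> exp (- 2 * \<xi>\<^sup>2)) at_top"
    by eventually_elim (simp add: divide_less_eq)
  have 2: "eventually (\<lambda>\<xi>::real. 20 * ln (2 * \<xi>) \<le> \<xi>) at_top" by real_asymp
  have 3: "eventually (\<lambda>\<xi>::real. 3 * \<xi>^3 \<le> exp (\<xi>\<^sup>2)) at_top" by real_asymp
  show ?thesis using eventually_ge_at_top[of 10] 1 2 3
    by eventually_elim (simp add: sufficiently_large_def)
qed

text \<open>The series of the staircase majorant: the one-coordinate variance grows by at most \<open>exp 8\<close> from one level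
to the next, while the probability to be below the \<open>k\<close>-th level is doubly exponentially small.\<close>

definition level_series_le :: "real \<Rightarrow> bool" where
  "level_series_le C \<longleftrightarrow>
    (\<forall>J. exp (8 * real 0) + (\<Sum>k<J. exp (8 * real (Suc k)) * exp (- (exp (real k / 2) / 256))) \<le> C)"

lemma level_series_bounded: "\<exists>C\<ge>1. level_series_le C"
proof -
  let ?f = "\<lambda>k. exp (8 * real (Suc k)) * exp (- (exp (real k / 2) / 256))"
  have "((\<lambda>k. exp (8 * (real k + 1)) * exp (- (exp (real k / 2) / 256)) / exp (- real k)) \<longlongrightarrow> 0) at_top"
    by real_asymp
  then have "eventually (\<lambda>k. exp (8 * (real k + 1)) * exp (- (exp (real k / 2) / 256)) / exp (- real k) < 1) at_top"
    by (rule order_tendstoD(2)) simp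
  then have ev: "eventually (\<lambda>k. norm (?f k) \<le> exp (- real k)) at_top"
    by eventually_elim (simp add: divide_less_eq add.commute)
  have "summable (\<lambda>k. exp (-1 :: real) ^ k)" by (intro summable_geometric) simp
  then have "summable (\<lambda>k. exp (- real k))" by (simp flip: exp_of_nat_mult)
  then have f: "summable ?f" by (rule summable_comparison_test_ev[OF ev])
  have "(\<Sum>k<K. ?f k) \<le> suminf ?f" for K by (intro sum_le_suminf f) auto
  moreover have "0 \<le> suminf ?f" using f by (intro suminf_nonneg) auto
  ultimately show ?thesis
    by (intro exI[of _ "1 + suminf ?f"]) (auto simp: level_series_le_def)
qed

locale large_dimension =
  fixes n N :: nat and \<xi> :: real
  assumes n: "n = Suc N" and tail: "gtail \<xi> = 1 / real n" and sufficiently_large: "sufficiently_large \<xi>"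
begin

lemma xi: "10 \<le> \<xi>" and xi_rem: "64 * \<xi> * exp (\<xi>\<^sup>2 / 2) * exp (- (exp (\<xi>\<^sup>2 / 4 - 1 / 2) / 256)) \<le> exp (- 2 * \<xi>\<^sup>2)"
  and xi_ln: "20 * ln (2 * \<xi>) \<le> \<xi>" and xi_exp: "3 * \<xi>^3 \<le> exp (\<xi>\<^sup>2)"
  using sufficiently_large by (auto simp: sufficiently_large_def)

lemma n_pos: "0 < real n" using n by simp

text \<open>Mills' ratio for the defining equation of \<open>\<xi>\<close>, from both sides: \<open>n\<close> is \<open>\<xi> * exp (\<xi>\<^sup>2 / 2)\<close> up to a
constant factor.\<close>

lemma n_ge: "\<xi> * exp (\<xi>\<^sup>2 / 2) \<le> real n"
proof -
  have "1 / real n \<le> exp (- \<xi>\<^sup>2 / 2) / \<xi>" using gtail_le[of \<xi>] xi tail by simp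
  then have "1 * (\<xi> * exp (\<xi>\<^sup>2 / 2)) \<le> real n * (exp (- \<xi>\<^sup>2 / 2) / \<xi> * (\<xi> * exp (\<xi>\<^sup>2 / 2)))"
    using n_pos xi by (simp add: field_simps)
  moreover have "exp (- \<xi>\<^sup>2 / 2) / \<xi> * (\<xi> * exp (\<xi>\<^sup>2 / 2)) = 1"
    using xi by (simp flip: exp_add)
  ultimately show ?thesis by simp
qed

lemma n_le: "real n \<le> 16 * \<xi> * exp (\<xi>\<^sup>2 / 2)"
proof -
  have "exp (- \<xi>\<^sup>2 / 2) / (16 * \<xi>) \<le> 1 / real n" using gtail_ge[of \<xi>] xi tail by simp
  then have "exp (- \<xi>\<^sup>2 / 2) * real n \<le> 16 * \<xi>" using n_pos xi by (simp add: field_simps)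
  then have le: "exp (\<xi>\<^sup>2 / 2) * (exp (- \<xi>\<^sup>2 / 2) * real n) \<le> exp (\<xi>\<^sup>2 / 2) * (16 * \<xi>)"
    by (intro mult_left_mono) auto
  have "exp (\<xi>\<^sup>2 / 2) * exp (- \<xi>\<^sup>2 / 2) = 1" by (simp flip: exp_add)
  then have "exp (\<xi>\<^sup>2 / 2) * (exp (- \<xi>\<^sup>2 / 2) * real n) = real n"
    unfolding mult.assoc[symmetric] by simp
  with le show ?thesis by (simp only: mult_ac)
qed

lemma n_ge_10: "10 \<le> real n"
proof -
  have "10 * 1 \<le> \<xi> * exp (\<xi>\<^sup>2 / 2)" using xi by (intro mult_mono) auto
  then show ?thesis using n_ge by simp
qed

lemma N_ge: "real n / 2 \<le> real N" using n n_ge_10 by simp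

lemma ln_n_ge: "\<xi>\<^sup>2 / 2 \<le> ln (real n)"
proof -
  have "exp (\<xi>\<^sup>2 / 2) \<le> \<xi> * exp (\<xi>\<^sup>2 / 2)" using xi by simp
  from order_trans[OF this n_ge] have "exp (\<xi>\<^sup>2 / 2) \<le> real n" .
  then show ?thesis using n_pos ln_ge_iff by blast
qed

lemma ln_n_le: "ln (real n) \<le> \<xi>\<^sup>2"
proof -
  have "ln (real n) \<le> ln (16 * \<xi> * exp (\<xi>\<^sup>2 / 2))" using n_le n_pos by (subst ln_le_cancel_iff) auto
  also have "\<dots> = ln 16 + ln \<xi> + \<xi>\<^sup>2 / 2" using xi by (simp add: ln_mult)
  also have "ln \<xi> \<le> \<xi> - 1" using xi by (intro ln_le_minus_one) auto
  also have "ln 16 \<le> (16 - 1 :: real)" by (intro ln_le_minus_one) auto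
  also have "16 - 1 + (\<xi> - 1) + \<xi>\<^sup>2 / 2 \<le> \<xi>\<^sup>2"
  proof -
    have "10 * \<xi> \<le> \<xi>\<^sup>2" using xi by (simp add: power2_eq_square)
    then show ?thesis using xi by linarith
  qed
  finally show ?thesis by simp
qed

text \<open>Levels for the maximal coordinate, at distance \<open>1 / \<xi>\<close>, which is the scale of its fluctuations, from \<open>\<xi>\<close>
down to \<open>\<xi> / 2\<close>.\<close>

definition level :: "nat \<Rightarrow> real" where
  "level k = \<xi> - real k / \<xi>"

definition top_level :: nat where "top_level = nat \<lfloor>\<xi>\<^sup>2 / 2\<rfloor>"

lemma top_level_le: "real top_level \<le> \<xi>\<^sup>2 / 2" and top_level_ge: "\<xi>\<^sup>2 / 2 - 1 \<le> real top_level"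
proof -
  have "real top_level = real_of_int \<lfloor>\<xi>\<^sup>2 / 2\<rfloor>" unfolding top_level_def by simp
  then show "real top_level \<le> \<xi>\<^sup>2 / 2" "\<xi>\<^sup>2 / 2 - 1 \<le> real top_level" by linarith+
qed

lemma level_bounds:
  assumes "k \<le> top_level"
  shows "\<xi> / 2 \<le> level k" "level k \<le> \<xi>" "real k / 2 \<le> (\<xi>\<^sup>2 - (level k)\<^sup>2) / 2" "(\<xi>\<^sup>2 - (level k)\<^sup>2) / 2 \<le> real k"
proof -
  have k: "real k \<le> \<xi>\<^sup>2 / 2" using assms top_level_le by simp
  have "real k / \<xi> \<le> \<xi>\<^sup>2 / 2 / \<xi>" using k xi by (intro divide_right_mono) auto
  then have kx: "real k / \<xi> \<le> \<xi> / 2" using xi by (simp add: power2_eq_square)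
  then show "\<xi> / 2 \<le> level k" by (simp add: level_def)
  show "level k \<le> \<xi>" using xi by (simp add: level_def)
  have e: "(\<xi>\<^sup>2 - (level k)\<^sup>2) / 2 = real k - (real k / \<xi>) * (real k / \<xi>) / 2"
    using xi by (simp add: level_def power2_eq_square field_simps)
  show "(\<xi>\<^sup>2 - (level k)\<^sup>2) / 2 \<le> real k" unfolding e by simp
  have "(real k / \<xi>) * (real k / \<xi>) \<le> (real k / \<xi>) * (\<xi> / 2)" using kx xi by (intro mult_left_mono) auto
  also have "\<dots> = real k / 2" using xi by simp
  finally have t: "(real k / \<xi>) * (real k / \<xi>) \<le> real k / 2" .
  have "c / 2 \<le> c - t / 2" if "t \<le> c / 2" "0 \<le> c" for c t :: real using that by linarith
  from this[OF t] show "real k / 2 \<le> (\<xi>\<^sup>2 - (level k)\<^sup>2) / 2" unfolding e by simp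
qed

text \<open>The expected number of coordinates above the \<open>k\<close>-th level grows at least like \<open>exp (k / 2)\<close>.\<close>

lemma level_tail:
  assumes "k \<le> top_level"
  shows "exp (- (real N * gtail (level k) / 8)) \<le> exp (- (exp (real k / 2) / 256))"
proof -
  note l = level_bounds[OF assms]
  have l1: "1 \<le> level k" using l xi by simp
  have "exp (real k / 2) / 16 \<le> exp ((\<xi>\<^sup>2 - (level k)\<^sup>2) / 2) / 16" using l(3) by simp
  also have "\<dots> = \<xi> * exp (\<xi>\<^sup>2 / 2) * (exp (- (level k)\<^sup>2 / 2) / (16 * \<xi>))"
  proof -
    have "exp ((\<xi>\<^sup>2 - (level k)\<^sup>2) / 2) = exp (\<xi>\<^sup>2 / 2) * exp (- (level k)\<^sup>2 / 2)"
      by (simp add: exp_add[symmetric] diff_divide_distrib)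
    then show ?thesis using xi by simp
  qed
  also have "\<dots> \<le> real n * (exp (- (level k)\<^sup>2 / 2) / (16 * level k))"
    using n_ge l l1 xi by (intro mult_mono divide_left_mono) auto
  also have "\<dots> \<le> real n * gtail (level k)"
    using gtail_ge[OF l1] by (intro mult_left_mono) auto
  also have "\<dots> \<le> 2 * real N * gtail (level k)"
    using N_ge by (intro mult_right_mono) (auto simp: gtail_def)
  finally show ?thesis by simp
qed

lemma rem_le: "4 * real n * exp (- (exp (real top_level / 2) / 256)) \<le> exp (- 2 * \<xi>\<^sup>2)"
proof -
  have "exp (\<xi>\<^sup>2 / 4 - 1 / 2) \<le> exp (real top_level / 2)" using top_level_ge by simp
  then have "exp (- (exp (real top_level / 2) / 256)) \<le> exp (- (exp (\<xi>\<^sup>2 / 4 - 1 / 2) / 256))" by simp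
  then have "4 * real n * exp (- (exp (real top_level / 2) / 256))
      \<le> 4 * (16 * \<xi> * exp (\<xi>\<^sup>2 / 2)) * exp (- (exp (\<xi>\<^sup>2 / 4 - 1 / 2) / 256))"
    using n_le by (intro mult_mono) auto
  also have "\<dots> = 64 * \<xi> * exp (\<xi>\<^sup>2 / 2) * exp (- (exp (\<xi>\<^sup>2 / 4 - 1 / 2) / 256))" by simp
  finally show ?thesis using xi_rem by simp
qed

lemma var_le_from_expectation:
  assumes p: "1 \<le> p" and "0 \<le> b"
    and "(\<integral>\<^sup>+x. inc_energy p (psum p N x) \<partial>std_gaussian_vec N) \<le> ennreal b"
  shows "var_lp_norm n (ereal p) \<le> 2 * real n * b"
proof -
  have "ennreal (var_lp_norm n (ereal p)) \<le> of_nat (2 * Suc N) * ennreal b"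
    using var_lp_norm_le[OF p, of N] assms(3) unfolding n by (meson mult_left_mono order_trans zero_le)
  also have "\<dots> = ennreal (2 * real n * b)"
    unfolding n ennreal_of_nat_eq_real_of_nat by (subst ennreal_mult'[symmetric]) auto
  finally show ?thesis using assms(2) by (subst (asm) ennreal_le_iff) auto
qed

lemma var_upper_levels:
  assumes p: "1 \<le> p" and B: "0 \<le> B" and \<sigma>: "\<And>k. k \<le> top_level \<Longrightarrow> 0 \<le> \<sigma> k"
    and U: "\<And>k. k \<le> top_level \<Longrightarrow> inc_energy p (\<sigma> k) \<le> ennreal (B * exp (8 * real k))"
    and P: "\<And>k. k \<le> top_level \<Longrightarrow> law_below p N (\<sigma> k)
      \<le> ennreal (exp (- (real N * gtail (level k) / 8)))"
    and C: "level_series_le C"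
  shows "var_lp_norm n (ereal p) \<le> 2 * C * (real n * B) + exp (- 2 * \<xi>\<^sup>2)"
proof -
  let ?e = "\<lambda>k::nat. exp (- (exp (real k / 2) / 256))"
  have "(\<integral>\<^sup>+x. inc_energy p (psum p N x) \<partial>std_gaussian_vec N)
    \<le> ennreal (B * (exp (8 * real 0) + (\<Sum>k<top_level. exp (8 * real (Suc k)) * ?e k)) + 2 * ?e top_level)"
  proof (rule expectation_inc_energy_levels[OF p \<sigma> U B])
    fix k assume k: "k \<le> top_level"
    show "law_below p N (\<sigma> k) \<le> ennreal (?e k)"
      using P[OF k] level_tail[OF k] by (meson ennreal_leI order_trans)
  qed auto
  also have "\<dots> \<le> ennreal (B * C + 2 * ?e top_level)"
    using C B unfolding level_series_le_def by (intro ennreal_leI add_mono mult_left_mono) auto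
  finally have E: "(\<integral>\<^sup>+x. inc_energy p (psum p N x) \<partial>std_gaussian_vec N) \<le> ennreal (B * C + 2 * ?e top_level)" .
  have C0: "0 \<le> C" using C[unfolded level_series_le_def, rule_format, of 0] by simp
  have "var_lp_norm n (ereal p) \<le> 2 * real n * (B * C + 2 * ?e top_level)"
    using B C0 by (intro var_le_from_expectation[OF p _ E]) auto
  also have "\<dots> = 2 * C * (real n * B) + 4 * real n * ?e top_level" by (simp add: algebra_simps)
  finally show ?thesis using rem_le by simp
qed

text \<open>The upper bound for \<open>p \<le> 2 * \<xi>\<^sup>2\<close>, for any level \<open>s\<close> below the mean of the sum truncated at \<open>\<xi>\<close>. Truncating at
the \<open>k\<close>-th level below \<open>\<xi>\<close> costs at most the factor \<open>\<kappa> k = (level k / \<xi>) powr p\<close> in the mean, and \<open>\<kappa> k\<close> is at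
least \<open>exp (- 4 * k)\<close> because \<open>p / \<xi>\<^sup>2\<close> is bounded; the scaling of the increments turns this into \<open>exp (8 * k)\<close>.\<close>

lemma var_upper_mid:
  assumes p: "1 \<le> p" "p \<le> 2 * \<xi>\<^sup>2" and s: "0 < s" "s \<le> real N * m / 2"
    and m: "ennreal m \<le> gauss_int (\<lambda>x. min (\<bar>x\<bar> powr p) (\<xi> powr p))"
    and u: "0 \<le> u" "inc_energy p s \<le> ennreal u"
    and C: "level_series_le C"
  shows "var_lp_norm n (ereal p) \<le> 2 * C * (real n * u) + exp (- 2 * \<xi>\<^sup>2)"
proof (rule var_upper_levels[OF p(1) u(1) _ _ _ C])
  define \<kappa> where "\<kappa> k = (level k / \<xi>) powr p" for k
  fix k assume k: "k \<le> top_level"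
  note l = level_bounds[OF k]
  have q: "0 < level k / \<xi>" "level k / \<xi> \<le> 1" using l xi by auto
  have k0: "0 < \<kappa> k" "\<kappa> k \<le> 1" using q p unfolding \<kappa>_def by (auto simp: powr_le1)
  show "0 \<le> \<kappa> k * s" using k0 s by simp
  have kinv: "1 / (\<kappa> k)\<^sup>2 \<le> exp (8 * real k)"
  proof -
    define y where "y = real k / \<xi>\<^sup>2"
    have y: "0 \<le> y" "y \<le> 1/2" using k top_level_le xi by (auto simp: y_def divide_le_eq)
    have ly: "level k / \<xi> = 1 - y" using xi by (simp add: level_def y_def field_simps power2_eq_square)
    have "exp (- (2 * y)) \<le> 1 - 2 * y + (2 * y)\<^sup>2 / 2" using y by (intro exp_minus_le_quadratic) auto
    also have "\<dots> \<le> 1 - y" using y mult_left_mono[of y "1/2" y] by (simp add: power2_eq_square)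
    finally have "exp (- (2 * y)) \<le> level k / \<xi>" unfolding ly .
    then have "exp (- (2 * y)) powr (2 * p) \<le> (level k / \<xi>) powr (2 * p)" using p by (intro powr_mono2) auto
    also have "\<dots> = (\<kappa> k)\<^sup>2" by (simp add: \<kappa>_def power2_eq_square flip: powr_add)
    finally have 1: "exp (- (2 * y) * (2 * p)) \<le> (\<kappa> k)\<^sup>2" by (simp add: exp_powr_real)
    have "2 * y * (2 * p) \<le> 2 * y * (2 * (2 * \<xi>\<^sup>2))" using y p by (intro mult_left_mono) auto
    also have "\<dots> = 8 * real k" using xi by (simp add: y_def)
    finally have "exp (- (8 * real k)) \<le> exp (- (2 * y) * (2 * p))" by simp
    from order_trans[OF this 1] have "exp (- (8 * real k)) \<le> (\<kappa> k)\<^sup>2" .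
    then show ?thesis using k0 by (simp add: exp_minus field_simps)
  qed
  have "inc_energy p (\<kappa> k * s) \<le> ennreal (1 / (\<kappa> k)\<^sup>2) * inc_energy p s"
    using s k0 p by (intro inc_energy_scale) auto
  also have "\<dots> \<le> ennreal (exp (8 * real k)) * ennreal u"
    by (intro mult_mono ennreal_leI kinv u) auto
  also have "\<dots> = ennreal (u * exp (8 * real k))"
    by (subst ennreal_mult'[symmetric]) (auto simp: mult.commute)
  finally show "inc_energy p (\<kappa> k * s) \<le> ennreal (u * exp (8 * real k))" .
  have "ennreal (\<kappa> k * m) = ennreal (\<kappa> k) * ennreal m" using k0 by (intro ennreal_mult') auto
  also have "\<dots> \<le> ennreal (\<kappa> k) * gauss_int (\<lambda>x. min (\<bar>x\<bar> powr p) (\<xi> powr p))"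
    by (intro mult_left_mono m) auto
  also have "\<dots> = (\<integral>\<^sup>+x. ennreal (\<kappa> k) * ennreal (min (\<bar>x\<bar> powr p) (\<xi> powr p)) \<partial>std_gaussian)"
    by (rule nn_integral_cmult[symmetric]) measurable
  also have "\<dots> \<le> gauss_int (\<lambda>x. min (\<bar>x\<bar> powr p) (level k powr p))"
  proof (intro nn_integral_mono)
    fix x :: real
    have "\<kappa> k * min (\<bar>x\<bar> powr p) (\<xi> powr p) \<le> 1 * (\<bar>x\<bar> powr p)"
      using k0 by (intro mult_mono) auto
    moreover have "\<kappa> k * min (\<bar>x\<bar> powr p) (\<xi> powr p) \<le> \<kappa> k * \<xi> powr p"
      using k0 by (intro mult_left_mono) auto
    moreover have "\<kappa> k * \<xi> powr p = level k powr p" using q xi unfolding \<kappa>_def by (subst powr_mult[symmetric]) auto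
    ultimately have "\<kappa> k * min (\<bar>x\<bar> powr p) (\<xi> powr p) \<le> min (\<bar>x\<bar> powr p) (level k powr p)" by simp
    then show "ennreal (\<kappa> k) * ennreal (min (\<bar>x\<bar> powr p) (\<xi> powr p)) \<le> ennreal (min (\<bar>x\<bar> powr p) (level k powr p))"
      using k0 by (subst ennreal_mult'[symmetric]) (auto intro!: ennreal_leI)
  qed
  finally have mk: "ennreal (\<kappa> k * m) \<le> gauss_int (\<lambda>x. min (\<bar>x\<bar> powr p) (level k powr p))" .
  have sk: "\<kappa> k * s \<le> real N * (\<kappa> k * m) / 2" using mult_left_mono[OF s(2), of "\<kappa> k"] k0 by (simp add: mult_ac)
  have "law_below p N (\<kappa> k * s)
      \<le> law_upto p N (real N * (\<kappa> k * m) / 2)"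
    using sk by (intro emeasure_mono) auto
  also have "\<dots> \<le> ennreal (exp (- (real N * gtail (level k) / 8)))"
    using l xi by (intro psum_lower_tail[OF p(1) _ mk]) auto
  finally show "law_below p N (\<kappa> k * s)
      \<le> ennreal (exp (- (real N * gtail (level k) / 8)))" .
qed

text \<open>For \<open>p \<ge> 2 * \<xi>\<^sup>2\<close> the scaling argument would lose a factor that grows with \<open>p\<close>. Instead, the norm is compared
with the maximal coordinate: if it is at least \<open>r \<le> \<xi>\<close>, the one-coordinate variance is at most of order
\<open>exp (- r\<^sup>2 / 2) / r ^ 3\<close>.\<close>

lemma var_upper_beyond:
  assumes p: "2 * \<xi>\<^sup>2 \<le> p"
    and C: "level_series_le C"
  shows "var_lp_norm n (ereal p) \<le> 2 * C * (17000 / \<xi>\<^sup>2) + exp (- 2 * \<xi>\<^sup>2)"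
proof -
  have "1 * 1 \<le> \<xi> * \<xi>" using xi by (intro mult_mono) auto
  then have p1: "1 \<le> p" using p by (simp add: power2_eq_square)
  define B where "B = exp (- \<xi>\<^sup>2 / 2) * (1040 / \<xi>^3)"
  have B: "0 \<le> B" using xi by (simp add: B_def)
  have "var_lp_norm n (ereal p) \<le> 2 * C * (real n * B) + exp (- 2 * \<xi>\<^sup>2)"
  proof (rule var_upper_levels[OF p1 B _ _ _ C])
    fix k assume k: "k \<le> top_level"
    note l = level_bounds[OF k]
    define r where "r = level k"
    have r: "\<xi> / 2 \<le> r" "r \<le> \<xi>" "0 < r" using l xi by (auto simp: r_def)
    show "0 \<le> level k powr p" by simp
    show "law_below p N (level k powr p)
      \<le> ennreal (exp (- (real N * gtail (level k) / 8)))"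
      using psum_lower_tail_max[OF p1 r(3), of N] by (simp add: r_def)
    have rp: "2 * r\<^sup>2 \<le> p" proof -
      have "r\<^sup>2 \<le> \<xi>\<^sup>2" using r by (intro power_mono) auto
      then show ?thesis using p by linarith
    qed
    have "inc_energy p (r powr p) \<le> ennreal (exp (- r\<^sup>2 / 2) * (2 * (r / p)\<^sup>2 * (r / (r + 2 * p - r\<^sup>2)) + 128 / r^3 + 4 * r / p\<^sup>2))"
      using rp r p1 by (intro inc_energy_le) auto
    also have "\<dots> \<le> ennreal (B * exp (8 * real k))"
    proof (rule ennreal_leI)
      have r2: "0 < r\<^sup>2" using r by simp
      have a: "2 * (r / p)\<^sup>2 * (r / (r + 2 * p - r\<^sup>2)) \<le> 1 / r^3"
      proof -
        have "r / p \<le> r / (2 * r\<^sup>2)" using rp r r2 p1 by (intro divide_left_mono) auto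
        also have "\<dots> = 1 / (2 * r)" using r by (simp add: power2_eq_square)
        finally have "(r / p)\<^sup>2 \<le> (1 / (2 * r))\<^sup>2" using r p1 by (intro power_mono) auto
        moreover have "r / (r + 2 * p - r\<^sup>2) \<le> r / r\<^sup>2"
        proof (rule divide_left_mono)
          show "r\<^sup>2 \<le> r + 2 * p - r\<^sup>2" using rp r r2 by linarith
          then show "0 < (r + 2 * p - r\<^sup>2) * r\<^sup>2" using r2 by (intro mult_pos_pos) linarith+
        qed (use r in auto)
        moreover have "0 \<le> r / (r + 2 * p - r\<^sup>2)" using rp r r2 by (intro divide_nonneg_nonneg) linarith+
        ultimately have "2 * (r / p)\<^sup>2 * (r / (r + 2 * p - r\<^sup>2)) \<le> 2 * (1 / (2 * r))\<^sup>2 * (r / r\<^sup>2)"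
          by (intro mult_mono) auto
        also have "\<dots> \<le> 1 / r^3" using r by (simp add: power2_eq_square power3_eq_cube field_simps)
        finally show ?thesis .
      qed
      have b: "4 * r / p\<^sup>2 \<le> 1 / r^3"
      proof -
        have "(2 * r\<^sup>2)\<^sup>2 \<le> p\<^sup>2" using rp by (intro power_mono) auto
        then have "4 * r / p\<^sup>2 \<le> 4 * r / (2 * r\<^sup>2)\<^sup>2" using r r2 p1 by (intro divide_left_mono mult_pos_pos) auto
        also have "\<dots> = 1 / r^3" using r by (simp add: power2_eq_square power3_eq_cube field_simps)
        finally show ?thesis .
      qed
      have c: "130 / r^3 \<le> 1040 / \<xi>^3"
      proof -
        have "(\<xi> / 2)^3 \<le> r^3" using r xi by (intro power_mono) auto
        then have "130 / r^3 \<le> 130 / (\<xi> / 2)^3" using r xi by (intro divide_left_mono) auto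
        then show ?thesis by (simp add: power_divide)
      qed
      have "- r\<^sup>2 / 2 \<le> - \<xi>\<^sup>2 / 2 + real k" using l(4) by (simp add: r_def field_simps)
      also have "\<dots> \<le> - \<xi>\<^sup>2 / 2 + 8 * real k" by simp
      finally have d: "exp (- r\<^sup>2 / 2) \<le> exp (- \<xi>\<^sup>2 / 2) * exp (8 * real k)" by (simp flip: exp_add)
      have "2 * (r / p)\<^sup>2 * (r / (r + 2 * p - r\<^sup>2)) + 128 / r^3 + 4 * r / p\<^sup>2 \<le> 130 / r^3"
        using a b by (simp add: field_simps)
      then have e: "2 * (r / p)\<^sup>2 * (r / (r + 2 * p - r\<^sup>2)) + 128 / r^3 + 4 * r / p\<^sup>2 \<le> 1040 / \<xi>^3" using c by simp
      have "exp (- r\<^sup>2 / 2) * (2 * (r / p)\<^sup>2 * (r / (r + 2 * p - r\<^sup>2)) + 128 / r^3 + 4 * r / p\<^sup>2)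
          \<le> exp (- r\<^sup>2 / 2) * (1040 / \<xi>^3)" by (intro mult_left_mono e) auto
      also have "\<dots> \<le> (exp (- \<xi>\<^sup>2 / 2) * exp (8 * real k)) * (1040 / \<xi>^3)"
        using xi by (intro mult_right_mono d) auto
      finally show "exp (- r\<^sup>2 / 2) * (2 * (r / p)\<^sup>2 * (r / (r + 2 * p - r\<^sup>2)) + 128 / r^3 + 4 * r / p\<^sup>2)
          \<le> B * exp (8 * real k)" by (simp add: B_def mult_ac)
    qed
    finally show "inc_energy p (level k powr p) \<le> ennreal (B * exp (8 * real k))" by (simp add: r_def)
  qed
  also have "real n * B \<le> 17000 / \<xi>\<^sup>2"
  proof -
    have "real n * B \<le> (16 * \<xi> * exp (\<xi>\<^sup>2 / 2)) * B" using n_le B by (intro mult_right_mono) auto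
    also have "\<dots> = 16640 / \<xi>\<^sup>2 * (exp (\<xi>\<^sup>2 / 2) * exp (- \<xi>\<^sup>2 / 2))"
      using xi by (simp add: B_def power2_eq_square power3_eq_cube field_simps)
    also have "exp (\<xi>\<^sup>2 / 2) * exp (- \<xi>\<^sup>2 / 2) = 1" by (simp flip: exp_add)
    finally show ?thesis using xi by (simp add: field_simps)
  qed
  finally show ?thesis using C[unfolded level_series_le_def, rule_format, of 0] by (simp add: mult_left_mono)
qed

end

section \<open>Upper bounds in the three regimes\<close>

text \<open>The mass of the \<open>p\<close>-th moment sits at its peak \<open>sqrt p\<close>, so truncation beyond the peak does not change
its order.\<close>

lemma gaussian_min_moment_ge:
  assumes p: "1 \<le> p" "sqrt p \<le> R"
  shows "ennreal (1 / 54 * (p / exp 1) powr (p / 2)) \<le> gauss_int (\<lambda>x. min (\<bar>x\<bar> powr p) (R powr p))"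
proof -
  let ?M = "sqrt p"
  let ?f = "\<lambda>x. (\<bar>x\<bar> / ?M) powr p * indicator {x. ?M - 1/2 \<le> \<bar>x\<bar> \<and> \<bar>x\<bar> \<le> ?M} x"
  have M: "1 \<le> ?M" "?M\<^sup>2 = p" using p by auto
  have pw: "?M powr p = p powr (p / 2)" using p by (simp add: powr_half_sqrt[symmetric] powr_powr mult.commute)
  have "(p / exp 1) powr (p / 2) = ?M powr p * exp (- p / 2)"
    unfolding pw using p by (simp add: powr_divide exp_powr_real exp_minus field_simps)
  then have "ennreal (1 / 54 * (p / exp 1) powr (p / 2)) = ennreal (?M powr p * (1 / 54 * exp (- ?M\<^sup>2 / 2) * (?M / (?M + p - ?M\<^sup>2))))"
    using M by (intro arg_cong[where f = ennreal]) (simp add: mult_ac)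
  also have "\<dots> = ennreal (?M powr p) * ennreal (1 / 54 * exp (- ?M\<^sup>2 / 2) * (?M / (?M + p - ?M\<^sup>2)))"
    by (rule ennreal_mult') simp
  also have "\<dots> \<le> ennreal (?M powr p) * gauss_int (\<lambda>x. ?f x)"
    using p M(1) by (intro mult_left_mono truncated_moment_lower) auto
  also have "\<dots> = (\<integral>\<^sup>+x. ennreal (?M powr p) * ennreal (?f x) \<partial>std_gaussian)"
    by (rule nn_integral_cmult[symmetric]) measurable
  also have "\<dots> \<le> gauss_int (\<lambda>x. min (\<bar>x\<bar> powr p) (R powr p))"
  proof (rule nn_integral_mono)
    fix x :: real
    have "?M powr p * ?f x \<le> min (\<bar>x\<bar> powr p) (R powr p)"
    proof (cases "\<bar>x\<bar> \<le> ?M")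
      case True
      have "?M powr p * ?f x \<le> ?M powr p * (\<bar>x\<bar> / ?M) powr p"
        by (intro mult_left_mono) (auto split: split_indicator)
      also have "\<dots> = \<bar>x\<bar> powr p" using M(1) by (simp add: powr_divide)
      finally have "?M powr p * ?f x \<le> \<bar>x\<bar> powr p" .
      moreover have "\<bar>x\<bar> powr p \<le> R powr p" using True p by (intro powr_mono2) auto
      ultimately show ?thesis by linarith
    qed simp
    then show "ennreal (?M powr p) * ennreal (?f x) \<le> ennreal (min (\<bar>x\<bar> powr p) (R powr p))"
      by (subst ennreal_mult'[symmetric]) (auto intro!: ennreal_leI)
  qed
  finally show ?thesis .
qed

text \<open>Size of the norm in the first two regimes, up to a factor \<open>c powr (1 / p)\<close>: its \<open>p\<close>-th power is \<open>n\<close> times the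
order of the \<open>p\<close>-th moment. It is used in place of the exact moment, because its square is exactly
\<open>2 * (p / (2 * exp 1)) * n powr (2 / p)\<close>, the quantity in the exponent of the second formula.\<close>

definition typ_norm :: "real \<Rightarrow> real \<Rightarrow> real" where
  "typ_norm n p = n powr (1 / p) * sqrt (p / exp 1)"

lemma typ_norm_facts:
  assumes "0 < n" "1 \<le> p"
  shows "0 < typ_norm n p" "(typ_norm n p)\<^sup>2 = n powr (2 / p) * (p / exp 1)"
    "typ_norm n p powr p = n * (p / exp 1) powr (p / 2)"
proof -
  show "0 < typ_norm n p" using assms by (simp add: typ_norm_def)
  have "(n powr (1 / p))\<^sup>2 = n powr (2 / p)" by (simp add: power2_eq_square flip: powr_add)
  then show "(typ_norm n p)\<^sup>2 = n powr (2 / p) * (p / exp 1)"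
    using assms by (simp add: typ_norm_def power_mult_distrib)
  have "sqrt (p / exp 1) powr p = (p / exp 1) powr (p / 2)"
    using assms by (simp add: powr_half_sqrt[symmetric] powr_powr)
  then show "typ_norm n p powr p = n * (p / exp 1) powr (p / 2)"
    using assms by (simp add: typ_norm_def powr_mult powr_powr)
qed

lemma typ_norm_moment_term:
  assumes "0 < n" "1 \<le> p"
  shows "n * ((typ_norm n p / p)\<^sup>2 * typ_norm n p powr (- 2 * p) * (2 * p / exp 1) powr p)
    = (1 / exp 1) * (2 powr p / p * n powr (2 / p - 1))"
proof -
  note m = typ_norm_facts[OF assms]
  have "(p / exp 1) powr (p / 2) * (p / exp 1) powr (p / 2) = (p / exp 1) powr p"
    by (simp flip: powr_add)
  then have "typ_norm n p powr (2 * p) = n\<^sup>2 * (p / exp 1) powr p"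
    using m(3) by (metis (no_types, lifting) mult_2 powr_add power2_eq_square mult.assoc mult.left_commute)
  then have "typ_norm n p powr (- 2 * p) = 1 / (n\<^sup>2 * (p / exp 1) powr p)"
    by (simp add: powr_minus_divide)
  moreover have "(2 * p / exp 1) powr p = 2 powr p * (p / exp 1) powr p"
    by (subst powr_mult[symmetric]) simp
  moreover have "(p / exp 1) powr p \<noteq> 0" using assms by simp
  ultimately have "n * ((typ_norm n p / p)\<^sup>2 * typ_norm n p powr (- 2 * p) * (2 * p / exp 1) powr p)
      = (typ_norm n p / p)\<^sup>2 * 2 powr p / n"
    using assms by (simp add: power2_eq_square field_simps)
  also have "\<dots> = (n powr (2 / p) * (p / exp 1)) / p\<^sup>2 * 2 powr p / n"
    using m(2) by (simp add: power_divide)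
  also have "\<dots> = (1 / exp 1) * (2 powr p / p * (n powr (2 / p) / n))"
    using assms by (simp add: power2_eq_square field_simps)
  also have "n powr (2 / p) / n = n powr (2 / p - 1)" using assms by (simp add: powr_diff)
  finally show ?thesis .
qed

lemma two_powr_ge: "1 \<le> p \<Longrightarrow> 1 / 2 \<le> 2 powr p / (p::real)"
proof -
  assume p: "1 \<le> p"
  have "ln (p / 2) \<le> p / 2 - 1" using p by (intro ln_le_minus_one) auto
  then have "ln p - ln 2 \<le> p / 2 - 1" using p by (simp add: ln_div)
  moreover have "1 / 2 \<le> ln (2::real)" using ln2_ge_two_thirds by simp
  then have "p * (1 / 2) \<le> p * ln 2" using p by (intro mult_left_mono) auto
  ultimately have "ln p \<le> p * ln 2 + ln 2" by simp
  then have "exp (ln p) \<le> exp (p * ln 2 + ln 2)" by simp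
  then have "p \<le> 2 powr p * 2" using p by (simp add: exp_add powr_def)
  then show ?thesis using p by (simp add: field_simps)
qed

lemma ln_2e: "ln (2 * exp 1 :: real) = 1 + ln 2"
  by (simp add: ln_mult)

text \<open>The threshold is where \<open>n powr (2 / p) = 2 * exp 1\<close>. Up to it, \<open>2 powr p\<close> is at most \<open>n powr (9 / 10)\<close>, since
\<open>2 * ln 2 / (1 + ln 2) < 9 / 10\<close>; so the relative variance \<open>2 powr p / n\<close> of the sum is a negative power
of \<open>n\<close>.\<close>

lemma first_regime_size:
  assumes n: "1 \<le> real n" and p: "1 \<le> p" "p \<le> 2 * ln (real n) / ln (2 * exp 1)"
  shows "real n powr (1/10) \<le> real n * 2 powr (- p)" "2 * exp 1 \<le> real n powr (2 / p)"
proof -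
  define L where "L = ln (real n)"
  have L: "0 \<le> L" using n by (simp add: L_def)
  have l2: "2 / 3 \<le> ln (2::real)" "ln 2 \<le> (25/36 :: real)" using ln2_ge_two_thirds ln2_le_25_over_36 by auto
  have pL: "p * (1 + ln 2) \<le> 2 * L" using p l2 unfolding ln_2e L_def by (simp add: pos_le_divide_eq)
  have "p * ln 2 \<le> 9/10 * L"
  proof -
    have "p * ln 2 \<le> p * (9/20 * (1 + ln 2))" using l2 p by (intro mult_left_mono) auto
    also have "\<dots> = 9/20 * (p * (1 + ln 2))" by simp
    also have "\<dots> \<le> 9/20 * (2 * L)" by (intro mult_left_mono pL) auto
    finally show ?thesis by simp
  qed
  then have "exp (1/10 * L) \<le> exp (L + - p * ln 2)" by simp
  also have "\<dots> = exp L * exp (- p * ln 2)" by (rule exp_add)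
  finally show "real n powr (1/10) \<le> real n * 2 powr (- p)" using n by (simp add: L_def powr_def)
  have "1 + ln 2 \<le> 2 / p * L" using pL p by (simp add: field_simps)
  then have "exp (1 + ln 2) \<le> exp (2 / p * L)" by simp
  then show "2 * exp 1 \<le> real n powr (2 / p)" using n by (simp add: L_def powr_def exp_add)
qed

text \<open>In the first regime the sum is concentrated: the probability that it is below a fixed fraction of its
mean is at most \<open>exp (- c * n powr (1 / 10))\<close>, which is negligible, and a single level suffices.\<close>

lemma var_upper_first_regime:
  assumes n: "n = Suc N" "4 * real n * exp (- (real n powr (1/10) / 93312)) \<le> 1 / (2 * real n)" "2 \<le> n"
    and p: "1 \<le> p" "p \<le> 2 * ln (real n) / ln (2 * exp 1)"
  shows "var_lp_norm n (ereal p) \<le> 200000 * (2 powr p / p * real n powr (2 / p - 1))"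
proof -
  let ?T = "2 powr p / p * real n powr (2 / p - 1)"
  have n0: "0 < real n" "1 \<le> real n" using n by auto
  note m = typ_norm_facts[OF n0(1) p(1)]
  define M where "M = typ_norm (real n) p"
  define c where "c = (1 / 54 * (p / exp 1) powr (p / 2) :: real)"
  have c: "0 \<le> c" by (simp add: c_def)
  \<comment> \<open>\<open>1 / 54\<close> from the moment bound, and \<open>1 / 2\<close> each from \<open>N \<ge> n / 2\<close> and from the lower tail bound\<close>
  define \<sigma> where "\<sigma> = 1 / 216 * M powr p"
  have Nn: "real n / 2 \<le> real N" using n by simp
  have \<sigma>: "\<sigma> \<le> real N * c / 2"
  proof -
    have "\<sigma> = real n / 2 * c / 2" unfolding \<sigma>_def c_def M_def m(3) by simp
    also have "\<dots> \<le> real N * c / 2" using Nn c by (intro divide_right_mono mult_right_mono) auto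
    finally show ?thesis .
  qed
  define u where "u = 216\<^sup>2 * ((M / p)\<^sup>2 * M powr (- 2 * p) * (2 * (2 * p / exp 1) powr p))"
  have u0: "0 \<le> u" by (simp add: u_def)
  have u: "inc_energy p \<sigma> \<le> ennreal u"
  proof -
    have "inc_energy p \<sigma> \<le> ennreal (1 / (1 / 216)\<^sup>2) * inc_energy p (M powr p)"
      unfolding \<sigma>_def by (rule inc_energy_scale) (use p in auto)
    also have "\<dots> \<le> ennreal (216\<^sup>2) * ennreal ((M / p)\<^sup>2 * M powr (- 2 * p) * (2 * (2 * p / exp 1) powr p))"
      using m(1) p(1) by (intro mult_mono inc_energy_le_moment) (auto simp: M_def power_divide)
    also have "\<dots> = ennreal u" unfolding u_def by (rule ennreal_mult'[symmetric]) simp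
    finally show ?thesis .
  qed
  define v where "v = 2 * (2 * p / exp 1) powr p"
  have v: "0 < v" using p by (simp add: v_def)
  have tail: "law_upto p N (real N * c / 2)
      \<le> ennreal (exp (- (real N * c\<^sup>2 / (8 * v))))"
  proof (rule psum_lower_tail_moments[OF p(1) c _ v])
    have "ennreal c \<le> gauss_int (\<lambda>x. min (\<bar>x\<bar> powr p) (sqrt p powr p))"
      unfolding c_def by (rule gaussian_min_moment_ge[OF p(1)]) simp
    also have "\<dots> \<le> gauss_int (\<lambda>x. \<bar>x\<bar> powr p)"
      by (intro nn_integral_mono ennreal_leI) simp
    finally show "ennreal c \<le> gauss_int (\<lambda>x. \<bar>x\<bar> powr p)" .
    show "gauss_int (\<lambda>x. \<bar>x\<bar> powr (2 * p)) \<le> ennreal v"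
      using gaussian_moment_le[of "2 * p"] p by (simp add: v_def)
  qed
  have ex: "real n powr (1/10) / 93312 \<le> real N * c\<^sup>2 / (8 * v)"
  proof -
    have "(p / exp 1) powr (p / 2) * (p / exp 1) powr (p / 2) = (p / exp 1) powr p"
      by (simp flip: powr_add)
    then have c2: "c\<^sup>2 = 1 / 2916 * (p / exp 1) powr p" by (simp add: c_def power2_eq_square)
    have "(2 * p / exp 1) powr p = 2 powr p * (p / exp 1) powr p"
      by (subst powr_mult[symmetric]) simp
    then have "c\<^sup>2 / (8 * v) = 1 / 46656 * 2 powr (- p)"
      unfolding c2 v_def using p by (simp add: powr_minus_divide)
    then have "real N * (c\<^sup>2 / (8 * v)) = real N * (1 / 46656 * 2 powr (- p))" by (simp only:)
    then have "real N * c\<^sup>2 / (8 * v) = real N * (1 / 46656 * 2 powr (- p))" by simp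
    moreover have "real n / 2 * (1 / 46656 * 2 powr (- p)) \<le> real N * (1 / 46656 * 2 powr (- p))"
      using Nn by (intro mult_right_mono) auto
    ultimately show ?thesis using first_regime_size(1)[OF n0(2) p] by linarith
  qed
  let ?e = "exp (- (real n powr (1/10) / 93312))"
  have "(\<integral>\<^sup>+x. inc_energy p (psum p N x) \<partial>std_gaussian_vec N) \<le> ennreal (u * (1 + (\<Sum>k<(0::nat). 1 * ?e)) + 2 * ?e)"
  proof (rule expectation_inc_energy_levels[OF p(1), where \<sigma> = "\<lambda>_. \<sigma>" and b = "\<lambda>_. 1" and e = "\<lambda>_. ?e"])
    have "law_below p N (\<sigma>)
      \<le> law_upto p N (real N * c / 2)"
      using \<sigma> by (intro emeasure_mono) auto
    also have "\<dots> \<le> ennreal (exp (- (real N * c\<^sup>2 / (8 * v))))" by (rule tail)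
    also have "\<dots> \<le> ennreal ?e" using ex by (intro ennreal_leI) simp
    finally show "law_below p N (\<sigma>) \<le> ennreal ?e" .
  qed (use u u0 in \<open>auto simp: \<sigma>_def\<close>)
  then have E: "(\<integral>\<^sup>+x. inc_energy p (psum p N x) \<partial>std_gaussian_vec N) \<le> ennreal (u + 2 * ?e)" by simp
  have "ennreal (var_lp_norm n (ereal p)) \<le> of_nat (2 * Suc N) * ennreal (u + 2 * ?e)"
    using var_lp_norm_le[OF p(1), of N] E unfolding n(1) by (meson mult_left_mono order_trans zero_le)
  also have "\<dots> = ennreal (2 * real n * (u + 2 * ?e))"
    unfolding n(1) ennreal_of_nat_eq_real_of_nat using u0 by (subst ennreal_mult'[symmetric]) auto
  finally have "var_lp_norm n (ereal p) \<le> 2 * real n * (u + 2 * ?e)"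
    using u0 by (subst (asm) ennreal_le_iff) auto
  also have "\<dots> = 2 * (real n * u) + 4 * real n * ?e" by (simp add: algebra_simps)
  also have "4 * real n * ?e \<le> 1 / (2 * real n)" by (rule n(2))
  also have "1 / (2 * real n) \<le> ?T"
  proof -
    have "1 / 2 * (1 * real n powr (-1)) \<le> 2 powr p / p * (real n powr (2 / p) * real n powr (-1))"
      using two_powr_ge[OF p(1)] n0 p by (intro mult_mono) (auto intro!: ge_one_powr_ge_zero)
    then show ?thesis using n0 by (simp add: powr_minus_divide powr_diff)
  qed
  also have "real n * u = 216\<^sup>2 * 2 * ((1 / exp 1) * ?T)"
    unfolding typ_norm_moment_term[OF n0(1) p(1), symmetric] u_def M_def by simp
  also have "2 * (216\<^sup>2 * 2 * ((1 / exp 1) * ?T)) + ?T \<le> 200000 * ?T"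
  proof -
    have "1 / exp 1 \<le> (1::real)" by simp
    then have "(1 / exp 1) * ?T \<le> 1 * ?T" using p by (intro mult_right_mono) auto
    moreover have "0 \<le> ?T" using p by simp
    moreover have "2 * (216\<^sup>2 * 2 * a) + t \<le> 200000 * t" if "a \<le> 1 * t" "0 \<le> t" for a t :: real
      using that by (simp add: power2_eq_square)
    ultimately show ?thesis by blast
  qed
  finally show ?thesis by simp
qed

context large_dimension
begin

text \<open>In the second regime \<open>M\<^sup>2\<close> runs from \<open>2 * p\<close> at the lower end, where the peak of the weight is at \<open>M\<close>, to about \<open>p\<close>,
and \<open>2 * p - M\<^sup>2\<close> is comparable to the distance \<open>d\<close> of \<open>p\<close> from the lower end; all of \<open>s\<^sup>2\<close>, \<open>p\<close>, \<open>M\<^sup>2\<close> are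
of order \<open>ln n\<close>.\<close>

lemma second_regime_facts:
  assumes p: "1 \<le> p" "2 * ln (real n) / ln (2 * exp 1) \<le> p" "p \<le> \<xi>\<^sup>2"
  defines "M \<equiv> typ_norm (real n) p" and "s \<equiv> sqrt (ln (real n))" and "d \<equiv> p - 2 * ln (real n) / ln (2 * exp 1)"
  shows "p \<le> M\<^sup>2" "M\<^sup>2 \<le> 2 * p" "d \<le> 2 * p - M\<^sup>2" "2 * p - M\<^sup>2 \<le> 4 * d"
    "s / 2 \<le> M" "M \<le> 2 * s" "s\<^sup>2 / 2 \<le> p" "p \<le> 2 * s\<^sup>2" "2 \<le> s" "0 \<le> d" "d \<le> 2 * s\<^sup>2" "s\<^sup>2 = ln (real n)" "1 \<le> M"
proof -
  define L where "L = ln (real n)"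
  define a where "a = 1 + ln (2::real)"
  have a: "3 / 2 \<le> a" "a \<le> 2" using ln2_ge_two_thirds ln2_le_25_over_36 by (auto simp: a_def)
  have x2: "100 \<le> \<xi>\<^sup>2" using power_mono[OF xi, of 2] by simp
  have L: "50 \<le> L" "\<xi>\<^sup>2 / 2 \<le> L" "L \<le> \<xi>\<^sup>2" using ln_n_ge ln_n_le x2 by (auto simp: L_def)
  have d_def': "d = p - 2 * L / a" by (simp add: d_def L_def ln_2e a_def)
  have p0: "0 < p" using p by simp
  have pa: "2 * L / a \<le> p" using p(2) by (simp add: L_def ln_2e a_def)
  then have pL: "2 * L \<le> p * a" using a by (simp add: pos_divide_le_eq)
  have M: "M\<^sup>2 = real n powr (2 / p) * (p / exp 1)" unfolding M_def using n_pos p by (intro typ_norm_facts) auto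
  have M0: "0 < M" unfolding M_def using n_pos p by (intro typ_norm_facts) auto
  have nz: "real n powr (2 / p) = exp (2 * L / p)" using n_pos by (simp add: powr_def L_def)
  \<comment> \<open>chosen so that \<open>M\<^sup>2 = 2 * p * exp (- z)\<close>; it vanishes at the lower end \<open>p = 2 * L / a\<close>\<close>
  define z where "z = a - 2 * L / p"
  have z0: "0 \<le> z" using pL p0 by (simp add: z_def field_simps)
  have z1: "z \<le> 1"
  proof -
    have "p \<le> 2 * L" using p L by simp
    then have "1 \<le> 2 * L / p" using p0 by simp
    moreover have "a \<le> 2" by (rule a)
    ultimately show ?thesis by (simp add: z_def)
  qed
  have "exp (2 * L / p) = exp (1 + ln 2 + (- z))" by (simp add: z_def a_def)
  also have "\<dots> = exp 1 * 2 * exp (- z)" by (simp only: exp_add) simp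
  finally have "M\<^sup>2 = 2 * p * exp (- z)" unfolding M nz by simp
  then have M2: "2 * p - M\<^sup>2 = 2 * p * (1 - exp (- z))" by (simp add: algebra_simps)
  have e1: "1 - exp (- z) \<le> z" using exp_ge_add_one_self[of "- z"] by simp
  have e2: "z / 2 \<le> 1 - exp (- z)"
    using exp_minus_le_quadratic[OF z0] mult_left_mono[OF z1 z0] by (simp add: power2_eq_square)
  have pz: "p * z = a * d" using p0 a by (simp add: z_def d_def' field_simps)
  have d0: "0 \<le> d" using pa by (simp add: d_def')
  show "0 \<le> d" by (rule d0)
  have "d \<le> a * d" using a d0 mult_right_mono[of 1 a d] by simp
  also have "a * d = 2 * p * (z / 2)" using pz by simp
  also have "\<dots> \<le> 2 * p - M\<^sup>2" unfolding M2 using e2 p0 by (intro mult_left_mono) auto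
  finally show dl: "d \<le> 2 * p - M\<^sup>2" .
  have "2 * p - M\<^sup>2 \<le> 2 * p * z" unfolding M2 using e1 p0 by (intro mult_left_mono) auto
  also have "\<dots> = 2 * (a * d)" using pz by simp
  also have "\<dots> \<le> 2 * (2 * d)" using a d0 by (intro mult_left_mono mult_right_mono) auto
  finally show "2 * p - M\<^sup>2 \<le> 4 * d" by simp
  show M2p: "M\<^sup>2 \<le> 2 * p" using dl d0 by simp
  show pM: "p \<le> M\<^sup>2"
  proof -
    have "p \<le> 2 * L" using p L by simp
    then have "1 \<le> 2 * L / p" using p0 by simp
    then have "exp 1 \<le> exp (2 * L / p)" by simp
    then have "exp 1 * (p / exp 1) \<le> exp (2 * L / p) * (p / exp 1)" using p0 by (intro mult_right_mono) auto
    then show ?thesis unfolding M nz by simp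
  qed
  show s2: "s\<^sup>2 = ln (real n)" using L unfolding s_def by (simp add: L_def)
  have s0: "0 \<le> s" using L unfolding s_def by (simp add: L_def)
  have sL: "s\<^sup>2 = L" by (simp add: s2 L_def)
  have "2\<^sup>2 \<le> s\<^sup>2" using L sL by simp
  then show "2 \<le> s" using s0 by (rule power2_le_imp_le)
  show sp: "s\<^sup>2 / 2 \<le> p"
  proof -
    have "p * a \<le> p * 2" using a p0 by (intro mult_left_mono) auto
    then have "2 * L \<le> p * 2" using pL by linarith
    then show ?thesis using L unfolding sL by simp
  qed
  show ps: "p \<le> 2 * s\<^sup>2" using p L unfolding sL by simp
  show "d \<le> 2 * s\<^sup>2"
  proof -
    have "0 \<le> 2 * L / a" using L a by simp
    then show ?thesis using ps by (simp add: d_def')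
  qed
  have "(s / 2)\<^sup>2 = s\<^sup>2 / 4" by (simp add: power_divide)
  then have "(s / 2)\<^sup>2 \<le> M\<^sup>2" using sp pM zero_le_power2[of s] by linarith
  then show "s / 2 \<le> M" by (rule power2_le_imp_le) (use M0 in auto)
  have "(2 * s)\<^sup>2 = 4 * s\<^sup>2" by (simp add: power_mult_distrib)
  then have "M\<^sup>2 \<le> (2 * s)\<^sup>2" using M2p ps by linarith
  then show "M \<le> 2 * s" by (rule power2_le_imp_le) (use s0 in auto)
  have "1\<^sup>2 \<le> M\<^sup>2" using pM p(1) by simp
  then show "1 \<le> M" by (rule power2_le_imp_le) (use M0 in auto)
qed

text \<open>The numerator of the second formula is the expected number of coordinates beyond the typical norm, up to a
power of \<open>ln n\<close>.\<close>

lemma second_regime_value: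
  assumes p: "1 \<le> p"
  shows "exp (- (p / (2 * exp 1)) * real n powr (2 / p) + ln (real n)) = real n * exp (- (typ_norm (real n) p)\<^sup>2 / 2)"
proof -
  have "- (p / (2 * exp 1)) * real n powr (2 / p) = - (typ_norm (real n) p)\<^sup>2 / 2"
    using typ_norm_facts(2)[OF n_pos p] by (simp add: mult.commute)
  then show ?thesis using n_pos by (simp only: exp_add) (simp add: mult.commute)
qed

text \<open>The window at \<open>M\<close> contributes order \<open>1 / (s * (s + d))\<close>, and the dominating coordinates at most the same,
because their order \<open>1 / s ^ 3\<close> is, up to a constant, the smallest value of that expression for \<open>d \<le> 2 * s\<^sup>2\<close>.\<close>

lemma var_upper_second_regime:
  assumes p: "1 \<le> p" "2 * ln (real n) / ln (2 * exp 1) \<le> p" "p \<le> \<xi>\<^sup>2"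
    and C: "1 \<le> C" "level_series_le C"
  shows "var_lp_norm n (ereal p) \<le> 400000000 * C * (exp (- (p / (2 * exp 1)) * real n powr (2 / p) + ln (real n)) /
    (sqrt (ln (real n)) * (sqrt (ln (real n)) + p - 2 * ln (real n) / ln (2 * exp 1))))"
proof -
  define M where "M = typ_norm (real n) p"
  define s where "s = sqrt (ln (real n))"
  define d where "d = p - 2 * ln (real n) / ln (2 * exp 1)"
  note f = second_regime_facts[OF p, folded M_def s_def d_def]
  define V where "V = real n * exp (- M\<^sup>2 / 2) / (s * (s + d))"
  have V_eq: "exp (- (p / (2 * exp 1)) * real n powr (2 / p) + ln (real n)) /
    (sqrt (ln (real n)) * (sqrt (ln (real n)) + p - 2 * ln (real n) / ln (2 * exp 1))) = V"
    unfolding second_regime_value[OF p(1)] V_def M_def s_def d_def by (simp add: algebra_simps)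
  have s0: "0 < s" and d0: "0 \<le> d" and M0: "0 < M" using f by auto
  have V0: "0 \<le> V" using s0 d0 n_pos by (simp add: V_def)
  have p0: "0 < p" using p by simp
  define m where "m = 1 / 54 * (p / exp 1) powr (p / 2)"
  define u where "u = exp (- M\<^sup>2 / 2) * (2 * (M / p)\<^sup>2 * (M / (M + 2 * p - M\<^sup>2)) + 128 / M^3 + 4 * M / p\<^sup>2)"
  have u0: "0 \<le> u" using f M0 p0 by (auto simp: u_def intro!: mult_nonneg_nonneg add_nonneg_nonneg divide_nonneg_nonneg)
  have Mp: "M powr p = real n * (p / exp 1) powr (p / 2)" unfolding M_def using n_pos p by (intro typ_norm_facts) auto
  \<comment> \<open>the level \<open>M powr p / 216\<close> is below half of the truncated mean, and \<open>46656 = 216\<^sup>2\<close> is the cost of the scaling\<close>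
  have "var_lp_norm n (ereal p) \<le> 2 * C * (real n * (46656 * u)) + exp (- 2 * \<xi>\<^sup>2)"
  proof (rule var_upper_mid[OF p(1) _ _ _ _ _ _ C(2), where s = "1 / 216 * M powr p" and m = m])
    show "p \<le> 2 * \<xi>\<^sup>2" using p(3) by (smt (verit) zero_le_power2)
    show "0 < 1 / 216 * M powr p" using M0 by simp
    have m0: "0 \<le> m" by (simp add: m_def)
    have "1 / 216 * M powr p = real n / 2 * m / 2" unfolding Mp m_def by simp
    also have "\<dots> \<le> real N * m / 2" using N_ge m0 by (intro divide_right_mono mult_right_mono) auto
    finally show "1 / 216 * M powr p \<le> real N * m / 2" .
    have "sqrt p \<le> \<xi>" using p xi by (intro real_le_lsqrt) auto
    then show "ennreal m \<le> gauss_int (\<lambda>x. min (\<bar>x\<bar> powr p) (\<xi> powr p))"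
      unfolding m_def by (rule gaussian_min_moment_ge[OF p(1)])
    show "0 \<le> 46656 * u" using u0 by simp
    have "inc_energy p (1 / 216 * M powr p) \<le> ennreal (1 / (1 / 216)\<^sup>2) * inc_energy p (M powr p)"
      by (rule inc_energy_scale) (use p in auto)
    also have "\<dots> \<le> ennreal 46656 * ennreal u"
      unfolding u_def using f(2) M0 p(1) by (intro mult_mono inc_energy_le) (auto simp: power_divide)
    also have "\<dots> = ennreal (46656 * u)" by (rule ennreal_mult'[symmetric]) simp
    finally show "inc_energy p (1 / 216 * M powr p) \<le> ennreal (46656 * u)" .
  qed
  also have "real n * (46656 * u) \<le> 46656 * (3296 * V)"
  proof -
    have sd: "0 < s * (s + d)" using s0 d0 by simp
    have sd3: "s * (s + d) \<le> 3 * s^3"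
    proof -
      have "s \<le> s\<^sup>2" using f(9) by (simp add: power2_eq_square)
      then have "s + d \<le> 3 * s\<^sup>2" using f(11) by linarith
      then have "s * (s + d) \<le> s * (3 * s\<^sup>2)" using s0 by (intro mult_left_mono) auto
      then show ?thesis by (simp add: power2_eq_square power3_eq_cube)
    qed
    then have s3: "1 / s^3 \<le> 3 / (s * (s + d))"
      using s0 sd by (simp add: divide_le_eq pos_le_divide_eq field_simps)
    have Mpq: "M / p \<le> 4 / s"
    proof -
      have "M / p \<le> (2 * s) / (s\<^sup>2 / 2)" using f M0 p0 s0 by (intro frac_le) auto
      then show ?thesis using s0 by (simp add: power2_eq_square)
    qed
    have a: "2 * (M / p)\<^sup>2 * (M / (M + 2 * p - M\<^sup>2)) \<le> 128 / (s * (s + d))"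
    proof -
      have "(s + d) / 2 \<le> M + q" if "d \<le> q" for q using that f(5) d0 by (simp add: field_simps)
      from this[OF f(3)] have den: "(s + d) / 2 \<le> M + 2 * p - M\<^sup>2" by simp
      have "(M / p)\<^sup>2 \<le> (4 / s)\<^sup>2" using Mpq M0 p0 by (intro power_mono) auto
      moreover have "M / (M + 2 * p - M\<^sup>2) \<le> 2 * s / ((s + d) / 2)"
        using f(6) den s0 d0 M0 by (intro frac_le) auto
      moreover have "0 \<le> M / (M + 2 * p - M\<^sup>2)" using den s0 d0 M0 by (intro divide_nonneg_nonneg) auto
      ultimately have "2 * (M / p)\<^sup>2 * (M / (M + 2 * p - M\<^sup>2)) \<le> 2 * (4 / s)\<^sup>2 * (2 * s / ((s + d) / 2))"
        by (intro mult_mono) auto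
      moreover have "2 * (4 / s)\<^sup>2 * (2 * s / (t / 2)) = 128 / (s * t)" if "0 < t" for t
        using s0 that by (simp add: power2_eq_square field_simps)
      then have "2 * (4 / s)\<^sup>2 * (2 * s / ((s + d) / 2)) = 128 / (s * (s + d))" using s0 d0 by simp
      ultimately show ?thesis by simp
    qed
    have b: "128 / M^3 \<le> 3072 / (s * (s + d))"
    proof -
      have "(s / 2)^3 \<le> M^3" using f(5) s0 by (intro power_mono) auto
      then have "128 / M^3 \<le> 128 / (s / 2)^3" using s0 M0 by (intro divide_left_mono) auto
      also have "\<dots> = 1024 * (1 / s^3)" by (simp add: power_divide)
      also have "\<dots> \<le> 1024 * (3 / (s * (s + d)))" by (intro mult_left_mono s3) auto
      finally show ?thesis by simp
    qed
    have c: "4 * M / p\<^sup>2 \<le> 96 / (s * (s + d))"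
    proof -
      have "(s\<^sup>2 / 2)\<^sup>2 \<le> p\<^sup>2" using f(7) by (intro power_mono) auto
      then have "4 * M / p\<^sup>2 \<le> 4 * (2 * s) / (s\<^sup>2 / 2)\<^sup>2" using f(6) M0 s0 p0 by (intro frac_le) auto
      also have "\<dots> = 32 * (1 / s^3)" using s0 by (simp add: power2_eq_square power3_eq_cube field_simps)
      also have "\<dots> \<le> 32 * (3 / (s * (s + d)))" by (intro mult_left_mono s3) auto
      finally show ?thesis by simp
    qed
    have "2 * (M / p)\<^sup>2 * (M / (M + 2 * p - M\<^sup>2)) + 128 / M^3 + 4 * M / p\<^sup>2 \<le> 128 / (s * (s + d)) + 3072 / (s * (s + d)) + 96 / (s * (s + d))"
      by (intro add_mono a b c)
    also have "\<dots> = 3296 / (s * (s + d))" by (simp add: add_divide_distrib[symmetric])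
    finally have "u \<le> exp (- M\<^sup>2 / 2) * (3296 / (s * (s + d)))" unfolding u_def by (intro mult_left_mono) auto
    then have "real n * u \<le> real n * (exp (- M\<^sup>2 / 2) * (3296 / (s * (s + d))))" by (intro mult_left_mono) auto
    also have "\<dots> = 3296 * V" by (simp add: V_def)
    finally have "46656 * (real n * u) \<le> 46656 * (3296 * V)" by (rule mult_left_mono) simp
    then show ?thesis by (simp only: mult.left_commute)
  qed
  also have "exp (- 2 * \<xi>\<^sup>2) \<le> V"
  proof -
    have x0: "0 < \<xi>" using xi by simp
    have s_xi: "s \<le> \<xi>" using ln_n_le f(12) x0 by (intro power2_le_imp_le[of s \<xi>]) auto
    have "0 \<le> 2 * ln (real n) / (1 + ln 2)"
      using n_ge_10 ln2_ge_two_thirds by (intro divide_nonneg_nonneg) auto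
    then have "d \<le> p" unfolding d_def ln_2e by simp
    then have "s + d \<le> \<xi> + \<xi>\<^sup>2" using s_xi p by linarith
    also have "\<dots> \<le> 3 * \<xi>\<^sup>2" using xi by (simp add: power2_eq_square)
    finally have "s * (s + d) \<le> \<xi> * (3 * \<xi>\<^sup>2)" using s_xi s0 d0 x0 by (intro mult_mono) auto
    also have "\<dots> \<le> exp (\<xi>\<^sup>2)" using xi_exp by (simp add: power2_eq_square power3_eq_cube)
    finally have den: "s * (s + d) \<le> exp (\<xi>\<^sup>2)" .
    have "exp (- 2 * \<xi>\<^sup>2) = 1 * exp (- \<xi>\<^sup>2) / exp (\<xi>\<^sup>2)" by (simp flip: exp_diff)
    also have "\<dots> \<le> real n * exp (- M\<^sup>2 / 2) / (s * (s + d))"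
      using den s0 d0 n_ge_10 f(2) p(3) by (intro frac_le mult_mono) auto
    finally show ?thesis by (simp add: V_def)
  qed
  also have "2 * C * (46656 * (3296 * V)) + V \<le> 400000000 * C * V"
  proof -
    have "V \<le> C * V" using mult_right_mono[OF C(1) V0] by simp
    moreover have "2 * C * (46656 * (3296 * V)) = 307556352 * (C * V)" by simp
    moreover have "0 \<le> C * V" using C V0 by simp
    ultimately show ?thesis by linarith
  qed
  finally show ?thesis unfolding V_eq using C by (simp add: mult_left_mono)
qed

text \<open>Here \<open>M\<^sup>2\<close> exceeds \<open>\<xi>\<^sup>2\<close> by about \<open>(\<xi>\<^sup>2 / p) * 2 * ln (1 / w)\<close>, so \<open>exp (- M\<^sup>2 / 2)\<close> is about
\<open>w powr (\<xi>\<^sup>2 / p) * exp (- \<xi>\<^sup>2 / 2)\<close>. The exponent \<open>\<xi>\<^sup>2 / p\<close> may be replaced by \<open>1\<close>: it differs from \<open>1\<close> by at most \<open>w\<close>,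
and \<open>w powr (- w)\<close> is bounded.\<close>

lemma third_regime_facts:
  assumes p: "\<xi>\<^sup>2 \<le> p" "p \<le> 2 * \<xi>\<^sup>2"
  defines "w \<equiv> 1 - (\<xi>\<^sup>2 - \<xi>) / p" and "M \<equiv> \<xi> * (1 - (\<xi>\<^sup>2 - \<xi>) / p) powr (- (1 / p))"
  shows "0 < w" "w \<le> 1" "p * w = \<xi> + p - \<xi>\<^sup>2" "1 / (2 * \<xi>) \<le> w" "\<xi> \<le> M" "M \<le> 2 * \<xi>" "M\<^sup>2 \<le> 6/5 * p"
    "M powr p = \<xi> powr p / w" "exp (- M\<^sup>2 / 2) \<le> 3 * w * exp (- \<xi>\<^sup>2 / 2)" "w / 2 * exp (- \<xi>\<^sup>2 / 2) \<le> exp (- M\<^sup>2 / 2)" "1 \<le> p"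
proof -
  have x0: "0 < \<xi>" using xi by simp
  have x2: "100 \<le> \<xi>\<^sup>2" using power_mono[OF xi, of 2] by simp
  have p0: "0 < p" "1 \<le> p" using p x2 by auto
  show "1 \<le> p" by (rule p0)
  show pw: "p * w = \<xi> + p - \<xi>\<^sup>2" using p0 by (simp add: w_def field_simps)
  have w_eq: "w = (\<xi> + p - \<xi>\<^sup>2) / p" using p0 pw by (simp add: field_simps)
  show w0: "0 < w" unfolding w_eq using p x0 p0 by (intro divide_pos_pos) linarith+
  have "\<xi> \<le> \<xi>\<^sup>2" using xi by (simp add: power2_eq_square)
  then show w1: "w \<le> 1" using p0 by (simp add: w_def)
  have "1 / (2 * \<xi>) = \<xi> / (2 * \<xi>\<^sup>2)" using x0 by (simp add: power2_eq_square)
  also have "\<dots> \<le> (\<xi> + p - \<xi>\<^sup>2) / p" using p x0 p0 by (intro frac_le) auto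
  finally show w2: "1 / (2 * \<xi>) \<le> w" unfolding w_eq .
  define l where "l = ln (1 / w)"
  have lw: "l = - ln w" using w0 by (simp add: l_def ln_div)
  have l0: "0 \<le> l" using w0 w1 unfolding lw by simp
  have l1: "l \<le> ln (2 * \<xi>)"
  proof -
    have "1 / w \<le> 2 * \<xi>" using w2 w0 x0 by (simp add: field_simps)
    then show ?thesis unfolding l_def using w0 x0 by (subst ln_le_cancel_iff) auto
  qed
  then have l20: "20 * l \<le> \<xi>" using xi_ln by simp
  define x where "x = 2 * l / p"
  have M_eq: "M\<^sup>2 = \<xi>\<^sup>2 * exp x"
  proof -
    have "(w powr (- (1 / p)))\<^sup>2 = exp x"
      using w0 by (simp add: powr_def x_def lw power2_eq_square flip: exp_add)
    then show ?thesis unfolding M_def w_def[symmetric] by (simp add: power_mult_distrib)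
  qed
  have M0: "0 < M" using w0 x0 unfolding M_def w_def[symmetric] by simp
  have x0': "0 \<le> x" using l0 p0 by (simp add: x_def)
  have xxi: "\<xi>\<^sup>2 * x \<le> 2 * l"
  proof -
    have "\<xi>\<^sup>2 * x \<le> p * x" using p x0' by (intro mult_right_mono) auto
    then show ?thesis using p0 by (simp add: x_def)
  qed
  have x_small: "\<xi> * x \<le> 1/10"
  proof -
    have "\<xi> * (\<xi> * x) \<le> \<xi> * (1/10)" using xxi l20 by (simp add: power2_eq_square mult.assoc)
    then show ?thesis using x0 by simp
  qed
  then have x_small': "x \<le> 1/100" using mult_right_mono[OF xi x0'] by simp
  have ex: "exp x \<le> 1 + x + x\<^sup>2" using x0' x_small' by (intro exp_bound) auto
  have "x\<^sup>2 \<le> (1/100)\<^sup>2" using x0' x_small' by (intro power_mono) auto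
  then have ex': "exp x \<le> 6/5" using ex x_small' by (simp add: power2_eq_square)
  have "M\<^sup>2 \<le> \<xi>\<^sup>2 * (6/5)" unfolding M_eq using ex' by (intro mult_left_mono) auto
  then show M65: "M\<^sup>2 \<le> 6/5 * p" using p by simp
  have "a \<le> 4 * b" if "a \<le> b * (6/5)" "0 \<le> b" for a b :: real using that by linarith
  from this[OF \<open>M\<^sup>2 \<le> \<xi>\<^sup>2 * (6/5)\<close>] have "M\<^sup>2 \<le> (2 * \<xi>)\<^sup>2" unfolding power_mult_distrib by simp
  then show "M \<le> 2 * \<xi>" by (rule power2_le_imp_le) (use x0 in simp)
  have "\<xi>\<^sup>2 * 1 \<le> \<xi>\<^sup>2 * exp x" using x0' by (intro mult_left_mono) auto
  then have "\<xi>\<^sup>2 \<le> M\<^sup>2" unfolding M_eq by simp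
  then show "\<xi> \<le> M" by (rule power2_le_imp_le) (use M0 in simp)
  have "(w powr (- (1 / p))) powr p = 1 / w"
    using w0 p0 by (simp only: powr_powr) (simp add: powr_minus_divide)
  then show "M powr p = \<xi> powr p / w" using x0 unfolding M_def w_def[symmetric] by (simp add: powr_mult)
  show "exp (- M\<^sup>2 / 2) \<le> 3 * w * exp (- \<xi>\<^sup>2 / 2)"
  proof -
    have "\<xi>\<^sup>2 * (1 + x) \<le> M\<^sup>2" unfolding M_eq using exp_ge_add_one_self[of x] by (intro mult_left_mono) (auto simp: add.commute)
    then have 1: "- M\<^sup>2 / 2 \<le> - \<xi>\<^sup>2 / 2 - \<xi>\<^sup>2 * x / 2" by (simp add: algebra_simps)
    \<comment> \<open>here the exponent \<open>\<xi>\<^sup>2 / p\<close> of \<open>w\<close> is split into \<open>1\<close> and a remainder\<close>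
    have 2: "\<xi>\<^sup>2 * x / 2 = l - (1 - \<xi>\<^sup>2 / p) * l" using p0 by (simp add: x_def algebra_simps)
    have "1 - \<xi>\<^sup>2 / p \<le> w" using x0 p0 by (simp add: w_def diff_divide_distrib)
    then have "(1 - \<xi>\<^sup>2 / p) * l \<le> w * l" using l0 by (intro mult_right_mono) auto
    also have "\<dots> \<le> w * (1 / w - 1)" using w0 unfolding l_def by (intro mult_left_mono ln_le_minus_one) auto
    also have "\<dots> \<le> 1" using w0 by (simp add: right_diff_distrib)
    finally have "- M\<^sup>2 / 2 \<le> - \<xi>\<^sup>2 / 2 + (1 - l)" using 1 2 by linarith
    then have "exp (- M\<^sup>2 / 2) \<le> exp (- \<xi>\<^sup>2 / 2) * (exp 1 * exp (- l))" by (simp flip: exp_add)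
    also have "\<dots> \<le> exp (- \<xi>\<^sup>2 / 2) * (3 * exp (- l))" using exp_le by (intro mult_left_mono mult_right_mono) auto
    also have "exp (- l) = w" using w0 by (simp add: lw)
    finally show ?thesis by (simp add: mult_ac)
  qed
  show "w / 2 * exp (- \<xi>\<^sup>2 / 2) \<le> exp (- M\<^sup>2 / 2)"
  proof -
    have "(\<xi> * x)\<^sup>2 \<le> (1/10)\<^sup>2" using x_small x0' x0 by (intro power_mono) auto
    then have xx: "\<xi>\<^sup>2 * x\<^sup>2 \<le> 1/100" by (simp add: power2_eq_square mult_ac)
    have "M\<^sup>2 \<le> \<xi>\<^sup>2 * (1 + x + x\<^sup>2)" unfolding M_eq using ex by (intro mult_left_mono) auto
    also have "\<dots> = \<xi>\<^sup>2 + \<xi>\<^sup>2 * x + \<xi>\<^sup>2 * x\<^sup>2" by (simp add: algebra_simps)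
    finally have "- \<xi>\<^sup>2 / 2 + (- l + - (1/2)) \<le> - M\<^sup>2 / 2" using xxi xx by linarith
    then have "exp (- \<xi>\<^sup>2 / 2) * (exp (- l) * exp (- (1/2))) \<le> exp (- M\<^sup>2 / 2)" by (simp flip: exp_add)
    moreover have "exp (- l) = w" using w0 by (simp add: lw)
    moreover have "1/2 \<le> exp (- (1/2) :: real)" using exp_ge_add_one_self[of "- (1/2)"] by simp
    then have "exp (- \<xi>\<^sup>2 / 2) * (w * (1/2)) \<le> exp (- \<xi>\<^sup>2 / 2) * (w * exp (- (1/2)))"
      using w0 by (intro mult_left_mono) auto
    ultimately show ?thesis by (simp add: mult_ac)
  qed
qed

text \<open>The truncated mean of the sum is of order \<open>\<xi> powr p / w\<close>: the window below \<open>\<xi>\<close> has width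
\<open>\<xi> / (\<xi> + p - \<xi>\<^sup>2) = \<xi> / (p * w)\<close>. Then \<open>M\<close> is well below the peak \<open>sqrt (2 * p)\<close>, and all parts of the one-coordinate variance are of
order \<open>exp (- M\<^sup>2 / 2) / \<xi> ^ 3\<close>.\<close>

lemma var_upper_third_regime_near:
  assumes p: "\<xi>\<^sup>2 \<le> p" "p \<le> 2 * \<xi>\<^sup>2"
    and C: "1 \<le> C" "level_series_le C"
  shows "var_lp_norm n (ereal p) \<le> 4000000000 * C * (1 / ln (real n) * (1 - (\<xi>\<^sup>2 - \<xi>) / p))"
proof -
  define w where "w = 1 - (\<xi>\<^sup>2 - \<xi>) / p"
  define M where "M = \<xi> * w powr (- (1 / p))"
  note f = third_regime_facts[OF p, folded w_def, folded M_def]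
  have x0: "0 < \<xi>" using xi by simp
  have M0: "0 < M" using f(5) x0 by simp
  have p0: "0 < p" using f(11) by simp
  have mom: "ennreal (\<xi> powr p * (1 / 54 * exp (- \<xi>\<^sup>2 / 2) * (\<xi> / (\<xi> + p - \<xi>\<^sup>2))))
    \<le> gauss_int (\<lambda>x. min (\<bar>x\<bar> powr p) (\<xi> powr p))"
  proof -
    let ?f = "\<lambda>x. (\<bar>x\<bar> / \<xi>) powr p * indicator {x. \<xi> - 1/2 \<le> \<bar>x\<bar> \<and> \<bar>x\<bar> \<le> \<xi>} x"
    have "ennreal (\<xi> powr p * (1 / 54 * exp (- \<xi>\<^sup>2 / 2) * (\<xi> / (\<xi> + p - \<xi>\<^sup>2))))
        = ennreal (\<xi> powr p) * ennreal (1 / 54 * exp (- \<xi>\<^sup>2 / 2) * (\<xi> / (\<xi> + p - \<xi>\<^sup>2)))"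
      by (rule ennreal_mult') simp
    also have "\<dots> \<le> ennreal (\<xi> powr p) * gauss_int (\<lambda>x. ?f x)"
      using p xi by (intro mult_left_mono truncated_moment_lower) auto
    also have "\<dots> = (\<integral>\<^sup>+x. ennreal (\<xi> powr p) * ennreal (?f x) \<partial>std_gaussian)"
      by (rule nn_integral_cmult[symmetric]) measurable
    also have "\<dots> \<le> gauss_int (\<lambda>x. min (\<bar>x\<bar> powr p) (\<xi> powr p))"
    proof (rule nn_integral_mono)
      fix x :: real
      have "\<xi> powr p * ?f x \<le> min (\<bar>x\<bar> powr p) (\<xi> powr p)"
      proof (cases "\<bar>x\<bar> \<le> \<xi>")
        case True
        have "\<xi> powr p * ?f x \<le> \<xi> powr p * (\<bar>x\<bar> / \<xi>) powr p"
          by (intro mult_left_mono) (auto split: split_indicator)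
        also have "\<dots> = \<bar>x\<bar> powr p" using x0 by (simp add: powr_divide)
        finally have "\<xi> powr p * ?f x \<le> \<bar>x\<bar> powr p" .
        moreover have "\<bar>x\<bar> powr p \<le> \<xi> powr p" using True p0 by (intro powr_mono2) auto
        ultimately show ?thesis by linarith
      qed simp
      then show "ennreal (\<xi> powr p) * ennreal (?f x) \<le> ennreal (min (\<bar>x\<bar> powr p) (\<xi> powr p))"
        by (subst ennreal_mult'[symmetric]) (auto intro!: ennreal_leI)
    qed
    finally show ?thesis .
  qed
  define m where "m = \<xi> powr p * (1 / 54 * exp (- \<xi>\<^sup>2 / 2) * (\<xi> / (p * w)))"
  have mom': "ennreal m \<le> gauss_int (\<lambda>x. min (\<bar>x\<bar> powr p) (\<xi> powr p))"
    using mom unfolding m_def f(3) .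
  have m0: "0 \<le> m" using x0 p0 f(1) by (simp add: m_def)
  have size: "1 / 432 * M powr p \<le> real N * m / 2"
  proof -
    have "1 / 432 * M powr p = \<xi> powr p / w * (1 / 216) * (\<xi>\<^sup>2 / (2 * \<xi>\<^sup>2))" using x0 by (simp add: f(8))
    also have "\<dots> \<le> \<xi> powr p / w * (1 / 216) * (\<xi>\<^sup>2 / p)"
      using p p0 f(1) x0 by (intro mult_left_mono divide_left_mono mult_pos_pos) auto
    also have "\<dots> = \<xi> * exp (\<xi>\<^sup>2 / 2) / 2 * m / 2"
    proof -
      have "exp (\<xi>\<^sup>2 / 2) * exp (- \<xi>\<^sup>2 / 2) = 1" by (simp flip: exp_add)
      then have "\<xi> * exp (\<xi>\<^sup>2 / 2) / 2 * m / 2 = \<xi> powr p * (1 / 216) * \<xi> * (\<xi> / (p * w)) * 1"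
        by (simp add: m_def)
      then show ?thesis by (simp add: power2_eq_square mult_ac)
    qed
    also have "\<dots> \<le> real n / 2 * m / 2" using n_ge m0 by (intro divide_right_mono mult_right_mono) auto
    also have "\<dots> \<le> real N * m / 2" using N_ge m0 by (intro divide_right_mono mult_right_mono) auto
    finally show ?thesis .
  qed
  define u where "u = exp (- M\<^sup>2 / 2) * (2 * (M / p)\<^sup>2 * (M / (M + 2 * p - M\<^sup>2)) + 128 / M^3 + 4 * M / p\<^sup>2)"
  have den: "p / 2 \<le> M + 2 * p - M\<^sup>2" using f(7) M0 p0 by linarith
  have u0: "0 \<le> u" using den M0 p0 by (auto simp: u_def intro!: mult_nonneg_nonneg add_nonneg_nonneg divide_nonneg_nonneg)
  \<comment> \<open>the level \<open>M powr p / 432\<close> is below half of the truncated mean, and \<open>186624 = 432\<^sup>2\<close> is the cost of the scaling\<close>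
  have "var_lp_norm n (ereal p) \<le> 2 * C * (real n * (186624 * u)) + exp (- 2 * \<xi>\<^sup>2)"
  proof (rule var_upper_mid[OF f(11) p(2) _ size mom' _ _ C(2)])
    show "0 < 1 / 432 * M powr p" using M0 by simp
    show "0 \<le> 186624 * u" using u0 by simp
    have "inc_energy p (1 / 432 * M powr p) \<le> ennreal (1 / (1 / 432)\<^sup>2) * inc_energy p (M powr p)"
      by (rule inc_energy_scale) (use f(11) in auto)
    also have "\<dots> \<le> ennreal 186624 * ennreal u"
      unfolding u_def using f(7) M0 f(11) by (intro mult_mono inc_energy_le) (auto simp: power_divide)
    also have "\<dots> = ennreal (186624 * u)" by (rule ennreal_mult'[symmetric]) simp
    finally show "inc_energy p (1 / 432 * M powr p) \<le> ennreal (186624 * u)" .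
  qed
  also have "real n * (186624 * u) \<le> 186624 * (8064 * (w / \<xi>\<^sup>2))"
  proof -
    have Mp: "M / p \<le> 2 / \<xi>"
    proof -
      have "M / p \<le> 2 * \<xi> / \<xi>\<^sup>2" using f(6) p x0 M0 by (intro frac_le) auto
      then show ?thesis using x0 by (simp add: power2_eq_square)
    qed
    have a: "2 * (M / p)\<^sup>2 * (M / (M + 2 * p - M\<^sup>2)) \<le> 32 / \<xi>^3"
    proof -
      have "(M / p)\<^sup>2 \<le> (2 / \<xi>)\<^sup>2" using Mp M0 p0 by (intro power_mono) auto
      moreover have "M / (M + 2 * p - M\<^sup>2) \<le> 4 / \<xi>"
      proof -
        have "M / (M + 2 * p - M\<^sup>2) \<le> M / (p / 2)" using den M0 p0 by (intro divide_left_mono) auto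
        also have "\<dots> = 2 * (M / p)" by simp
        also have "\<dots> \<le> 2 * (2 / \<xi>)" by (intro mult_left_mono Mp) auto
        finally show ?thesis by simp
      qed
      moreover have "0 \<le> M / (M + 2 * p - M\<^sup>2)" using den M0 p0 by (intro divide_nonneg_nonneg) auto
      ultimately have "2 * (M / p)\<^sup>2 * (M / (M + 2 * p - M\<^sup>2)) \<le> 2 * (2 / \<xi>)\<^sup>2 * (4 / \<xi>)"
        by (intro mult_mono) auto
      then show ?thesis by (simp add: power2_eq_square power3_eq_cube)
    qed
    have b: "128 / M^3 \<le> 128 / \<xi>^3"
      using f(5) x0 M0 by (intro divide_left_mono power_mono) auto
    have c: "4 * M / p\<^sup>2 \<le> 8 / \<xi>^3"
    proof -
      have "(\<xi>\<^sup>2)\<^sup>2 \<le> p\<^sup>2" using p by (intro power_mono) auto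
      then have "4 * M / p\<^sup>2 \<le> 4 * (2 * \<xi>) / (\<xi>\<^sup>2)\<^sup>2" using f(6) x0 M0 by (intro frac_le) auto
      also have "\<dots> = 8 / \<xi>^3" using x0 by (simp add: power2_eq_square power3_eq_cube)
      finally show ?thesis .
    qed
    have "2 * (M / p)\<^sup>2 * (M / (M + 2 * p - M\<^sup>2)) + 128 / M^3 + 4 * M / p\<^sup>2 \<le> 32 / \<xi>^3 + 128 / \<xi>^3 + 8 / \<xi>^3"
      by (intro add_mono a b c)
    also have "\<dots> = 168 / \<xi>^3" by (simp add: add_divide_distrib[symmetric])
    finally have "u \<le> (3 * w * exp (- \<xi>\<^sup>2 / 2)) * (168 / \<xi>^3)"
      unfolding u_def using f(9) den M0 p0 f(1)
      by (intro mult_mono) (auto intro!: mult_nonneg_nonneg add_nonneg_nonneg divide_nonneg_nonneg)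
    then have "real n * u \<le> (16 * \<xi> * exp (\<xi>\<^sup>2 / 2)) * ((3 * w * exp (- \<xi>\<^sup>2 / 2)) * (168 / \<xi>^3))"
      using n_le u0 x0 by (intro mult_mono) auto
    also have "\<dots> = 8064 * w * (\<xi> / \<xi>^3) * (exp (\<xi>\<^sup>2 / 2) * exp (- \<xi>\<^sup>2 / 2))" by simp
    also have "exp (\<xi>\<^sup>2 / 2) * exp (- \<xi>\<^sup>2 / 2) = 1" by (simp flip: exp_add)
    also have "\<xi> / \<xi>^3 = 1 / \<xi>\<^sup>2" using x0 by (simp add: power2_eq_square power3_eq_cube)
    finally show ?thesis by simp
  qed
  also have "exp (- 2 * \<xi>\<^sup>2) \<le> w / \<xi>\<^sup>2"
  proof -
    have "exp (- 2 * \<xi>\<^sup>2) \<le> exp (- \<xi>\<^sup>2)" by simp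
    also have "\<dots> = 1 / exp (\<xi>\<^sup>2)" by (simp add: exp_minus field_simps)
    also have "\<dots> \<le> 1 / (2 * \<xi>^3)"
    proof -
      have "0 < \<xi>^3" using x0 by simp
      then have "2 * \<xi>^3 \<le> exp (\<xi>\<^sup>2)" using xi_exp by linarith
      then show ?thesis using x0 by (intro divide_left_mono) auto
    qed
    also have "\<dots> = 1 / (2 * \<xi>) / \<xi>\<^sup>2" by (simp add: power2_eq_square power3_eq_cube)
    also have "\<dots> \<le> w / \<xi>\<^sup>2" using f(4) by (intro divide_right_mono) auto
    finally show ?thesis .
  qed
  also have "2 * C * (186624 * (8064 * (w / \<xi>\<^sup>2))) + w / \<xi>\<^sup>2 \<le> 4000000000 * C * (w / \<xi>\<^sup>2)"
  proof -
    have W0: "0 \<le> w / \<xi>\<^sup>2" using f(1) by simp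
    have "w / \<xi>\<^sup>2 \<le> C * (w / \<xi>\<^sup>2)" using mult_right_mono[OF C(1) W0] by simp
    moreover have "2 * C * (186624 * (8064 * (w / \<xi>\<^sup>2))) = 3009871872 * (C * (w / \<xi>\<^sup>2))" by simp
    moreover have "0 \<le> C * (w / \<xi>\<^sup>2)" using C(1) W0 by (intro mult_nonneg_nonneg) auto
    ultimately show ?thesis by linarith
  qed
  also have "4000000000 * C * (w / \<xi>\<^sup>2) \<le> 4000000000 * C * (1 / ln (real n) * w)"
  proof -
    have "0 < ln (real n)" using n_ge_10 by simp
    then have "w / \<xi>\<^sup>2 \<le> w / ln (real n)" using ln_n_le f(1) x0 by (intro divide_left_mono) auto
    then show ?thesis using C by (intro mult_left_mono) auto
  qed
  finally show ?thesis using C unfolding w_def by (simp add: mult_left_mono)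
qed

lemma var_upper_third_regime_far:
  assumes p: "2 * \<xi>\<^sup>2 \<le> p"
    and C: "1 \<le> C" "level_series_le C"
  shows "var_lp_norm n (ereal p) \<le> 4000000000 * C * (1 / ln (real n) * (1 - (\<xi>\<^sup>2 - \<xi>) / p))"
proof -
  have x0: "0 < \<xi>" using xi by simp
  have L0: "0 < ln (real n)" using n_ge_10 by simp
  have x2: "0 < \<xi>\<^sup>2" using x0 by simp
  have w: "1 / 2 \<le> 1 - (\<xi>\<^sup>2 - \<xi>) / p"
  proof -
    have "\<xi>\<^sup>2 - \<xi> \<le> \<xi>\<^sup>2" using x0 by simp
    then have "(\<xi>\<^sup>2 - \<xi>) / p \<le> \<xi>\<^sup>2 / (2 * \<xi>\<^sup>2)" using p x2 by (intro frac_le) auto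
    then show ?thesis using x0 by simp
  qed
  have "var_lp_norm n (ereal p) \<le> 2 * C * (17000 / \<xi>\<^sup>2) + exp (- 2 * \<xi>\<^sup>2)"
    by (rule var_upper_beyond[OF p C(2)])
  also have "exp (- 2 * \<xi>\<^sup>2) \<le> C * (1 / \<xi>\<^sup>2)"
  proof -
    have "\<xi>\<^sup>2 \<le> exp (2 * \<xi>\<^sup>2)" using exp_ge_add_one_self[of "2 * \<xi>\<^sup>2"] x2 by linarith
    then have "exp (- 2 * \<xi>\<^sup>2) \<le> 1 / \<xi>\<^sup>2" using x2 by (simp add: exp_minus field_simps)
    also have "\<dots> \<le> C * (1 / \<xi>\<^sup>2)" using C(1) x2 mult_right_mono[OF C(1), of "1 / \<xi>\<^sup>2"] by simp
    finally show ?thesis .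
  qed
  also have "2 * C * (17000 / \<xi>\<^sup>2) + C * (1 / \<xi>\<^sup>2) = 68002 * C * (1 / \<xi>\<^sup>2 * (1 / 2))" by (simp add: field_simps)
  also have "\<dots> \<le> 4000000000 * C * (1 / ln (real n) * (1 - (\<xi>\<^sup>2 - \<xi>) / p))"
  proof (intro mult_mono)
    show "1 / \<xi>\<^sup>2 \<le> 1 / ln (real n)" using ln_n_le L0 x2 by (intro divide_left_mono) auto
  qed (use C L0 x2 w in auto)
  finally show ?thesis by simp
qed

end

section \<open>Lower bounds in the three regimes\<close>

text \<open>Markov's inequality bounds the median of the sum by \<open>4 * typ_norm n p powr p\<close>, and the scaling of the
increments removes the factor four.\<close>

lemma var_lower_from_gap_energy:
  assumes n: "n = Suc N" and p: "1 \<le> p"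
    and l: "0 \<le> l" "ennreal l \<le> gap_energy p (typ_norm (real n) p powr p)"
  shows "1 / 3072 * (real n * l) \<le> var_lp_norm n (ereal p)"
proof -
  have n0: "0 < real n" using n by simp
  define T where "T = typ_norm (real n) p powr p"
  have T: "T = real n * (p / exp 1) powr (p / 2)" unfolding T_def by (rule typ_norm_facts(3)[OF n0 p])
  have T0: "0 < T" unfolding T using n0 p by simp
  have med: "1/2 \<le> prob_upto p N (4 * T)"
  proof (rule psum_median_le[OF p, where B = "{}" and ?c1.0 = 0 and ?c2.0 = "1 / (2 * real n)"])
    show "real N * (0 + 1 / (2 * real n)) \<le> 1 / 2" using n by simp
    have "gauss_int (\<lambda>x. \<bar>x\<bar> powr p * indicator (- {}) x) \<le> ennreal (2 * (p / exp 1) powr (p / 2))"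
      using gaussian_moment_le[of p] p by simp
    also have "2 * (p / exp 1) powr (p / 2) = 1 / (2 * real n) * (4 * T)" unfolding T using n0 by simp
    finally show "gauss_int (\<lambda>x. \<bar>x\<bar> powr p * indicator (- {}) x) \<le> ennreal (1 / (2 * real n) * (4 * T))" .
  qed (use T0 in auto)
  have "ennreal l \<le> gap_energy p (1/4 * (4 * T))" using l(2) by (simp add: T_def)
  also have "\<dots> \<le> ennreal (1 / (1/4)\<^sup>2) * gap_energy p (4 * T)"
    by (rule gap_energy_scale) (use T0 p in auto)
  also have "ennreal (1 / (1/4)\<^sup>2) = ennreal 16" by (simp add: power_divide)
  finally have 1: "ennreal l \<le> ennreal 16 * gap_energy p (4 * T)" .
  have "ennreal (real n * l) = ennreal (real n) * ennreal l" by (rule ennreal_mult') simp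
  also have "\<dots> \<le> ennreal (real n) * (ennreal 16 * gap_energy p (4 * T))" by (intro mult_left_mono 1) simp
  also have "\<dots> = ennreal 16 * (of_nat (Suc N) * gap_energy p (4 * T))"
    unfolding n ennreal_of_nat_eq_real_of_nat by (rule mult.left_commute)
  also have "\<dots> \<le> ennreal 16 * ennreal (192 * var_lp_norm n (ereal p))"
    unfolding n using T0 med p by (intro mult_left_mono var_lp_norm_ge) auto
  also have "\<dots> = ennreal (16 * (192 * var_lp_norm n (ereal p)))" by (rule ennreal_mult'[symmetric]) simp
  finally have "ennreal (real n * l) \<le> ennreal (16 * (192 * var_lp_norm n (ereal p)))" .
  moreover have "0 \<le> var_lp_norm n (ereal p)" unfolding var_lp_norm_def by simp
  ultimately have "real n * l \<le> 16 * (192 * var_lp_norm n (ereal p))"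
    by (subst (asm) ennreal_le_iff) auto
  then show ?thesis by simp
qed

lemma var_lower_first_regime:
  assumes n: "n = Suc N"
    and p: "1 \<le> p" "p \<le> 2 * ln (real n) / ln (2 * exp 1)"
  shows "1 / 10000000 * (2 powr p / p * real n powr (2 / p - 1)) \<le> var_lp_norm n (ereal p)"
proof -
  let ?T = "2 powr p / p * real n powr (2 / p - 1)"
  have n0: "0 < real n" "1 \<le> real n" using n by auto
  note m = typ_norm_facts[OF n0(1) p(1)]
  define m' where "m' = typ_norm (real n) p"
  define M where "M = sqrt (2 * p)"
  have M2: "M\<^sup>2 = 2 * p" using p by (simp add: M_def)
  have M1: "1 \<le> M" using p by (simp add: M_def)
  have Mm: "M \<le> m'"
  proof -
    have "2 * exp 1 * (p / exp 1) \<le> real n powr (2 / p) * (p / exp 1)"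
      using first_regime_size(2)[OF n0(2) p] p by (intro mult_right_mono) auto
    then have "M\<^sup>2 \<le> m'\<^sup>2" unfolding M2 m'_def m(2) by simp
    then show ?thesis by (rule power2_le_imp_le) (use m in \<open>simp add: m'_def\<close>)
  qed
  have m0: "0 < m'" using m by (simp add: m'_def)
  define l where "l = (m' / (4 * p))\<^sup>2 * (M / m') powr (2 * p) * (1 / 54 * exp (- M\<^sup>2 / 2) * (M / (M + 2 * p - M\<^sup>2)))"
  have l0: "0 \<le> l" using M1 M2 p by (auto simp: l_def intro!: mult_nonneg_nonneg)
  have l: "ennreal l \<le> gap_energy p (m' powr p)"
    unfolding l_def using M1 Mm M2 p(1) by (intro gap_energy_ge_window) auto
  have "1 / 3072 * (real n * l) \<le> var_lp_norm n (ereal p)"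
    using l l0 by (intro var_lower_from_gap_energy[OF n p(1)]) (auto simp: m'_def)
  moreover have "1 / 10000000 * ?T \<le> 1 / 3072 * (real n * l)"
  proof -
    have Mpow: "(M / m') powr (2 * p) * exp (- M\<^sup>2 / 2) = m' powr (- 2 * p) * (2 * p / exp 1) powr p"
    proof -
      have "M powr (2 * p) = (2 * p) powr p"
        using p by (simp add: M_def powr_half_sqrt[symmetric] powr_powr)
      moreover have "exp (- M\<^sup>2 / 2) = 1 / (exp 1) powr p" using p by (simp add: M2 exp_powr_real exp_minus field_simps)
      ultimately show ?thesis using M1 m0 p by (simp add: powr_divide powr_minus_divide)
    qed
    have "l = 1 / 864 * ((m' / p)\<^sup>2 * ((M / m') powr (2 * p) * exp (- M\<^sup>2 / 2)))"
      unfolding l_def using M1 M2 by (simp add: power_divide power_mult_distrib)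
    then have "real n * l = 1 / 864 * (real n * ((m' / p)\<^sup>2 * m' powr (- 2 * p) * (2 * p / exp 1) powr p))"
      unfolding Mpow by simp
    also have "\<dots> = 1 / 864 * ((1 / exp 1) * ?T)"
      unfolding m'_def typ_norm_moment_term[OF n0(1) p(1)] by simp
    also have "(1 / 3) * ?T \<le> (1 / exp 1) * ?T"
      using exp_le p by (intro mult_right_mono divide_left_mono) auto
    then have "1 / 864 * ((1 / 3) * ?T) \<le> 1 / 864 * ((1 / exp 1) * ?T)" by (intro mult_left_mono) auto
    finally have a: "1 / 864 * ((1 / 3) * ?T) \<le> real n * l" by simp
    have "0 \<le> ?T" using p by simp
    moreover have "1 / 10000000 * t \<le> 1 / 3072 * y" if "1 / 864 * ((1 / 3) * t) \<le> y" "0 \<le> t" for t y :: real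
      using that by linarith
    ultimately show ?thesis using a by blast
  qed
  ultimately show ?thesis by linarith
qed

context large_dimension
begin

lemma var_lower_second_regime:
  assumes p: "1 \<le> p" "2 * ln (real n) / ln (2 * exp 1) \<le> p" "p \<le> \<xi>\<^sup>2"
  shows "1 / 400000000 * (exp (- (p / (2 * exp 1)) * real n powr (2 / p) + ln (real n)) /
    (sqrt (ln (real n)) * (sqrt (ln (real n)) + p - 2 * ln (real n) / ln (2 * exp 1)))) \<le> var_lp_norm n (ereal p)"
proof -
  define M where "M = typ_norm (real n) p"
  define s where "s = sqrt (ln (real n))"
  define d where "d = p - 2 * ln (real n) / ln (2 * exp 1)"
  note f = second_regime_facts[OF p, folded M_def s_def d_def]
  define V where "V = real n * exp (- M\<^sup>2 / 2) / (s * (s + d))"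
  have V_eq: "exp (- (p / (2 * exp 1)) * real n powr (2 / p) + ln (real n)) /
    (sqrt (ln (real n)) * (sqrt (ln (real n)) + p - 2 * ln (real n) / ln (2 * exp 1))) = V"
    unfolding second_regime_value[OF p(1)] V_def M_def s_def d_def by (simp add: algebra_simps)
  have s0: "0 < s" and d0: "0 \<le> d" and M0: "0 < M" using f by auto
  have p0: "0 < p" using p by simp
  have V0: "0 \<le> V" using s0 d0 n_pos by (simp add: V_def)
  define D where "D = M + 2 * p - M\<^sup>2"
  have D0: "0 < D" using f(2) M0 by (simp add: D_def)
  define l where "l = (M / (4 * p))\<^sup>2 * (M / M) powr (2 * p) * (1 / 54 * exp (- M\<^sup>2 / 2) * (M / (M + 2 * p - M\<^sup>2)))"
  have l0: "0 \<le> l" using D0 M0 by (auto simp: l_def D_def intro!: mult_nonneg_nonneg)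
  have l: "ennreal l \<le> gap_energy p (M powr p)"
    unfolding l_def using f p by (intro gap_energy_ge_window) auto
  have "1 / 3072 * (real n * l) \<le> var_lp_norm n (ereal p)"
    using l l0 by (intro var_lower_from_gap_energy[OF n p(1)]) (auto simp: M_def)
  moreover have "1 / 400000000 * V \<le> 1 / 3072 * (real n * l)"
  proof -
    have "1 / (4 * s) \<le> M / p"
    proof -
      have "(s / 2) / (2 * s\<^sup>2) \<le> M / p" using f(5,8) s0 p0 M0 by (intro frac_le) auto
      then show ?thesis using s0 by (simp add: power2_eq_square)
    qed
    then have a: "(1 / (4 * s))\<^sup>2 \<le> (M / p)\<^sup>2" using s0 by (intro power_mono) auto
    have "D \<le> 2 * s + 4 * d" using f(4,6) by (simp add: D_def)
    then have "D \<le> 4 * (s + d)" using s0 by simp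
    then have b: "(s / 2) / (4 * (s + d)) \<le> M / D" using f(5) D0 s0 d0 M0 by (intro frac_le) auto
    have ab: "(1 / (4 * s))\<^sup>2 * ((s / 2) / (4 * (s + d))) \<le> (M / p)\<^sup>2 * (M / D)"
      using a b s0 d0 by (intro mult_mono) auto
    have K: "(1 / (4 * s))\<^sup>2 * ((s / 2) / (4 * t)) = 1 / 128 * (1 / (s * t))" if "0 < t" for t
      using s0 that by (simp add: power2_eq_square field_simps)
    have "0 < s + d" using s0 d0 by simp
    then have c: "1 / 128 * (1 / (s * (s + d))) \<le> (M / p)\<^sup>2 * (M / D)"
      using ab unfolding K[OF \<open>0 < s + d\<close>] by simp
    have "real n * l = 1 / 864 * (real n * exp (- M\<^sup>2 / 2)) * ((M / p)\<^sup>2 * (M / D))"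
      unfolding l_def D_def[symmetric] using M0 by (simp add: power_divide power_mult_distrib)
    also have "\<dots> \<ge> 1 / 864 * (real n * exp (- M\<^sup>2 / 2)) * (1 / 128 * (1 / (s * (s + d))))"
      using c by (intro mult_left_mono) auto
    finally have "1 / 110592 * V \<le> real n * l" by (simp add: V_def)
    moreover have "1 / 400000000 * t \<le> 1 / 3072 * y" if "1 / 110592 * t \<le> y" "0 \<le> t" for t y :: real
      using that by linarith
    ultimately show ?thesis using V0 by blast
  qed
  ultimately show ?thesis unfolding V_eq by linarith
qed

text \<open>A truncation level that is exceeded by some coordinate only with small probability, but which is
still within \<open>O(1 / \<xi>)\<close> of \<open>\<xi>\<close>; the number \<open>8\<close> makes the probability at most \<open>1 / 4\<close>.\<close>

lemma outlier_facts:
  defines "R \<equiv> \<xi> + 8 / \<xi>"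
  shows "\<xi> \<le> R" "R \<le> 2 * \<xi>" "R\<^sup>2 \<le> 3/2 * \<xi>\<^sup>2" "real n * exp (- R\<^sup>2 / 2) \<le> 16 * \<xi>" "gtail R \<le> 1 / (4 * real n)"
proof -
  have x0: "0 < \<xi>" using xi by simp
  have x2: "100 \<le> \<xi>\<^sup>2" using power_mono[OF xi, of 2] by simp
  show R1: "\<xi> \<le> R" using x0 by (simp add: R_def)
  have R2: "R\<^sup>2 = \<xi>\<^sup>2 + 16 + 64 / \<xi>\<^sup>2" using x0 by (simp add: R_def power2_eq_square field_simps)
  have "64 / \<xi>\<^sup>2 \<le> 64 / 100" using x2 by (intro divide_left_mono) auto
  then have R3: "R\<^sup>2 \<le> \<xi>\<^sup>2 + 17" unfolding R2 by simp
  then show R4: "R\<^sup>2 \<le> 3/2 * \<xi>\<^sup>2" using x2 by simp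
  have "a \<le> 4 * b" if "a \<le> 3/2 * b" "0 \<le> b" for a b :: real using that by linarith
  from this[OF R4] have "R\<^sup>2 \<le> (2 * \<xi>)\<^sup>2" unfolding power_mult_distrib by simp
  then show "R \<le> 2 * \<xi>" by (rule power2_le_imp_le) (use x0 in simp)
  have "0 \<le> 64 / \<xi>\<^sup>2" by simp
  then have e: "exp (- R\<^sup>2 / 2) \<le> exp (- \<xi>\<^sup>2 / 2) * exp (- 8)"
    unfolding R2 by (simp add: exp_add[symmetric])
  have one: "exp (\<xi>\<^sup>2 / 2) * exp (- \<xi>\<^sup>2 / 2) = 1" by (simp flip: exp_add)
  have "real n * exp (- R\<^sup>2 / 2) \<le> (16 * \<xi> * exp (\<xi>\<^sup>2 / 2)) * (exp (- \<xi>\<^sup>2 / 2) * exp (- 8))"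
    using n_le e x0 by (intro mult_mono) auto
  also have "\<dots> = 16 * \<xi> * exp (- 8) * (exp (\<xi>\<^sup>2 / 2) * exp (- \<xi>\<^sup>2 / 2))" by simp
  finally have ne: "real n * exp (- R\<^sup>2 / 2) \<le> 16 * \<xi> * exp (- 8)" unfolding one by simp
  have "(2::real) ^ 8 \<le> exp 1 ^ 8" using exp_ge_add_one_self[of 1] by (intro power_mono) auto
  also have "\<dots> = exp (8::real)" by (simp flip: exp_of_nat_mult)
  finally have e8: "exp (- 8 :: real) \<le> 1 / 256" by (simp add: exp_minus field_simps)
  then have "16 * \<xi> * exp (- 8) \<le> 16 * \<xi> * (1 / 256)" using x0 by (intro mult_left_mono) auto
  then have ne': "real n * exp (- R\<^sup>2 / 2) \<le> \<xi> / 16" using ne by simp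
  then show "real n * exp (- R\<^sup>2 / 2) \<le> 16 * \<xi>" using x0 by simp
  have "gtail R \<le> exp (- R\<^sup>2 / 2) / R" using R1 x0 by (intro gtail_le) auto
  also have "\<dots> \<le> exp (- R\<^sup>2 / 2) / \<xi>" using R1 x0 by (intro divide_left_mono) auto
  finally have "real n * gtail R \<le> real n * (exp (- R\<^sup>2 / 2) / \<xi>)" by (intro mult_left_mono) auto
  also have "\<dots> \<le> (\<xi> / 16) / \<xi>" using ne' x0 by (simp add: divide_right_mono)
  finally have "real n * gtail R \<le> 1 / 4" using x0 by simp
  then show "gtail R \<le> 1 / (4 * real n)" using n_pos by (simp add: field_simps)
qed

lemma median_from_truncated_moment:
  assumes p: "1 \<le> p" and S1: "0 < S1"
    and "gauss_int (\<lambda>x. \<bar>x\<bar> powr p * indicator {x. \<bar>x\<bar> \<le> \<xi> + 8 / \<xi>} x) \<le> ennreal (S1 / (4 * real n))"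
  shows "1/2 \<le> prob_upto p N (S1)"
proof (rule psum_median_le[OF p S1, where B = "{x. \<xi> + 8 / \<xi> \<le> \<bar>x\<bar>}" and ?c1.0 = "1 / (4 * real n)" and ?c2.0 = "1 / (4 * real n)"])
  have e: "1 / (4 * real n) + 1 / (4 * real n) = 1 / (2 * real n)" by simp
  show "real N * (1 / (4 * real n) + 1 / (4 * real n)) \<le> 1 / 2" unfolding e using n by simp
  show "gauss_int (\<lambda>x. indicator {x. \<xi> + 8 / \<xi> \<le> \<bar>x\<bar>} x) \<le> ennreal (1 / (4 * real n))"
    unfolding gauss_int_indicator_tail using outlier_facts(5) by (intro ennreal_leI) auto
  have "gauss_int (\<lambda>x. \<bar>x\<bar> powr p * indicator (- {x. \<xi> + 8 / \<xi> \<le> \<bar>x\<bar>}) x)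
    \<le> gauss_int (\<lambda>x. \<bar>x\<bar> powr p * indicator {x. \<bar>x\<bar> \<le> \<xi> + 8 / \<xi>} x)"
    by (intro nn_integral_mono ennreal_leI) (auto split: split_indicator)
  also note assms(3)
  finally show "gauss_int (\<lambda>x. \<bar>x\<bar> powr p * indicator (- {x. \<xi> + 8 / \<xi> \<le> \<bar>x\<bar>}) x)
    \<le> ennreal (1 / (4 * real n) * S1)" by simp
qed auto

lemma var_lower_from_median:
  assumes p: "1 \<le> p" and S1: "0 < S1"
    and med: "1/2 \<le> prob_upto p N (S1)"
    and l: "0 \<le> l" "ennreal l \<le> gap_energy p S1"
  shows "real n * l \<le> 192 * var_lp_norm n (ereal p)"
proof -
  have "ennreal (real n * l) = ennreal (real n) * ennreal l" by (rule ennreal_mult') simp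
  also have "\<dots> \<le> of_nat (Suc N) * gap_energy p S1"
    unfolding n ennreal_of_nat_eq_real_of_nat using l by (intro mult_left_mono) auto
  also have "\<dots> \<le> ennreal (192 * var_lp_norm n (ereal p))"
    unfolding n using S1 med p by (intro var_lp_norm_ge) auto
  finally have "ennreal (real n * l) \<le> ennreal (192 * var_lp_norm n (ereal p))" .
  moreover have "0 \<le> var_lp_norm n (ereal p)" unfolding var_lp_norm_def by simp
  ultimately show ?thesis by (subst (asm) ennreal_le_iff) auto
qed

lemma truncated_powr_moment:
  assumes R: "0 < R" "R\<^sup>2 \<le> p"
  shows "gauss_int (\<lambda>x. \<bar>x\<bar> powr p * indicator {x. \<bar>x\<bar> \<le> R} x)
    \<le> ennreal (R powr p * (2 * exp (- R\<^sup>2 / 2) * (R / (R + p - R\<^sup>2))))"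
proof -
  have "gauss_int (\<lambda>x. \<bar>x\<bar> powr p * indicator {x. \<bar>x\<bar> \<le> R} x)
    = (\<integral>\<^sup>+x. ennreal (R powr p) * ennreal ((\<bar>x\<bar> / R) powr p * indicator {x. \<bar>x\<bar> \<le> R} x) \<partial>std_gaussian)"
  proof (intro nn_integral_cong)
    fix x :: real
    have e: "\<bar>x\<bar> powr p * indicator {x. \<bar>x\<bar> \<le> R} x = R powr p * ((\<bar>x\<bar> / R) powr p * indicator {x. \<bar>x\<bar> \<le> R} x)"
      using R by (simp add: powr_divide)
    show "ennreal (\<bar>x\<bar> powr p * indicator {x. \<bar>x\<bar> \<le> R} x) = ennreal (R powr p) * ennreal ((\<bar>x\<bar> / R) powr p * indicator {x. \<bar>x\<bar> \<le> R} x)"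
      unfolding e by (rule ennreal_mult') simp
  qed
  also have "\<dots> = ennreal (R powr p) * gauss_int (\<lambda>x. (\<bar>x\<bar> / R) powr p * indicator {x. \<bar>x\<bar> \<le> R} x)"
    by (rule nn_integral_cmult) measurable
  also have "\<dots> \<le> ennreal (R powr p) * ennreal (2 * exp (- R\<^sup>2 / 2) * (R / (R + p - R\<^sup>2)))"
    by (intro mult_left_mono truncated_moment_upper R) auto
  also have "\<dots> = ennreal (R powr p * (2 * exp (- R\<^sup>2 / 2) * (R / (R + p - R\<^sup>2))))"
    by (rule ennreal_mult'[symmetric]) simp
  finally show ?thesis .
qed

text \<open>The sum truncated slightly above \<open>\<xi>\<close> still has mean of order \<open>\<xi> powr p / w\<close>, since \<open>(1 + 8 / \<xi>\<^sup>2) powr p\<close> is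
bounded. A coordinate above \<open>M\<close> has probability of order \<open>w / n\<close> and moves the norm by order \<open>M / p\<close>, that is
\<open>1 / \<xi>\<close>.\<close>

lemma var_lower_third_regime_near:
  assumes p: "\<xi>\<^sup>2 \<le> p" "p \<le> 2 * \<xi>\<^sup>2"
  shows "1 / (10^8 * (4 * (32 + exp 16))\<^sup>2) * (1 / ln (real n) * (1 - (\<xi>\<^sup>2 - \<xi>) / p)) \<le> var_lp_norm n (ereal p)"
proof -
  define w where "w = 1 - (\<xi>\<^sup>2 - \<xi>) / p"
  define M where "M = \<xi> * w powr (- (1 / p))"
  note f = third_regime_facts[OF p, folded w_def, folded M_def]
  define R where "R = \<xi> + 8 / \<xi>"
  note r = outlier_facts[folded R_def]
  have x0: "0 < \<xi>" using xi by simp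
  have M0: "0 < M" using f(5) x0 by simp
  have p0: "0 < p" using f(11) by simp
  \<comment> \<open>\<open>32\<close> bounds the part of the truncated mean below \<open>\<xi>\<close>, and \<open>exp 16\<close> the part between \<open>\<xi>\<close> and \<open>R\<close>\<close>
  define C1 where "C1 = 32 + exp (16::real)"
  have C1: "0 < C1" "1 \<le> 4 * C1" by (auto simp: C1_def intro: add_pos_pos)
  define S1 where "S1 = 4 * C1 * M powr p"
  have S1: "0 < S1" using C1 M0 by (simp add: S1_def)
  have "gauss_int (\<lambda>x. \<bar>x\<bar> powr p * indicator {x. \<bar>x\<bar> \<le> R} x)
    \<le> (\<integral>\<^sup>+x. ennreal (\<bar>x\<bar> powr p * indicator {x. \<bar>x\<bar> \<le> \<xi>} x) + ennreal (R powr p) * ennreal (indicator {x. \<xi> \<le> \<bar>x\<bar>} x) \<partial>std_gaussian)"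
  proof (intro nn_integral_mono)
    fix x :: real
    show "ennreal (\<bar>x\<bar> powr p * indicator {x. \<bar>x\<bar> \<le> R} x)
      \<le> ennreal (\<bar>x\<bar> powr p * indicator {x. \<bar>x\<bar> \<le> \<xi>} x) + ennreal (R powr p) * ennreal (indicator {x. \<xi> \<le> \<bar>x\<bar>} x)"
    proof (cases "\<bar>x\<bar> \<le> \<xi>")
      case True
      then show ?thesis using r(1) by (intro add_increasing2) (auto split: split_indicator)
    next
      case False
      then show ?thesis using p0
        by (auto split: split_indicator intro!: ennreal_leI powr_mono2)
    qed
  qed
  also have "\<dots> = gauss_int (\<lambda>x. \<bar>x\<bar> powr p * indicator {x. \<bar>x\<bar> \<le> \<xi>} x)
      + (\<integral>\<^sup>+x. ennreal (R powr p) * ennreal (indicator {x. \<xi> \<le> \<bar>x\<bar>} x) \<partial>std_gaussian)"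
    by (rule nn_integral_add) measurable
  also have "(\<integral>\<^sup>+x. ennreal (R powr p) * ennreal (indicator {x. \<xi> \<le> \<bar>x\<bar>} x) \<partial>std_gaussian)
      = ennreal (R powr p) * gauss_int (\<lambda>x. indicator {x. \<xi> \<le> \<bar>x\<bar>} x)"
    by (rule nn_integral_cmult) measurable
  also have "\<dots> = ennreal (R powr p) * ennreal (1 / real n)" by (simp only: gauss_int_indicator_tail tail)
  also have "gauss_int (\<lambda>x. \<bar>x\<bar> powr p * indicator {x. \<bar>x\<bar> \<le> \<xi>} x) + ennreal (R powr p) * ennreal (1 / real n)
      \<le> ennreal (\<xi> powr p * (2 * exp (- \<xi>\<^sup>2 / 2) * (\<xi> / (\<xi> + p - \<xi>\<^sup>2)))) + ennreal (R powr p * (1 / real n))"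
    using truncated_powr_moment[OF x0 p(1)]
    by (intro add_mono order.refl eq_refl[OF ennreal_mult'[symmetric]]) auto
  also have "\<dots> = ennreal (\<xi> powr p * (2 * exp (- \<xi>\<^sup>2 / 2) * (\<xi> / (\<xi> + p - \<xi>\<^sup>2))) + R powr p * (1 / real n))"
    using p x0 by (intro ennreal_plus[symmetric]) (auto intro!: mult_nonneg_nonneg divide_nonneg_nonneg)
  also have "\<dots> \<le> ennreal (S1 / (4 * real n))"
  proof (rule ennreal_leI)
    have one: "exp (\<xi>\<^sup>2 / 2) * exp (- \<xi>\<^sup>2 / 2) = 1" by (simp flip: exp_add)
    have pw: "0 < p * w" using p0 f(1) by simp
    have "real n * (\<xi> powr p * (2 * exp (- \<xi>\<^sup>2 / 2) * (\<xi> / (p * w))))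
      \<le> (16 * \<xi> * exp (\<xi>\<^sup>2 / 2)) * (\<xi> powr p * (2 * exp (- \<xi>\<^sup>2 / 2) * (\<xi> / (p * w))))"
      using n_le pw x0 by (intro mult_right_mono) auto
    also have "\<dots> = 32 * \<xi> powr p * (\<xi>\<^sup>2 / (p * w)) * (exp (\<xi>\<^sup>2 / 2) * exp (- \<xi>\<^sup>2 / 2))"
      by (simp add: power2_eq_square)
    also have "\<dots> = 32 * (\<xi> powr p / w) * (\<xi>\<^sup>2 / p)" unfolding one by simp
    also have "\<dots> \<le> 32 * (\<xi> powr p / w) * 1" using p p0 f(1) by (intro mult_left_mono) auto
    finally have a: "real n * (\<xi> powr p * (2 * exp (- \<xi>\<^sup>2 / 2) * (\<xi> / (p * w)))) \<le> 32 * (\<xi> powr p / w)" by simp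
    have b: "R powr p \<le> exp 16 * (\<xi> powr p / w)"
    proof -
      have "R = \<xi> * (1 + 8 / \<xi>\<^sup>2)" using x0 by (simp add: R_def power2_eq_square field_simps)
      also have "\<dots> \<le> \<xi> * exp (8 / \<xi>\<^sup>2)"
        using exp_ge_add_one_self[of "8 / \<xi>\<^sup>2"] x0 by (intro mult_left_mono) (auto simp: add.commute)
      finally have "R powr p \<le> (\<xi> * exp (8 / \<xi>\<^sup>2)) powr p" using r(1) x0 p0 by (intro powr_mono2) auto
      also have "\<dots> = exp (8 / \<xi>\<^sup>2 * p) * \<xi> powr p" by (simp add: powr_mult exp_powr_real)
      also have "\<dots> \<le> exp 16 * (\<xi> powr p / w)"
      proof (intro mult_mono)
        have "8 / \<xi>\<^sup>2 * p \<le> 8 / \<xi>\<^sup>2 * (2 * \<xi>\<^sup>2)" using p by (intro mult_left_mono) auto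
        then show "exp (8 / \<xi>\<^sup>2 * p) \<le> exp 16" using x0 by simp
        show "\<xi> powr p \<le> \<xi> powr p / w" using f(1,2) by (simp add: le_divide_eq mult_left_le)
      qed auto
      finally show ?thesis .
    qed
    have "real n * (\<xi> powr p * (2 * exp (- \<xi>\<^sup>2 / 2) * (\<xi> / (\<xi> + p - \<xi>\<^sup>2))) + R powr p * (1 / real n))
      = real n * (\<xi> powr p * (2 * exp (- \<xi>\<^sup>2 / 2) * (\<xi> / (p * w)))) + R powr p"
      unfolding f(3) using n_pos by (simp add: distrib_left)
    also have "\<dots> \<le> 32 * (\<xi> powr p / w) + exp 16 * (\<xi> powr p / w)" by (intro add_mono a b)
    also have "\<dots> = real n * (S1 / (4 * real n))"
      using n_pos f(1) by (simp add: S1_def C1_def f(8) field_simps)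
    finally show "\<xi> powr p * (2 * exp (- \<xi>\<^sup>2 / 2) * (\<xi> / (\<xi> + p - \<xi>\<^sup>2))) + R powr p * (1 / real n) \<le> S1 / (4 * real n)"
      using n_pos by (simp only: mult_le_cancel_left_pos)
  qed
  finally have "gauss_int (\<lambda>x. \<bar>x\<bar> powr p * indicator {x. \<bar>x\<bar> \<le> R} x) \<le> ennreal (S1 / (4 * real n))" .
  then have med: "1/2 \<le> prob_upto p N (S1)"
    unfolding R_def by (intro median_from_truncated_moment f(11) S1)
  define l0 where "l0 = (M / (4 * p))\<^sup>2 * gtail M"
  define l where "l = l0 / (4 * C1)\<^sup>2"
  have g0: "0 \<le> gtail M" by (simp add: gtail_def)
  have l0: "ennreal l0 \<le> gap_energy p (M powr p)"
  proof -
    have M_half: "1 / 2 \<le> M" using f(5) xi by simp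
    have "m / (4 * p) * (\<bar>M\<bar> / m) powr p \<le> root_gap p (m powr p) M" if "m = M" for m
      using that M_half M0 f(11) by (intro root_gap_ge) auto
    from this[of M] have "M / (4 * p) \<le> root_gap p (M powr p) M" using M0 by simp
    then show ?thesis unfolding l0_def using M0 p0 M_half f(11) by (intro gap_energy_ge_tail) auto
  qed
  have l_nonneg: "0 \<le> l" using g0 by (simp add: l_def l0_def)
  have l: "ennreal l \<le> gap_energy p S1"
  proof -
    have "ennreal l0 \<le> gap_energy p (1 / (4 * C1) * S1)" using l0 C1 by (simp add: S1_def)
    also have "\<dots> \<le> ennreal (1 / (1 / (4 * C1))\<^sup>2) * gap_energy p S1"
      using C1 S1 f(11) by (intro gap_energy_scale) auto
    finally have 1: "ennreal l0 \<le> ennreal ((4 * C1)\<^sup>2) * gap_energy p S1" by (simp add: power_divide)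
    have "ennreal l = ennreal (1 / (4 * C1)\<^sup>2) * ennreal l0" unfolding l_def by (subst ennreal_mult'[symmetric]) auto
    also have "\<dots> \<le> ennreal (1 / (4 * C1)\<^sup>2) * (ennreal ((4 * C1)\<^sup>2) * gap_energy p S1)" by (intro mult_left_mono 1) simp
    also have "\<dots> = (ennreal (1 / (4 * C1)\<^sup>2) * ennreal ((4 * C1)\<^sup>2)) * gap_energy p S1" by (simp only: mult.assoc)
    also have "ennreal (1 / (4 * C1)\<^sup>2) * ennreal ((4 * C1)\<^sup>2) = 1"
      using C1 by (subst ennreal_mult'[symmetric]) auto
    finally show ?thesis by simp
  qed
  have main: "real n * l \<le> 192 * var_lp_norm n (ereal p)"
    by (rule var_lower_from_median[OF f(11) S1 med l_nonneg l])
  have L0: "0 < ln (real n)" using n_ge_10 by simp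
  have x2: "0 < \<xi>\<^sup>2" using x0 by simp
  have "1 / 64 * (1 / ln (real n) * w) * (1 / 4096) \<le> real n * l0"
  proof -
    have tail_ge: "w / 64 \<le> real n * gtail M"
    proof -
      have "exp (\<xi>\<^sup>2 / 2) * exp (- \<xi>\<^sup>2 / 2) = 1" by (simp flip: exp_add)
      then have "w / 64 = (\<xi> * exp (\<xi>\<^sup>2 / 2)) * ((w / 2 * exp (- \<xi>\<^sup>2 / 2)) / (16 * (2 * \<xi>)))" using x0 by simp
      also have "\<dots> \<le> real n * (exp (- M\<^sup>2 / 2) / (16 * M))"
        using n_ge f(1,6,10) x0 M0 by (intro mult_mono frac_le) auto
      also have "\<dots> \<le> real n * gtail M"
        using f(5) xi by (intro mult_left_mono gtail_ge) auto
      finally show ?thesis .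
    qed
    have "1 / (8 * \<xi>) \<le> M / (4 * p)"
    proof -
      have "\<xi> / (4 * (2 * \<xi>\<^sup>2)) \<le> M / (4 * p)" using f(5) p p0 x0 by (intro frac_le) auto
      then show ?thesis using x0 by (simp add: power2_eq_square)
    qed
    then have sq: "(1 / (8 * \<xi>))\<^sup>2 \<le> (M / (4 * p))\<^sup>2" using x0 by (intro power_mono) auto
    have "(1 / (8 * \<xi>))\<^sup>2 * (w / 64) \<le> (M / (4 * p))\<^sup>2 * (real n * gtail M)"
      using sq tail_ge f(1) by (intro mult_mono) auto
    then have A: "1 / 4096 * (w / \<xi>\<^sup>2) \<le> real n * l0"
      by (simp add: l0_def power_divide power_mult_distrib mult_ac)
    have "1 / ln (real n) \<le> 2 / \<xi>\<^sup>2"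
    proof -
      have "1 / ln (real n) \<le> 1 / (\<xi>\<^sup>2 / 2)"
        using ln_n_ge L0 x0 by (intro divide_left_mono mult_pos_pos) auto
      then show ?thesis by simp
    qed
    then have "1 / ln (real n) * w \<le> 2 / \<xi>\<^sup>2 * w" using f(1) by (intro mult_right_mono) auto
    then have B: "1 / ln (real n) * w \<le> 2 * (w / \<xi>\<^sup>2)" by simp
    have "1 / 64 * a * (1 / 4096) \<le> y" if "1 / 4096 * b \<le> y" "a \<le> 2 * b" "0 \<le> b" for a b y :: real
      using that by linarith
    from this[OF A B] show ?thesis using f(1) by simp
  qed
  then have "1 / (4 * C1)\<^sup>2 * (1 / 64 * (1 / ln (real n) * w) * (1 / 4096)) \<le> 1 / (4 * C1)\<^sup>2 * (real n * l0)"
    by (intro mult_left_mono) auto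
  also have "\<dots> = real n * l" by (simp add: l_def)
  also note main
  finally have fin: "1 / (4 * C1)\<^sup>2 * (1 / ln (real n) * w) * (1 / 262144) \<le> 192 * var_lp_norm n (ereal p)" by simp
  have nonneg: "0 \<le> 1 / (4 * C1)\<^sup>2 * (1 / ln (real n) * w)" using f(1) L0 by simp
  have "1 / 10^8 * a \<le> v" if "a * (1 / 262144) \<le> 192 * v" "0 \<le> a" for a v :: real using that by simp
  from this[OF fin nonneg] show ?thesis unfolding w_def C1_def by simp
qed

text \<open>For large \<open>p\<close> the norm is essentially the maximum: its median is at most \<open>\<xi> + 22 / \<xi>\<close>, and a coordinate
above \<open>\<xi> + 23 / \<xi>\<close> increases it by at least \<open>1 / \<xi>\<close>.\<close>

lemma var_lower_third_regime_far:
  assumes p: "2 * \<xi>\<^sup>2 \<le> p"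
  shows "1 / (30000 * exp 26) * (1 / ln (real n) * (1 - (\<xi>\<^sup>2 - \<xi>) / p)) \<le> var_lp_norm n (ereal p)"
proof -
  define R where "R = \<xi> + 8 / \<xi>"
  note r = outlier_facts[folded R_def]
  have x0: "0 < \<xi>" using xi by simp
  have x2: "100 \<le> \<xi>\<^sup>2" using power_mono[OF xi, of 2] by simp
  have p1: "1 \<le> p" and p0: "0 < p" and p200: "200 \<le> p" using p x2 by auto
  have R0: "0 < R" using r(1) x0 by simp
  have Rp: "R\<^sup>2 \<le> p" using r(3) p zero_le_power2[of \<xi>] by linarith
  have den: "\<xi>\<^sup>2 / 2 \<le> R + p - R\<^sup>2" using r(3) p R0 by linarith
  define S1 where "S1 = 512 * R powr p"
  have S1: "0 < S1" using R0 by (simp add: S1_def)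
  have "gauss_int (\<lambda>x. \<bar>x\<bar> powr p * indicator {x. \<bar>x\<bar> \<le> R} x)
    \<le> ennreal (R powr p * (2 * exp (- R\<^sup>2 / 2) * (R / (R + p - R\<^sup>2))))"
    by (rule truncated_powr_moment[OF R0 Rp])
  also have "\<dots> \<le> ennreal (S1 / (4 * real n))"
  proof (rule ennreal_leI)
    have "R / (R + p - R\<^sup>2) \<le> (2 * \<xi>) / (\<xi>\<^sup>2 / 2)" using den r(2) R0 x0 by (intro frac_le) auto
    also have "\<dots> = 4 / \<xi>" using x0 by (simp add: power2_eq_square)
    finally have a: "R / (R + p - R\<^sup>2) \<le> 4 / \<xi>" .
    have "real n * (R powr p * (2 * exp (- R\<^sup>2 / 2) * (R / (R + p - R\<^sup>2))))
        = 2 * R powr p * ((real n * exp (- R\<^sup>2 / 2)) * (R / (R + p - R\<^sup>2)))" by simp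
    also have "\<dots> \<le> 2 * R powr p * ((16 * \<xi>) * (4 / \<xi>))"
    proof (rule mult_left_mono)
      have "0 \<le> R + p - R\<^sup>2" using den x2 by linarith
      then show "(real n * exp (- R\<^sup>2 / 2)) * (R / (R + p - R\<^sup>2)) \<le> (16 * \<xi>) * (4 / \<xi>)"
        using R0 x0 by (intro mult_mono[OF r(4) a]) auto
    qed simp
    also have "\<dots> = real n * (S1 / (4 * real n))" using n_pos x0 by (simp add: S1_def)
    finally show "R powr p * (2 * exp (- R\<^sup>2 / 2) * (R / (R + p - R\<^sup>2))) \<le> S1 / (4 * real n)"
      using n_pos by (simp only: mult_le_cancel_left_pos)
  qed
  finally have med: "1/2 \<le> prob_upto p N (S1)"
    unfolding R_def by (intro median_from_truncated_moment p1 S1)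
  define T where "T = \<xi> + 23 / \<xi>"
  have T0: "1 \<le> T" using xi by (simp add: T_def add_increasing2)
  have d: "1 / \<xi> \<le> root_gap p S1 T"
  proof -
    have "(1/4) powr p \<le> R powr p" using r(1) xi p0 by (intro powr_mono2) auto
    moreover have "0 \<le> R powr p" by simp
    ultimately have "S1 + (1/4) powr p \<le> 1024 * R powr p" unfolding S1_def by linarith
    then have "(S1 + (1/4) powr p) powr (1 / p) \<le> (1024 * R powr p) powr (1 / p)"
      using p0 S1 by (intro powr_mono2) auto
    also have "\<dots> = 1024 powr (1 / p) * R" using R0 p0 by (simp add: powr_mult powr_powr)
    also have "\<dots> \<le> (1 + 14 / p) * R"
    proof (rule mult_right_mono)
      have "ln (1024::real) = 10 * ln 2" using ln_realpow[of 2 10] by simp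
      also have "\<dots> \<le> 7" using ln2_le_25_over_36 by simp
      finally have l7: "ln (1024::real) \<le> 7" .
      have "1024 powr (1 / p) = exp (ln 1024 / p)" by (simp add: powr_def)
      also have "\<dots> \<le> exp (7 / p)" using l7 p0 by (simp add: divide_right_mono)
      also have "\<dots> \<le> 1 + 7 / p + (7 / p)\<^sup>2" using p200 by (intro exp_bound) auto
      also have "(7 / p)\<^sup>2 \<le> 7 / p * 1" unfolding power2_eq_square using p200 by (intro mult_left_mono) auto
      finally show "1024 powr (1 / p) \<le> 1 + 14 / p" by simp
    qed (use R0 in simp)
    also have "\<dots> = R + 14 * R / p" by (simp add: algebra_simps)
    also have "\<dots> \<le> (\<xi> + 8 / \<xi>) + 14 / \<xi>"
    proof (intro add_mono)
      have "14 * R / p \<le> 14 * (2 * \<xi>) / (2 * \<xi>\<^sup>2)" using r(2) p R0 x0 by (intro frac_le) auto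
      then show "14 * R / p \<le> 14 / \<xi>" using x0 by (simp add: power2_eq_square)
    qed (simp add: R_def)
    finally have 1: "(S1 + (1/4) powr p) powr (1 / p) \<le> \<xi> + 22 / \<xi>" using x0 by (simp add: field_simps)
    have "T = (T powr p) powr (1 / p)" using T0 p0 by (simp add: powr_powr)
    also have "\<dots> \<le> (S1 + \<bar>T\<bar> powr p) powr (1 / p)" using S1 T0 p0 by (intro powr_mono2) auto
    finally have "T - (\<xi> + 22 / \<xi>) \<le> root_gap p S1 T" unfolding root_gap_def using 1 by simp
    moreover have "T - (\<xi> + 22 / \<xi>) = 1 / \<xi>" using x0 by (simp add: T_def field_simps)
    ultimately show ?thesis by simp
  qed
  define l where "l = (1 / \<xi>)\<^sup>2 * gtail T"
  have l_nonneg: "0 \<le> l" by (simp add: l_def gtail_def)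
  have l: "ennreal l \<le> gap_energy p S1"
    unfolding l_def using d S1 T0 p1 x0 by (intro gap_energy_ge_tail) auto
  have main: "real n * l \<le> 192 * var_lp_norm n (ereal p)"
    by (rule var_lower_from_median[OF p1 S1 med l_nonneg l])
  have tail_ge: "exp (- 26) / 64 \<le> real n * gtail T"
  proof -
    have "T\<^sup>2 = \<xi>\<^sup>2 + 46 + 529 / \<xi>\<^sup>2" using x0 by (simp add: T_def power2_eq_square field_simps)
    moreover have "529 / \<xi>\<^sup>2 \<le> 529 / 100" using x2 by (intro divide_left_mono) auto
    ultimately have T2: "T\<^sup>2 \<le> \<xi>\<^sup>2 + 52" by simp
    then have e: "exp (- \<xi>\<^sup>2 / 2) * exp (- 26) \<le> exp (- T\<^sup>2 / 2)" by (simp flip: exp_add)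
    have "T\<^sup>2 \<le> (2 * \<xi>)\<^sup>2" using T2 x2 unfolding power_mult_distrib by simp
    then have T2x: "T \<le> 2 * \<xi>" by (rule power2_le_imp_le) (use x0 in simp)
    have "exp (\<xi>\<^sup>2 / 2) * exp (- \<xi>\<^sup>2 / 2) = 1" by (simp flip: exp_add)
    then have "exp (- 26) / 32 = (\<xi> * exp (\<xi>\<^sup>2 / 2)) * ((exp (- \<xi>\<^sup>2 / 2) * exp (- 26)) / (16 * (2 * \<xi>)))"
      using x0 by simp
    also have "\<dots> \<le> real n * (exp (- T\<^sup>2 / 2) / (16 * T))"
      using n_ge e T2x T0 x0 by (intro mult_mono frac_le) auto
    also have "\<dots> \<le> real n * gtail T" using T0 by (intro mult_left_mono gtail_ge) auto
    finally have "exp (- 26) / 32 \<le> real n * gtail T" .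
    moreover have "0 \<le> exp (- 26 :: real)" by simp
    ultimately show ?thesis by linarith
  qed
  have L0: "0 < ln (real n)" using n_ge_10 by simp
  have "1 / ln (real n) \<le> 1 / (\<xi>\<^sup>2 / 2)"
    using ln_n_ge L0 x0 by (intro divide_left_mono mult_pos_pos) auto
  then have "1 / ln (real n) * (1 - (\<xi>\<^sup>2 - \<xi>) / p) \<le> 2 / \<xi>\<^sup>2 * 1"
  proof (intro mult_mono)
    have "\<xi> \<le> \<xi>\<^sup>2" using xi by (simp add: power2_eq_square)
    then show "1 - (\<xi>\<^sup>2 - \<xi>) / p \<le> 1" using p0 by simp
    have "(\<xi>\<^sup>2 - \<xi>) / p \<le> 1" using p p0 x0 x2 by simp
    then show "0 \<le> 1 - (\<xi>\<^sup>2 - \<xi>) / p" by simp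
  qed auto
  then have A: "1 / ln (real n) * (1 - (\<xi>\<^sup>2 - \<xi>) / p) \<le> 2 * (1 / \<xi>\<^sup>2)" by simp
  have "(1 / \<xi>)\<^sup>2 * (exp (- 26) / 64) \<le> (1 / \<xi>)\<^sup>2 * (real n * gtail T)" by (intro mult_left_mono tail_ge) auto
  also have "\<dots> = real n * l" by (simp add: l_def)
  also note main
  finally have B: "exp (- 26) * (1 / \<xi>\<^sup>2) * (1 / 64) \<le> 192 * var_lp_norm n (ereal p)" by (simp add: power_divide)
  have "exp (- 26) * (1 / ln (real n) * (1 - (\<xi>\<^sup>2 - \<xi>) / p)) \<le> exp (- 26) * (2 * (1 / \<xi>\<^sup>2))"
    by (intro mult_left_mono A) auto
  then have "exp (- 26) * (1 / ln (real n) * (1 - (\<xi>\<^sup>2 - \<xi>) / p)) \<le> 2 * (exp (- 26) * (1 / \<xi>\<^sup>2))"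
    by (simp only: mult.left_commute)
  moreover have "1 / 30000 * a \<le> v" if "a \<le> 2 * b" "b * (1 / 64) \<le> 192 * v" "0 \<le> b" for a b v :: real
    using that by linarith
  ultimately have "1 / 30000 * (exp (- 26) * (1 / ln (real n) * (1 - (\<xi>\<^sup>2 - \<xi>) / p))) \<le> var_lp_norm n (ereal p)"
    using B by fastforce
  then show ?thesis by (simp add: exp_minus field_simps)
qed

end

section \<open>The maximum norm as a limit\<close>

lemma gtail_antimono: "r \<le> s \<Longrightarrow> gtail s \<le> gtail r"
proof -
  assume rs: "r \<le> s"
  interpret prob_space std_gaussian by (rule prob_space_std_gaussian)
  show ?thesis unfolding gtail_def
    by (rule finite_measure_mono) (use rs in \<open>auto cong: measurable_cong_sets\<close>)
qed

text \<open>The tail is closed in its definition, so the two boundary points have to be discarded.\<close>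

lemma gtail_eq:
  assumes "0 < \<xi>" "measure std_gaussian {g. \<bar>g\<bar> \<le> \<xi>} = 1 - 1 / real n"
  shows "gtail \<xi> = 1 / real n"
proof -
  interpret prob_space std_gaussian by (rule prob_space_std_gaussian)
  have "emeasure std_gaussian {\<xi>, - \<xi>} = (\<integral>\<^sup>+x. ennreal (std_normal_density x) * indicator {\<xi>, - \<xi>} x \<partial>lborel)"
    unfolding std_gaussian_def by (rule emeasure_density) auto
  also have "\<dots> = 0"
    by (rule nn_integral_null_set) (simp add: finite_imp_null_set_lborel)
  finally have null: "prob {\<xi>, - \<xi>} = 0" by (simp add: measure_def)
  have "{g. \<xi> \<le> \<bar>g\<bar>} = (UNIV - {g. \<bar>g\<bar> \<le> \<xi>}) \<union> ({\<xi>, - \<xi>} \<inter> {g. \<xi> \<le> \<bar>g\<bar>})"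
    using assms(1) by auto
  then have "gtail \<xi> = prob ((UNIV - {g. \<bar>g\<bar> \<le> \<xi>}) \<union> ({\<xi>, - \<xi>} \<inter> {g. \<xi> \<le> \<bar>g\<bar>}))"
    unfolding gtail_def by simp
  also have "\<dots> = prob (UNIV - {g. \<bar>g\<bar> \<le> \<xi>}) + prob ({\<xi>, - \<xi>} \<inter> {g. \<xi> \<le> \<bar>g\<bar>})"
    by (rule finite_measure_Union) (use assms(1) in auto)
  also have "prob ({\<xi>, - \<xi>} \<inter> {g. \<xi> \<le> \<bar>g\<bar>}) = 0"
  proof -
    have "prob ({\<xi>, - \<xi>} \<inter> {g. \<xi> \<le> \<bar>g\<bar>}) \<le> prob {\<xi>, - \<xi>}" by (rule finite_measure_mono) auto
    then show ?thesis using null measure_nonneg[of std_gaussian] by (simp add: order_antisym)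
  qed
  also have "prob (UNIV - {g. \<bar>g\<bar> \<le> \<xi>}) = 1 - prob {g. \<bar>g\<bar> \<le> \<xi>}"
    using prob_compl[of "{g. \<bar>g\<bar> \<le> \<xi>}"] by simp
  finally show ?thesis using assms by simp
qed

lemma large_dimension_eventually:
  "\<exists>n0\<ge>2. \<forall>n \<xi>. n0 \<le> n \<and> \<xi> > 0 \<and> measure std_gaussian {g. \<bar>g\<bar> \<le> \<xi>} = 1 - 1 / real n
    \<longrightarrow> large_dimension n (n - 1) \<xi>"
proof -
  obtain x0 where x0: "\<And>x. x0 \<le> x \<Longrightarrow> sufficiently_large x"
    using eventually_sufficiently_large unfolding eventually_at_top_linorder by blast
  define x1 where "x1 = max 1 x0"
  have "0 < exp (- x1\<^sup>2 / 2) / (16 * x1)" by (simp add: x1_def)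
  also have "\<dots> \<le> gtail x1" by (rule gtail_ge) (simp add: x1_def)
  finally have g: "0 < gtail x1" .
  obtain k :: nat where k: "1 / gtail x1 < real k" using reals_Archimedean2 by blast
  show ?thesis
  proof (intro exI[of _ "max 2 k"] conjI allI impI)
    fix n :: nat and \<xi> :: real
    assume a: "max 2 k \<le> n \<and> \<xi> > 0 \<and> measure std_gaussian {g. \<bar>g\<bar> \<le> \<xi>} = 1 - 1 / real n"
    then have t: "gtail \<xi> = 1 / real n" by (intro gtail_eq) auto
    have "1 / gtail x1 < real n" using k a by simp
    then have "gtail \<xi> < gtail x1" unfolding t using g a by (simp add: field_simps)
    then have "x1 < \<xi>" using gtail_antimono[of \<xi> x1] by (meson not_le)
    then have "sufficiently_large \<xi>" by (intro x0) (simp add: x1_def)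
    then show "large_dimension n (n - 1) \<xi>" using a t by unfold_locales auto
  qed simp
qed

lemma first_regime_eventually:
  "\<exists>n1. \<forall>n\<ge>n1. 4 * real n * exp (- (real n powr (1/10) / 93312)) \<le> 1 / (2 * real n)"
proof -
  have "eventually (\<lambda>n::nat. 4 * real n * exp (- (real n powr (1/10) / 93312)) \<le> 1 / (2 * real n)) at_top"
    by real_asymp
  then show ?thesis unfolding eventually_at_top_linorder .
qed

lemma max_le_lp_norm:
  fixes x :: "nat \<Rightarrow> real"
  assumes n: "0 < n" and p: "1 \<le> p"
  defines "m \<equiv> Max ((\<lambda>i. \<bar>x i\<bar>) ` {..<n})"
  shows "m \<le> lp_norm n (ereal p) x" "lp_norm n (ereal p) x \<le> real n powr (1 / p) * m" "0 \<le> m" "m \<le> (\<Sum>i<n. \<bar>x i\<bar>)"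
proof -
  let ?S = "\<Sum>i<n. \<bar>x i\<bar> powr p"
  have fin: "finite ((\<lambda>i. \<bar>x i\<bar>) ` {..<n})" "(\<lambda>i. \<bar>x i\<bar>) ` {..<n} \<noteq> {}" using n by auto
  obtain j where j: "j < n" "m = \<bar>x j\<bar>" using Max_in[OF fin] unfolding m_def by auto
  have le: "\<bar>x i\<bar> \<le> m" if "i < n" for i unfolding m_def using that fin by (intro Max_ge) auto
  show m0: "0 \<le> m" using j by simp
  show "m \<le> (\<Sum>i<n. \<bar>x i\<bar>)" unfolding j(2) using j(1) by (intro member_le_sum) auto
  have lp: "lp_norm n (ereal p) x = ?S powr (1 / p)" by (simp add: lp_norm_def)
  have "m = (m powr p) powr (1 / p)" using m0 p by (simp add: powr_powr)
  also have "\<dots> \<le> ?S powr (1 / p)"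
    unfolding j(2) using j(1) p by (intro powr_mono2 member_le_sum) auto
  finally show "m \<le> lp_norm n (ereal p) x" unfolding lp .
  have "?S \<le> (\<Sum>i<n. m powr p)" using le p by (intro sum_mono powr_mono2) auto
  also have "\<dots> = real n * m powr p" by simp
  finally have "?S powr (1 / p) \<le> (real n * m powr p) powr (1 / p)"
    using p by (intro powr_mono2) (auto simp: sum_nonneg)
  also have "\<dots> = real n powr (1 / p) * m" using m0 p by (simp add: powr_mult powr_powr)
  finally show "lp_norm n (ereal p) x \<le> real n powr (1 / p) * m" unfolding lp .
qed

lemma lp_norm_measurable [measurable]:
  "lp_norm n (ereal p) \<in> borel_measurable (std_gaussian_vec n)"
  unfolding lp_norm_psum[abs_def] by measurable

lemma max_norm_limit:
  assumes n: "0 < n"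
  shows "(\<lambda>k. lp_norm n (ereal (real (Suc k))) x) \<longlonglongrightarrow> lp_norm n \<infinity> x"
proof -
  let ?m = "Max ((\<lambda>i. \<bar>x i\<bar>) ` {..<n})"
  have "((\<lambda>k. real n powr (1 / real (Suc k)) * ?m) \<longlonglongrightarrow> real n powr 0 * ?m)"
    using n by (intro tendsto_intros LIMSEQ_Suc[OF lim_1_over_n]) auto
  then have up: "(\<lambda>k. real n powr (1 / real (Suc k)) * ?m) \<longlonglongrightarrow> ?m" using n by simp
  have "(\<lambda>k. lp_norm n (ereal (real (Suc k))) x) \<longlonglongrightarrow> ?m"
    by (rule tendsto_sandwich[OF _ _ tendsto_const up])
       (auto intro!: always_eventually max_le_lp_norm[OF n])
  then show ?thesis by (simp add: lp_norm_def)
qed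

text \<open>Dominated convergence with the majorant \<open>n\<close> times the sum of the absolute values.\<close>

lemma var_lp_norm_limit:
  assumes n: "n = Suc N"
  shows "(\<lambda>k. var_lp_norm n (ereal (real (Suc k)))) \<longlonglongrightarrow> var_lp_norm n \<infinity>"
proof -
  let ?G = "std_gaussian_vec n"
  interpret prob_space ?G by (rule prob_space_std_gaussian_vec)
  have n0: "0 < n" using n by simp
  define F where "F k = lp_norm n (ereal (real (Suc k)))" for k
  define F' where "F' = lp_norm n \<infinity>"
  have lim: "(\<lambda>k. F k x) \<longlonglongrightarrow> F' x" for x unfolding F_def F'_def by (rule max_norm_limit[OF n0])
  have Fm [measurable]: "F k \<in> borel_measurable ?G" for k unfolding F_def by measurable
  have F'm [measurable]: "F' \<in> borel_measurable ?G"
    by (rule borel_measurable_LIMSEQ_real[OF lim]) measurable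
  define B where "B x = real n * psum 1 n x" for x
  have F0: "0 \<le> F k x" for k x unfolding F_def
    using max_le_lp_norm(1,3)[OF n0, of "real (Suc k)" x] by linarith
  have FB: "F k x \<le> B x" for k x
  proof -
    let ?m = "Max ((\<lambda>i. \<bar>x i\<bar>) ` {..<n})"
    have "F k x \<le> real n powr (1 / real (Suc k)) * ?m" unfolding F_def by (intro max_le_lp_norm[OF n0]) auto
    also have "\<dots> \<le> real n powr 1 * (\<Sum>i<n. \<bar>x i\<bar>)"
      using n max_le_lp_norm(3,4)[OF n0, of 1 x] by (intro mult_mono powr_mono) (auto simp: divide_le_eq)
    finally show ?thesis using n by (simp add: B_def psum_def)
  qed
  have B2: "integrable ?G (\<lambda>x. (B x)\<^sup>2)"
  proof -
    interpret I: iid_sum std_gaussian "\<lambda>x. \<bar>x\<bar> powr 1" by (rule iid_sum_std_gaussian) simp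
    have "integrable ?G (\<lambda>x. (psum 1 n x)\<^sup>2)"
      unfolding std_gaussian_vec_iid_law[OF order.refl] by (rule I.isum_sq_integrable)
    then show ?thesis by (simp add: B_def power_mult_distrib)
  qed
  have [measurable]: "B \<in> borel_measurable ?G" unfolding B_def[abs_def] by measurable
  have B1: "integrable ?G B" by (rule square_integrable_imp_integrable[OF _ B2]) measurable
  have Fabs: "\<bar>F k x\<bar> \<le> \<bar>B x\<bar>" for k x using F0[of k x] FB[of k x] by linarith
  have Fsq: "(F k x)\<^sup>2 \<le> (B x)\<^sup>2" for k x using F0 FB by (rule power_mono[rotated])
  have 1: "(\<lambda>k. expectation (F k)) \<longlonglongrightarrow> expectation F'"
    by (rule integral_dominated_convergence[where w = B]) (use lim F0 FB B1 in \<open>auto intro!: AE_I2\<close>)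
  have 2: "(\<lambda>k. expectation (\<lambda>x. (F k x)\<^sup>2)) \<longlonglongrightarrow> expectation (\<lambda>x. (F' x)\<^sup>2)"
    by (rule integral_dominated_convergence[where w = "\<lambda>x. (B x)\<^sup>2"])
       (use lim Fsq B2 in \<open>auto intro!: AE_I2 tendsto_power\<close>)
  have i1: "integrable ?G (F k)" for k
    by (rule Bochner_Integration.integrable_bound[OF B1]) (use Fabs in \<open>auto intro!: AE_I2\<close>)
  have i2: "integrable ?G (\<lambda>x. (F k x)\<^sup>2)" for k
    by (rule Bochner_Integration.integrable_bound[OF B2]) (use Fsq in \<open>auto intro!: AE_I2\<close>)
  have F'0: "0 \<le> F' x" for x by (rule LIMSEQ_le_const[OF lim]) (use F0 in blast)
  have F'B: "F' x \<le> B x" for x by (rule LIMSEQ_le_const2[OF lim]) (use FB in blast)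
  have F'abs: "\<bar>F' x\<bar> \<le> \<bar>B x\<bar>" for x using F'0[of x] F'B[of x] by linarith
  have F'sq: "(F' x)\<^sup>2 \<le> (B x)\<^sup>2" for x using F'0 F'B by (rule power_mono[rotated])
  have i1': "integrable ?G F'"
    by (rule Bochner_Integration.integrable_bound[OF B1]) (use F'abs in \<open>auto intro!: AE_I2\<close>)
  have i2': "integrable ?G (\<lambda>x. (F' x)\<^sup>2)"
    by (rule Bochner_Integration.integrable_bound[OF B2]) (use F'sq in \<open>auto intro!: AE_I2\<close>)
  have "(\<lambda>k. expectation (\<lambda>x. (F k x)\<^sup>2) - (expectation (F k))\<^sup>2) \<longlonglongrightarrow> expectation (\<lambda>x. (F' x)\<^sup>2) - (expectation F')\<^sup>2"
    by (intro tendsto_diff tendsto_power 1 2)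
  then show ?thesis
    unfolding var_lp_norm_def F_def[symmetric] F'_def[symmetric] using i1 i2 i1' i2' by (simp add: variance_eq)
qed

section \<open>The variance for all exponents\<close>

theorem theoremA:
  "\<exists>(n0::nat) (C::real). n0 > 0 \<and> C \<ge> 1 \<and>
    (\<forall>(n::nat) (\<xi>::real). n \<ge> n0 \<and> \<xi> > 0 \<and>
        measure std_gaussian {g. \<bar>g\<bar> \<le> \<xi>} = 1 - 1 / real n \<longrightarrow>
      (\<forall>p::real. 1 \<le> p \<and> p \<le> 2 * ln (real n) / ln (2 * exp 1) \<longrightarrow>
        inverse C * (2 powr p / p * real n powr (2 / p - 1)) \<le> var_lp_norm n (ereal p) \<and>
        var_lp_norm n (ereal p) \<le> C * (2 powr p / p * real n powr (2 / p - 1))) \<and>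
      (\<forall>p::real. 1 \<le> p \<and> 2 * ln (real n) / ln (2 * exp 1) \<le> p \<and> p \<le> \<xi>\<^sup>2 \<longrightarrow>
        (let V = exp (- (p / (2 * exp 1)) * real n powr (2 / p) + ln (real n)) /
                 (sqrt (ln (real n)) *
                   (sqrt (ln (real n)) + p - 2 * ln (real n) / ln (2 * exp 1)))
         in inverse C * V \<le> var_lp_norm n (ereal p) \<and> var_lp_norm n (ereal p) \<le> C * V)) \<and>
      (\<forall>p::ereal. 1 \<le> p \<and> ereal (\<xi>\<^sup>2) \<le> p \<longrightarrow>
        inverse C * (1 / ln (real n) * (1 - real_of_ereal (ereal (\<xi>\<^sup>2 - \<xi>) / p)))
          \<le> var_lp_norm n p \<and>
        var_lp_norm n p
          \<le> C * (1 / ln (real n) * (1 - real_of_ereal (ereal (\<xi>\<^sup>2 - \<xi>) / p)))))"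
proof -
  obtain n0 where n0: "2 \<le> n0" "\<And>n \<xi>. n0 \<le> n \<and> \<xi> > 0 \<and> measure std_gaussian {g. \<bar>g\<bar> \<le> \<xi>} = 1 - 1 / real n
    \<Longrightarrow> large_dimension n (n - 1) \<xi>" using large_dimension_eventually by blast
  obtain n1 where n1: "\<And>n. n1 \<le> n \<Longrightarrow> 4 * real n * exp (- (real n powr (1/10) / 93312)) \<le> 1 / (2 * real n)"
    using first_regime_eventually by blast
  obtain C0 where C0: "1 \<le> C0" "level_series_le C0"
    using level_series_bounded by blast
  define A where "A = 10^8 * (4 * (32 + exp (16::real)))\<^sup>2"
  define B where "B = 30000 * exp (26::real)"
  have "0 < 32 + exp (16::real)" by (intro add_pos_pos) auto
  then have AB: "0 < A" "0 < B" unfolding A_def B_def by (intro mult_pos_pos zero_less_power | simp)+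
  define C where "C = 4000000000 * C0 + A + B"
  have CA: "A \<le> C" "B \<le> C" "4000000000 * C0 \<le> C" "4000000000 \<le> C" using AB C0(1) by (auto simp: C_def)
  have C1: "1 \<le> C" using CA by simp
  have inv_le: "inverse C * t \<le> v" if "1 / c * t \<le> v" "0 \<le> t" "0 < c" "c \<le> C" for c t v :: real
  proof -
    have "inverse C \<le> 1 / c" using that by (simp add: inverse_eq_divide frac_le)
    then have "inverse C * t \<le> 1 / c * t" using that by (intro mult_right_mono) auto
    then show ?thesis using that(1) by linarith
  qed
  have mul_le: "v \<le> C * t" if "v \<le> c * t" "0 \<le> t" "c \<le> C" for c t v :: real
    using that mult_right_mono[of c C t] by linarith
  show ?thesis
  proof (rule exI[of _ "max n0 n1"], rule exI[of _ C], intro conjI allI impI)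
    show "0 < max n0 n1" using n0(1) by simp
    show "1 \<le> C" by (rule C1)
  next
    fix n :: nat and \<xi> p :: real
    assume a: "max n0 n1 \<le> n \<and> 0 < \<xi> \<and> measure std_gaussian {g. \<bar>g\<bar> \<le> \<xi>} = 1 - 1 / real n"
      and p: "1 \<le> p \<and> p \<le> 2 * ln (real n) / ln (2 * exp 1)"
    have n: "n = Suc (n - 1)" "2 \<le> n" using a n0(1) by auto
    let ?T = "2 powr p / p * real n powr (2 / p - 1)"
    have T0: "0 \<le> ?T" using p by simp
    have l: "1 / 10000000 * ?T \<le> var_lp_norm n (ereal p)" using p by (intro var_lower_first_regime[OF n(1)]) auto
    show "inverse C * ?T \<le> var_lp_norm n (ereal p)" by (rule inv_le[OF l T0]) (use CA in auto)
    have u: "var_lp_norm n (ereal p) \<le> 200000 * ?T" using p a n by (intro var_upper_first_regime[OF n(1) n1]) auto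
    show "var_lp_norm n (ereal p) \<le> C * ?T" by (rule mul_le[OF u T0]) (use CA in auto)
  next
    fix n :: nat and \<xi> p :: real
    assume a: "max n0 n1 \<le> n \<and> 0 < \<xi> \<and> measure std_gaussian {g. \<bar>g\<bar> \<le> \<xi>} = 1 - 1 / real n"
      and p: "1 \<le> p \<and> 2 * ln (real n) / ln (2 * exp 1) \<le> p \<and> p \<le> \<xi>\<^sup>2"
    interpret large_dimension n "n - 1" \<xi> using a by (intro n0(2)) auto
    let ?V = "exp (- (p / (2 * exp 1)) * real n powr (2 / p) + ln (real n)) /
                 (sqrt (ln (real n)) * (sqrt (ln (real n)) + p - 2 * ln (real n) / ln (2 * exp 1)))"
    have V0: "0 \<le> ?V"
    proof -
      have s: "0 \<le> sqrt (ln (real n))" using n_ge_10 by simp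
      then have "0 \<le> sqrt (ln (real n)) + p - 2 * ln (real n) / ln (2 * exp 1)" using p by linarith
      with s show ?thesis by (intro divide_nonneg_nonneg mult_nonneg_nonneg) auto
    qed
    have l: "1 / 400000000 * ?V \<le> var_lp_norm n (ereal p)" using p by (intro var_lower_second_regime) auto
    have u: "var_lp_norm n (ereal p) \<le> 400000000 * C0 * ?V" using p by (intro var_upper_second_regime C0) auto
    show "let V = ?V in inverse C * V \<le> var_lp_norm n (ereal p) \<and> var_lp_norm n (ereal p) \<le> C * V"
      unfolding Let_def
    proof
      show "inverse C * ?V \<le> var_lp_norm n (ereal p)" by (rule inv_le[OF l V0]) (use CA in auto)
      show "var_lp_norm n (ereal p) \<le> C * ?V" by (rule mul_le[OF u V0]) (use CA C0(1) in linarith)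
    qed
  next
    fix n :: nat and \<xi> :: real and p :: ereal
    assume a: "max n0 n1 \<le> n \<and> 0 < \<xi> \<and> measure std_gaussian {g. \<bar>g\<bar> \<le> \<xi>} = 1 - 1 / real n"
      and p: "1 \<le> p \<and> ereal (\<xi>\<^sup>2) \<le> p"
    interpret large_dimension n "n - 1" \<xi> using a by (intro n0(2)) auto
    have L0: "0 < ln (real n)" using n_ge_10 by simp
    define W where "W q = 1 / ln (real n) * (1 - (\<xi>\<^sup>2 - \<xi>) / q)" for q
    have fin: "inverse C * W q \<le> var_lp_norm n (ereal q) \<and> var_lp_norm n (ereal q) \<le> C * W q" if q: "\<xi>\<^sup>2 \<le> q" for q
    proof -
      have x0: "0 < \<xi>" using xi by simp
      have q0: "0 < q" using q x0 by (meson less_le_trans zero_less_power)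
      have W0: "0 \<le> W q"
      proof -
        have "(\<xi>\<^sup>2 - \<xi>) / q \<le> 1" using q q0 x0 by simp
        then show ?thesis using L0 by (simp add: W_def)
      qed
      show ?thesis
      proof (cases "q \<le> 2 * \<xi>\<^sup>2")
        case True
        have l: "1 / A * W q \<le> var_lp_norm n (ereal q)"
          unfolding A_def W_def by (rule var_lower_third_regime_near[OF q True])
        have u: "var_lp_norm n (ereal q) \<le> 4000000000 * C0 * W q"
          unfolding W_def by (rule var_upper_third_regime_near[OF q True C0])
        show ?thesis using inv_le[OF l W0 AB(1) CA(1)] mul_le[OF u W0 CA(3)] by blast
      next
        case False
        then have q2: "2 * \<xi>\<^sup>2 \<le> q" by simp
        have l: "1 / B * W q \<le> var_lp_norm n (ereal q)"
          unfolding B_def W_def by (rule var_lower_third_regime_far[OF q2])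
        have u: "var_lp_norm n (ereal q) \<le> 4000000000 * C0 * W q"
          unfolding W_def by (rule var_upper_third_regime_far[OF q2 C0])
        show ?thesis using inv_le[OF l W0 AB(2) CA(2)] mul_le[OF u W0 CA(3)] by blast
      qed
    qed
    have both: "inverse C * (1 / ln (real n) * (1 - real_of_ereal (ereal (\<xi>\<^sup>2 - \<xi>) / p))) \<le> var_lp_norm n p \<and>
        var_lp_norm n p \<le> C * (1 / ln (real n) * (1 - real_of_ereal (ereal (\<xi>\<^sup>2 - \<xi>) / p)))"
    proof (cases p)
      case (real q)
      have q: "\<xi>\<^sup>2 \<le> q" using p real by simp
      have "0 < \<xi>" using xi by simp
      then have "q \<noteq> 0" using q by (smt (verit) zero_less_power)
      then show ?thesis using fin[OF q] unfolding real W_def by simp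
    next
      case PInf
      obtain k0 :: nat where k0: "\<xi>\<^sup>2 \<le> real k0" using real_arch_simple by blast
      have ev: "\<forall>k\<ge>k0. inverse C * W (real (Suc k)) \<le> var_lp_norm n (ereal (real (Suc k))) \<and>
          var_lp_norm n (ereal (real (Suc k))) \<le> C * W (real (Suc k))"
        using k0 by (intro allI impI fin) auto
      have lim: "(\<lambda>k. var_lp_norm n (ereal (real (Suc k)))) \<longlonglongrightarrow> var_lp_norm n \<infinity>"
        by (rule var_lp_norm_limit[OF n])
      have "(\<lambda>k. 1 / ln (real n) * (1 - (\<xi>\<^sup>2 - \<xi>) * (1 / real (Suc k)))) \<longlonglongrightarrow> 1 / ln (real n) * (1 - (\<xi>\<^sup>2 - \<xi>) * 0)"
        by (intro tendsto_intros LIMSEQ_Suc[OF lim_1_over_n])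
      then have W: "(\<lambda>k. W (real (Suc k))) \<longlonglongrightarrow> 1 / ln (real n)" unfolding W_def by simp
      have "inverse C * (1 / ln (real n)) \<le> var_lp_norm n \<infinity>"
        by (rule LIMSEQ_le[OF tendsto_mult_left[OF W] lim]) (use ev in blast)
      moreover have "var_lp_norm n \<infinity> \<le> C * (1 / ln (real n))"
        by (rule LIMSEQ_le[OF lim tendsto_mult_left[OF W]]) (use ev in blast)
      ultimately show ?thesis unfolding PInf by simp
    next
      case MInf
      then show ?thesis using p by simp
    qed
    show "inverse C * (1 / ln (real n) * (1 - real_of_ereal (ereal (\<xi>\<^sup>2 - \<xi>) / p))) \<le> var_lp_norm n p"
      using both ..
    show "var_lp_norm n p \<le> C * (1 / ln (real n) * (1 - real_of_ereal (ereal (\<xi>\<^sup>2 - \<xi>) / p)))"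
      using both ..
  qed
qed

end
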